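(* Let $(X,\mu)$ be a $\sigma$-finite measure space, let $\mathcal{B}$ be a complex Banach space and let $\mathcal{T}=\{T_t:t\geq0\}$ be a strongly continuous semigroup on $L^2(X)$ with the contraction property. If $1<p<\infty$ then the maximal ergodic function operator $\mathcal{A}^{\mathcal{T}}_{\mathcal{B}}$, defined by \[\mathcal{A}^{\mathcal{T}}_{\mathcal{B}}F=\sup_{t>0}|\widetilde{A}(\mathcal{T},t)F|_{\mathcal{B}}\qquad\forall F\in L^p(X,\mathcal{B}),\] satisfies the inequality \[\|\mathcal{A}_{\mathcal{B}}^{\mathcal{T}}F\|_{L^p(X)}\leq2\left(\frac{p}{p-1}\right)^{1/p}\|F\|_{L^p(X,\mathcal{B})}\qquad\forall F\in L^p(X,\mathcal{B}).\]
   Context: A semigroup $\{T_t:t\ge0\}$ on $L^2(X)$ (with $T_0=I$, $T_{s+t}=T_sT_t$) has the contraction property if $\|T_tf\|_q\le\|f\|_q$ for all $f\in L^2(X)\cap L^q(X)$, $t\ge0$, $q\in[1,\infty]$; each $T_t$ then extends uniquely to a contraction of $L^p(X)$, $1\le p<\infty$, still denoted $T_t$, and for $1<p<\infty$ the extended semigroup is strongly continuous on $L^p(X)$ when the original one is strongly continuous on $L^2(X)$. For $t>0$, $A(\mathcal{T},t)$ is the operator on $L^p(X)$ given by $A(\mathcal{T},t)f=\frac1t\int_0^tT_sf\,\mathrm{d}s$. $L^p(X,\mathcal{B})$ is the Bochner space of $\mathcal{B}$-valued $p$-integrable functions, $|\cdot|_{\mathcal{B}}$ is the norm of $\mathcal{B}$,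 and $\widetilde{A}(\mathcal{T},t)$ is the tensor product extension of $A(\mathcal{T},t)$ to $L^p(X,\mathcal{B})$, i.e. the unique bounded operator with $\widetilde{A}(\mathcal{T},t)(\sum_k u_kf_k)=\sum_k u_kA(\mathcal{T},t)f_k$ for finite sums with $u_k\in\mathcal{B}$, $f_k\in L^p(X)$ (this extension exists). Since $t\mapsto\widetilde{A}(\mathcal{T},t)F$ is continuous from $(0,\infty)$ to $L^p(X,\mathcal{B})$, the supremum over $t>0$ is understood as the supremum over positive rational $t$, so it is measurable. *)

theory Defs
  imports "HOL-Probability.Essential_Supremum"
begin

text \<open>
  Elements of Lebesgue and Bochner spaces are represented by functions rather than by classes modulo
  almost everywhere equality; accordingly, all identities between them are required almost
  everywhere only.
\<close>

section \<open>Complex Banach spaces\<close>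

class complex_banach = banach +
  fixes scaleC :: "complex \<Rightarrow> 'a \<Rightarrow> 'a"  (infixr \<open>*\<^sub>C\<close> 75)
  assumes scaleC_add_right: "a *\<^sub>C (x + y) = a *\<^sub>C x + a *\<^sub>C y"
    and scaleC_add_left: "(a + b) *\<^sub>C x = a *\<^sub>C x + b *\<^sub>C x"
    and scaleC_scaleC: "a *\<^sub>C (b *\<^sub>C x) = (a * b) *\<^sub>C x"
    and scaleC_of_real: "of_real r *\<^sub>C x = r *\<^sub>R x"
    and norm_scaleC: "norm (a *\<^sub>C x) = cmod a * norm x"

instantiation complex :: complex_banach
begin

definition scaleC_complex :: "complex \<Rightarrow> complex \<Rightarrow> complex"
  where "scaleC_complex a x = a * x"

instance
  by standard (simp_all add: scaleC_complex_def algebra_simps norm_mult scaleR_conv_of_real)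

end

section \<open>Lebesgue and Bochner spaces\<close>

text \<open>Only meant for exponents \<open>r > 0\<close>.\<close>

definition ennreal_powr :: "ennreal \<Rightarrow> real \<Rightarrow> ennreal"
  where "ennreal_powr a r = (if a = \<infinity> then \<infinity> else ennreal (enn2real a powr r))"

definition Lp_norm :: "'a measure \<Rightarrow> ennreal \<Rightarrow> ('a \<Rightarrow> ennreal) \<Rightarrow> ennreal"
  where "Lp_norm M q g =
    (if q = \<infinity> then esssup M g
     else ennreal_powr (\<integral>\<^sup>+ x. ennreal_powr (g x) (enn2real q) \<partial>M) (1 / enn2real q))"

definition Bochner_norm :: "'a measure \<Rightarrow> ennreal \<Rightarrow> ('a \<Rightarrow> 'b::real_normed_vector) \<Rightarrow> ennreal"
  where "Bochner_norm M q F = Lp_norm M q (\<lambda>x. ennreal (norm (F x)))"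

text \<open>
  The target space need not be separable, so Borel measurability would be too weak.
\<close>

definition strongly_measurable :: "'a measure \<Rightarrow> ('a \<Rightarrow> 'b::real_normed_vector) \<Rightarrow> bool"
  where "strongly_measurable M F \<longleftrightarrow>
    (\<exists>s. (\<forall>n::nat. simple_function M (s n)) \<and> (\<forall>x\<in>space M. (\<lambda>n. s n x) \<longlonglongrightarrow> F x))"

lemma strongly_measurable_complex_iff:
  fixes f :: "'a \<Rightarrow> complex"
  shows "strongly_measurable M f \<longleftrightarrow> f \<in> borel_measurable M"
proof
  assume "strongly_measurable M f"
  then obtain s where s: "\<And>n::nat. simple_function M (s n)"
    and lim: "\<And>x. x \<in> space M \<Longrightarrow> (\<lambda>n. s n x) \<longlonglongrightarrow> f x"
    unfolding strongly_measurable_def by blast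
  show "f \<in> borel_measurable M"
    by (rule borel_measurable_LIMSEQ_metric[OF borel_measurable_simple_function[OF s] lim])
next
  assume "f \<in> borel_measurable M"
  from borel_measurable_implies_sequence_metric[OF this, of 0]
  show "strongly_measurable M f"
    unfolding strongly_measurable_def by blast
qed

definition Lspace :: "'a measure \<Rightarrow> ennreal \<Rightarrow> ('a \<Rightarrow> 'b::real_normed_vector) set"
  where "Lspace M q = {F. strongly_measurable M F \<and> Bochner_norm M q F < \<infinity>}"

definition bounded_operator ::
  "'a measure \<Rightarrow> ennreal \<Rightarrow> (('a \<Rightarrow> 'b::complex_banach) \<Rightarrow> ('a \<Rightarrow> 'b)) \<Rightarrow> bool"
  where "bounded_operator M q S \<longleftrightarrow>
    (\<forall>F\<in>Lspace M q. S F \<in> Lspace M q) \<and>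
    (\<forall>F\<in>Lspace M q. \<forall>G\<in>Lspace M q.
       (AE x in M. F x = G x) \<longrightarrow> (AE x in M. S F x = S G x)) \<and>
    (\<forall>F\<in>Lspace M q. \<forall>G\<in>Lspace M q. AE x in M. S (\<lambda>y. F y + G y) x = S F x + S G x) \<and>
    (\<forall>c. \<forall>F\<in>Lspace M q. AE x in M. S (\<lambda>y. c *\<^sub>C F y) x = c *\<^sub>C S F x) \<and>
    (\<exists>C::real. \<forall>F\<in>Lspace M q. Bochner_norm M q (S F) \<le> ennreal C * Bochner_norm M q F)"

section \<open>Semigroups\<close>

definition semigroup_L2 :: "'a measure \<Rightarrow> (real \<Rightarrow> ('a \<Rightarrow> complex) \<Rightarrow> ('a \<Rightarrow> complex)) \<Rightarrow> bool"
  where "semigroup_L2 M T \<longleftrightarrow>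
    (\<forall>t\<ge>0. bounded_operator M 2 (T t)) \<and>
    (\<forall>f\<in>Lspace M 2. AE x in M. T 0 f x = f x) \<and>
    (\<forall>s\<ge>0. \<forall>t\<ge>0. \<forall>f\<in>Lspace M 2. AE x in M. T (s + t) f x = T s (T t f) x)"

definition strongly_continuous_L2 ::
  "'a measure \<Rightarrow> (real \<Rightarrow> ('a \<Rightarrow> complex) \<Rightarrow> ('a \<Rightarrow> complex)) \<Rightarrow> bool"
  where "strongly_continuous_L2 M T \<longleftrightarrow>
    (\<forall>f\<in>Lspace M 2. ((\<lambda>t. Bochner_norm M 2 (\<lambda>x. T t f x - f x)) \<longlongrightarrow> 0) (at_right 0))"

definition contraction_property ::
  "'a measure \<Rightarrow> (real \<Rightarrow> ('a \<Rightarrow> complex) \<Rightarrow> ('a \<Rightarrow> complex)) \<Rightarrow> bool"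
  where "contraction_property M T \<longleftrightarrow>
    (\<forall>q\<ge>1. \<forall>t\<ge>0. \<forall>f\<in>Lspace M 2 \<inter> Lspace M q. Bochner_norm M q (T t f) \<le> Bochner_norm M q f)"

text \<open>
  The operators below are determined on \<open>L\<^sup>p\<close>, up to almost everywhere equality, by the properties
  in the scope of the choice operator.
\<close>

definition Lp_extension ::
  "'a measure \<Rightarrow> ennreal \<Rightarrow> (('a \<Rightarrow> complex) \<Rightarrow> ('a \<Rightarrow> complex)) \<Rightarrow> (('a \<Rightarrow> complex) \<Rightarrow> ('a \<Rightarrow> complex))"
  where "Lp_extension M p S = (SOME S'.
    bounded_operator M p S' \<and>
    (\<forall>f\<in>Lspace M p. Bochner_norm M p (S' f) \<le> Bochner_norm M p f) \<and>
    (\<forall>f\<in>Lspace M 2 \<inter> Lspace M p. AE x in M. S' f x = S f x))"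

text \<open>
  Riemann integral over \<open>{a..b}\<close> of a function with values in \<open>L\<^sup>p\<close>: convergence in norm of the
  Riemann sums over tagged divisions as the mesh tends to zero.
\<close>

definition Lp_has_integral ::
  "'a measure \<Rightarrow> ennreal \<Rightarrow> (real \<Rightarrow> 'a \<Rightarrow> complex) \<Rightarrow> ('a \<Rightarrow> complex) \<Rightarrow> real \<Rightarrow> real \<Rightarrow> bool"
  where "Lp_has_integral M p \<phi> g a b \<longleftrightarrow>
    g \<in> Lspace M p \<and>
    (\<forall>\<epsilon>>0. \<exists>\<delta>>0. \<forall>D. D tagged_division_of {a..b} \<and> (\<lambda>s. ball s \<delta>) fine D \<longrightarrow>
       Bochner_norm M p (\<lambda>x. (\<Sum>(s, K)\<in>D. measure lborel K *\<^sub>R \<phi> s x) - g x) < \<epsilon>)"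

definition ergodic_mean ::
  "'a measure \<Rightarrow> ennreal \<Rightarrow> (real \<Rightarrow> ('a \<Rightarrow> complex) \<Rightarrow> ('a \<Rightarrow> complex)) \<Rightarrow> real
    \<Rightarrow> ('a \<Rightarrow> complex) \<Rightarrow> ('a \<Rightarrow> complex)"
  where "ergodic_mean M p T t f =
    (\<lambda>x. (1 / t) *\<^sub>R (SOME g. Lp_has_integral M p (\<lambda>s. Lp_extension M p (T s) f) g 0 t) x)"

definition tensor_extension ::
  "'a measure \<Rightarrow> ennreal \<Rightarrow> (('a \<Rightarrow> complex) \<Rightarrow> ('a \<Rightarrow> complex))
    \<Rightarrow> (('a \<Rightarrow> 'b::complex_banach) \<Rightarrow> ('a \<Rightarrow> 'b))"
  where "tensor_extension M p S = (SOME S'.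
    bounded_operator M p S' \<and>
    (\<forall>(n::nat) u f. (\<forall>k<n. f k \<in> Lspace M p) \<longrightarrow>
       (AE x in M. S' (\<lambda>y. \<Sum>k<n. f k y *\<^sub>C u k) x = (\<Sum>k<n. S (f k) x *\<^sub>C u k))))"

text \<open>
  The supremum runs over positive rational \<open>t\<close>, which makes it measurable and, up to null sets,
  independent of the chosen representatives.
\<close>

definition maximal_ergodic ::
  "'a measure \<Rightarrow> ennreal \<Rightarrow> (real \<Rightarrow> ('a \<Rightarrow> complex) \<Rightarrow> ('a \<Rightarrow> complex))
    \<Rightarrow> ('a \<Rightarrow> 'b::complex_banach) \<Rightarrow> 'a \<Rightarrow> ennreal"
  where "maximal_ergodic M p T F x =
    (SUP t\<in>{t\<in>\<rat>. t > 0}. ennreal (norm (tensor_extension M p (ergodic_mean M p T t) F x)))"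

end

theory Submission
  imports Defs
begin

text \<open>
  Let \<open>S\<close> contract \<open>L\<^sup>1\<close> and \<open>L\<^sup>\<infinity>\<close>. Then so does its extension to finite sums of tensors
  \<open>f\<^sub>k u\<^sub>k\<close>, and Chacon's filling scheme yields a weak type \<open>(1, 1)\<close> bound with constant \<open>1\<close> for
  the maximal function of the averages of \<open>S\<close>, without recourse to a positive majorant of \<open>S\<close>.
  Cutting a function at height \<open>a\<close> and integrating the bound for the measure of the set where the
  maximal function exceeds \<open>2 a\<close> gives the strong type \<open>(p, p)\<close> bound with the constant
  \<open>2 (p / (p - 1))\<^sup>1\<^sup>/\<^sup>p\<close>. For finitely many rational times \<open>t\<close>, the operators \<open>A(T, t)\<close> are
  simultaneous limits of averages of one operator \<open>T\<^sub>h\<close> with small \<open>h\<close>; so the bound passes to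
  the ergodic means, where it also gives the existence of their tensor extensions, and then by density
  and monotone convergence to the whole Bochner space and all rational times.
\<close>

section \<open>The \<open>L\<^sup>p\<close> functional on nonnegative functions\<close>

text \<open>The difficulty is that \<open>S\<close> acts on scalar functions while the conclusion
  concerns an arbitrary Banach norm. What carries over is that the scalar contraction of
  L^\<infinity> controls more than single images: over disjoint sets of finite measure the moduli of
  the images of the indicators add up to at most 1, because coefficients of modulus at most 1 can
  align their phases. For a simple tensor with values \<open>w v\<close> on disjoint sets, both
  contraction properties then involve only the numbers \<open>norm (w v)\<close>.

  The factor 2 stems from the truncation: a function of norm at most \<open>a\<close> has averages
  of norm at most \<open>a\<close>, so where an average of the whole exceeds \<open>2 * a\<close>,
  that of the excess part exceeds \<open>a\<close>. Multiplying the resulting bound by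
  \<open>p * a powr (p - 1)\<close> and integrating over \<open>a\<close> produces
  \<open>2 powr p * (p / (p - 1))\<close>, whose \<open>p\<close>-th root is the constant.

  Extensions, integrals and tensor extensions are introduced by choice, so their existence has to be
  proved along the way. All identities hold almost everywhere only, and each step has to get by with
  countably many exceptional null sets.\<close>

lemma ennreal_powr_ennreal: "0 \<le> x \<Longrightarrow> ennreal_powr (ennreal x) r = ennreal (x powr r)"
  by (simp add: ennreal_powr_def)

lemma ennreal_powr_top [simp]: "ennreal_powr top r = top"
  by (simp add: ennreal_powr_def)

lemma ennreal_powr_0 [simp]: "ennreal_powr 0 r = 0"
  by (simp add: ennreal_powr_def)

lemma ennreal_powr_one [simp]: "ennreal_powr a 1 = a"
  by (cases a) (auto simp: ennreal_powr_def)

lemma ennreal_powr_mono: "a \<le> b \<Longrightarrow> 0 \<le> r \<Longrightarrow> ennreal_powr a r \<le> ennreal_powr b r"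
  by (cases a; cases b)
    (auto simp: ennreal_powr_ennreal top_unique intro!: ennreal_leI powr_mono2)

lemma ennreal_powr_inverse: "0 < r \<Longrightarrow> ennreal_powr (ennreal_powr a r) (1 / r) = a"
  by (cases a) (auto simp: ennreal_powr_ennreal powr_powr)

lemma ennreal_powr_inverse': "0 < r \<Longrightarrow> ennreal_powr (ennreal_powr a (1 / r)) r = a"
  using ennreal_powr_inverse[of "1 / r" a] by simp

lemma ennreal_powr_le_iff:
  assumes "0 < r"
  shows "ennreal_powr a (1 / r) \<le> b \<longleftrightarrow> a \<le> ennreal_powr b r"
  using ennreal_powr_mono[of "ennreal_powr a (1 / r)" b r] ennreal_powr_mono[of a "ennreal_powr b r" "1 / r"]
    ennreal_powr_inverse[of r b] ennreal_powr_inverse'[of r a] assms by auto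

text \<open>The case of an infinite factor rests on \<open>0 * top = 0\<close>: a power vanishes
  exactly where its base does.\<close>

lemma ennreal_powr_mult: "ennreal_powr (a * b) r = ennreal_powr a r * ennreal_powr b r"
proof (cases "a = top \<or> b = top")
  case True
  have nz: "ennreal_powr c r = 0 \<longleftrightarrow> c = 0" for c
    by (cases c) (auto simp: ennreal_powr_ennreal ennreal_eq_0_iff)
  from True show ?thesis
    by (elim disjE) (simp_all only: ennreal_powr_top nz ennreal_top_mult ennreal_mult_top ennreal_powr_0
        if_distrib[of "\<lambda>c. ennreal_powr c r"] refl)
next
  case False
  then obtain x y where "a = ennreal x" "0 \<le> x" "b = ennreal y" "0 \<le> y"
    by (metis ennreal_cases)
  then show ?thesis
    by (simp add: ennreal_powr_ennreal powr_mult flip: ennreal_mult)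
qed

text \<open>Powers to \<open>r\<close> and \<open>1 / r\<close> form a pair of inverse monotone
  maps, hence preserve suprema, infinite ones included.\<close>

lemma ennreal_powr_SUP:
  assumes "0 < r"
  shows "ennreal_powr (SUP i\<in>I. f i) r = (SUP i\<in>I. ennreal_powr (f i) r)"
proof (rule antisym)
  have *: "ennreal_powr a r \<le> b \<longleftrightarrow> a \<le> ennreal_powr b (1 / r)" for a b
    using ennreal_powr_le_iff[of "1 / r" a b] assms by simp
  show "ennreal_powr (SUP i\<in>I. f i) r \<le> (SUP i\<in>I. ennreal_powr (f i) r)"
    unfolding * by (rule SUP_least, unfold *[symmetric]) (rule SUP_upper)
  show "(SUP i\<in>I. ennreal_powr (f i) r) \<le> ennreal_powr (SUP i\<in>I. f i) r"
    using assms by (intro SUP_least ennreal_powr_mono SUP_upper) auto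
qed

lemma measurable_ennreal_powr [measurable]:
  "f \<in> borel_measurable M \<Longrightarrow> (\<lambda>x. ennreal_powr (f x) r) \<in> borel_measurable M"
proof -
  assume [measurable]: "f \<in> borel_measurable M"
  have "Measurable.pred M (\<lambda>x. f x = top)" by measurable
  then show ?thesis unfolding ennreal_powr_def infinity_ennreal_def by measurable
qed

lemma Lp_norm_real:
  "0 \<le> p \<Longrightarrow> Lp_norm M (ennreal p) g = ennreal_powr (\<integral>\<^sup>+x. ennreal_powr (g x) p \<partial>M) (1 / p)"
  by (simp add: Lp_norm_def)

lemma Lp_norm_le_iff:
  assumes "0 < p"
  shows "Lp_norm M (ennreal p) g \<le> c \<longleftrightarrow> (\<integral>\<^sup>+x. ennreal_powr (g x) p \<partial>M) \<le> ennreal_powr c p"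
  using assms by (simp add: Lp_norm_real ennreal_powr_le_iff)

lemma Lp_norm_powr:
  assumes "0 < p"
  shows "ennreal_powr (Lp_norm M (ennreal p) g) p = (\<integral>\<^sup>+x. ennreal_powr (g x) p \<partial>M)"
  using assms by (simp add: Lp_norm_real ennreal_powr_inverse')

lemma Lp_norm_mono_AE:
  assumes "0 < p" "AE x in M. g x \<le> h x"
  shows "Lp_norm M (ennreal p) g \<le> Lp_norm M (ennreal p) h"
  unfolding Lp_norm_le_iff[OF assms(1)] Lp_norm_powr[OF assms(1)]
  using assms by (intro nn_integral_mono_AE) (auto elim!: eventually_mono intro: ennreal_powr_mono)

lemma Lp_norm_cong_AE:
  assumes "0 < p" "AE x in M. g x = h x"
  shows "Lp_norm M (ennreal p) g = Lp_norm M (ennreal p) h"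
  using assms by (intro antisym Lp_norm_mono_AE) (auto elim!: eventually_mono)

lemma Lp_norm_zero [simp]: "0 < p \<Longrightarrow> Lp_norm M (ennreal p) (\<lambda>_. 0) = 0"
  by (simp add: Lp_norm_real)

lemma Lp_norm_eq_0_AE:
  assumes "0 < p" and [measurable]: "g \<in> borel_measurable M" and "Lp_norm M (ennreal p) g = 0"
  shows "AE x in M. g x = 0"
proof -
  have "(\<integral>\<^sup>+x. ennreal_powr (g x) p \<partial>M) = 0"
    using Lp_norm_powr[OF assms(1), of M g] assms(3) by simp
  then have "AE x in M. ennreal_powr (g x) p = 0"
    by (subst (asm) nn_integral_0_iff_AE) auto
  then show ?thesis
  proof eventually_elim
    case (elim x)
    with ennreal_powr_inverse[OF assms(1), of "g x"] show ?case by simp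
  qed
qed

lemma Lp_norm_cmult:
  assumes "0 < p" and [measurable]: "g \<in> borel_measurable M"
  shows "Lp_norm M (ennreal p) (\<lambda>x. c * g x) = c * Lp_norm M (ennreal p) g"
  using assms
  by (simp add: Lp_norm_real ennreal_powr_mult nn_integral_cmult ennreal_powr_inverse)

text \<open>For positive arguments this is the convexity of the power; when an argument is 0 the
  claim reduces to \<open>c powr p \<le> c\<close> on the unit interval.\<close>

lemma powr_convex_sum:
  fixes x y a b p :: real
  assumes "1 \<le> p" "0 \<le> x" "0 \<le> y" "0 \<le> a" "0 \<le> b" "a + b = 1"
  shows "(a * x + b * y) powr p \<le> a * x powr p + b * y powr p"
proof -
  have le: "c powr p \<le> c" if "0 \<le> c" "c \<le> 1" for c :: real
    using powr_mono'[of 1 p c] that assms(1) by (cases "c = 0") auto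
  consider "x = 0" | "y = 0" | "0 < x" "0 < y"
    using assms by linarith
  then show ?thesis
  proof cases
    case 1
    then show ?thesis
      using le[of b] assms by (auto simp: powr_mult intro!: mult_right_mono)
  next
    case 2
    then show ?thesis
      using le[of a] assms by (auto simp: powr_mult intro!: mult_right_mono)
  next
    case 3
    have "1 - b = a" "b \<le> 1" using assms by auto
    with 3 show ?thesis
      using convex_onD[OF powr_convex[OF assms(1)], of b x y] assms(5) by simp
  qed
qed

text \<open>Minkowski's inequality from convexity alone: if \<open>a\<close> and \<open>b\<close>
  are positive bounds for the two norms, \<open>x + y\<close> is \<open>a + b\<close> times the
  convex combination of \<open>x / a\<close> and \<open>y / b\<close> with weights
  \<open>a / (a + b)\<close> and \<open>b / (a + b)\<close>.\<close>

lemma Lp_norm_add: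
  assumes "1 \<le> p" and [measurable]: "g \<in> borel_measurable M" "h \<in> borel_measurable M"
  shows "Lp_norm M (ennreal p) (\<lambda>x. g x + h x) \<le> Lp_norm M (ennreal p) g + Lp_norm M (ennreal p) h"
proof -
  have p: "0 < p" using assms(1) by simp
  have main: "Lp_norm M (ennreal p) (\<lambda>x. g x + h x) \<le> ennreal (a + b)"
    if "0 < a" "0 < b" "Lp_norm M (ennreal p) g \<le> ennreal a" "Lp_norm M (ennreal p) h \<le> ennreal b"
    for a b
  proof -
    \<comment> \<open>\<open>A\<close> and \<open>B\<close> collect what convexity yields in front
      of the two \<open>p\<close>-th powers; they satisfy
      \<open>A * a powr p + B * b powr p = (a + b) powr p\<close>.\<close>
    define A where "A = (a + b) powr p * (a / (a + b)) * a powr - p"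
    define B where "B = (a + b) powr p * (b / (a + b)) * b powr - p"
    have AB: "0 \<le> A" "0 \<le> B" using that by (auto simp: A_def B_def)
    have pw: "ennreal_powr (u + v) p \<le> ennreal A * ennreal_powr u p + ennreal B * ennreal_powr v p" for u v
    proof (cases "u = top \<or> v = top")
      case True
      have "ennreal A \<noteq> 0" "ennreal B \<noteq> 0" using that by (auto simp: A_def B_def ennreal_eq_0_iff not_le)
      with True show ?thesis by (auto simp: ennreal_mult_top)
    next
      case False
      then obtain x y where xy: "u = ennreal x" "0 \<le> x" "v = ennreal y" "0 \<le> y"
        by (metis ennreal_cases)
      have "x + y = (a + b) * ((a / (a + b)) * (x / a) + (b / (a + b)) * (y / b))"
        using that by (simp add: add_divide_distrib[symmetric])
      then have "(x + y) powr p = (a + b) powr p * ((a / (a + b)) * (x / a) + (b / (a + b)) * (y / b)) powr p"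
        using that xy by (simp add: powr_mult)
      also have "\<dots> \<le> (a + b) powr p * ((a / (a + b)) * (x / a) powr p + (b / (a + b)) * (y / b) powr p)"
        using that xy assms(1)
        by (intro mult_left_mono powr_convex_sum) (auto simp flip: add_divide_distrib)
      also have "\<dots> = A * x powr p + B * y powr p"
        using that xy by (simp add: A_def B_def powr_divide powr_minus_divide distrib_left)
      finally show ?thesis
        using xy AB by (simp add: ennreal_powr_ennreal flip: ennreal_plus ennreal_mult)
    qed
    have "(\<integral>\<^sup>+x. ennreal_powr (g x + h x) p \<partial>M)
      \<le> (\<integral>\<^sup>+x. ennreal A * ennreal_powr (g x) p + ennreal B * ennreal_powr (h x) p \<partial>M)"
      by (intro nn_integral_mono pw)
    also have "\<dots> = ennreal A * (\<integral>\<^sup>+x. ennreal_powr (g x) p \<partial>M) + ennreal B * (\<integral>\<^sup>+x. ennreal_powr (h x) p \<partial>M)"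
      by (simp add: nn_integral_add nn_integral_cmult)
    also have "\<dots> \<le> ennreal A * ennreal_powr (ennreal a) p + ennreal B * ennreal_powr (ennreal b) p"
      using p by (intro add_mono mult_left_mono) (use that in \<open>auto simp: Lp_norm_le_iff\<close>)
    also have "\<dots> = ennreal (A * a powr p + B * b powr p)"
      using that AB by (simp add: ennreal_powr_ennreal flip: ennreal_plus ennreal_mult)
    also have "A * a powr p + B * b powr p = (a + b) powr p"
    proof -
      have "A * a powr p = (a + b) powr p * (a / (a + b))" "B * b powr p = (a + b) powr p * (b / (a + b))"
        using that by (auto simp: A_def B_def powr_minus)
      moreover have "a / (a + b) + b / (a + b) = 1"
        using that by (simp flip: add_divide_distrib)
      ultimately show ?thesis by (metis distrib_left mult.right_neutral)
    qed
    finally show ?thesis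
      using that p by (simp add: Lp_norm_le_iff ennreal_powr_ennreal del: ennreal_plus)
  qed
  show ?thesis
  proof (cases "Lp_norm M (ennreal p) g = top \<or> Lp_norm M (ennreal p) h = top")
    case False
    then obtain a b where ab: "Lp_norm M (ennreal p) g = ennreal a" "0 \<le> a"
        "Lp_norm M (ennreal p) h = ennreal b" "0 \<le> b"
      by (metis ennreal_cases)
    \<comment> \<open>\<open>main\<close> asks for positive bounds, so each finite norm is enlarged
      by \<open>e / 2\<close>.\<close>
    show ?thesis
    proof (rule ennreal_le_epsilon)
      fix e :: real
      assume "0 < e"
      then show "Lp_norm M (ennreal p) (\<lambda>x. g x + h x) \<le> Lp_norm M (ennreal p) g + Lp_norm M (ennreal p) h + ennreal e"
        using main[of "a + e / 2" "b + e / 2"] ab by (simp add: ennreal_leI add_ac flip: ennreal_plus)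
    qed
  qed auto
qed

lemma Lp_norm_sum:
  assumes "1 \<le> p" "\<And>i. i \<in> I \<Longrightarrow> g i \<in> borel_measurable M"
  shows "Lp_norm M (ennreal p) (\<lambda>x. \<Sum>i\<in>I. g i x) \<le> (\<Sum>i\<in>I. Lp_norm M (ennreal p) (g i))"
  using assms(2)
proof (induction I rule: infinite_finite_induct)
  case (insert i I)
  have "Lp_norm M (ennreal p) (\<lambda>x. g i x + (\<Sum>i\<in>I. g i x))
      \<le> Lp_norm M (ennreal p) (g i) + Lp_norm M (ennreal p) (\<lambda>x. \<Sum>i\<in>I. g i x)"
    using insert assms(1) by (intro Lp_norm_add borel_measurable_sum) auto
  also have "\<dots> \<le> Lp_norm M (ennreal p) (g i) + (\<Sum>i\<in>I. Lp_norm M (ennreal p) (g i))"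
    using insert by (intro add_left_mono) auto
  finally show ?case using insert by simp
qed (use assms(1) in auto)

lemma Lp_norm_SUP_le:
  fixes g :: "nat \<Rightarrow> 'a \<Rightarrow> ennreal"
  assumes "0 < p" "\<And>i. g i \<in> borel_measurable M" "\<And>x. x \<in> space M \<Longrightarrow> incseq (\<lambda>i. g i x)"
    and "\<And>i. Lp_norm M (ennreal p) (g i) \<le> c"
  shows "Lp_norm M (ennreal p) (\<lambda>x. SUP i. g i x) \<le> c"
proof -
  have "(\<integral>\<^sup>+x. (SUP i. ennreal_powr (g i x) p) \<partial>M) = (SUP i. \<integral>\<^sup>+x. ennreal_powr (g i x) p \<partial>M)"
    using assms
    by (intro nn_integral_monotone_convergence_SUP_AE)
      (auto simp: incseq_Suc_iff intro!: AE_I2 ennreal_powr_mono measurable_ennreal_powr)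
  also have "\<dots> \<le> ennreal_powr c p"
    using assms(4) unfolding Lp_norm_le_iff[OF assms(1)] by (rule SUP_least)
  finally show ?thesis
    using assms(1) by (simp add: Lp_norm_le_iff ennreal_powr_SUP)
qed

section \<open>Bochner spaces\<close>

lemma bounded_bilinear_scaleC: "bounded_bilinear (scaleC :: complex \<Rightarrow> 'b \<Rightarrow> 'b::complex_banach)"
proof
  fix r :: real and a :: complex and x :: 'b
  show "(r *\<^sub>R a) *\<^sub>C x = r *\<^sub>R (a *\<^sub>C x)" "a *\<^sub>C (r *\<^sub>R x) = r *\<^sub>R (a *\<^sub>C x)"
    by (simp_all add: scaleR_conv_of_real scaleC_scaleC mult.commute flip: scaleC_of_real)
  show "\<exists>K. \<forall>a (x::'b). norm (a *\<^sub>C x) \<le> norm a * norm x * K"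
    by (rule exI[of _ 1]) (simp add: norm_scaleC)
qed (simp_all add: scaleC_add_left scaleC_add_right)

lemmas scaleC_sum_right = bounded_bilinear.sum_right[OF bounded_bilinear_scaleC]
  and scaleC_sum_left = bounded_bilinear.sum_left[OF bounded_bilinear_scaleC]
  and scaleC_diff_left = bounded_bilinear.diff_left[OF bounded_bilinear_scaleC]
  and scaleC_diff_right = bounded_bilinear.diff_right[OF bounded_bilinear_scaleC]
  and scaleC_zero_left = bounded_bilinear.zero_left[OF bounded_bilinear_scaleC]
  and tendsto_scaleC = bounded_bilinear.tendsto[OF bounded_bilinear_scaleC]

lemma scaleC_complex_eq: "a *\<^sub>C (x::complex) = a * x"
  by (simp add: scaleC_complex_def)

lemma scaleC_one: "1 *\<^sub>C (x::'b::complex_banach) = x"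
  using scaleC_of_real[of 1 x] by simp

lemma scaleC_minus1: "(- 1) *\<^sub>C (x::'b::complex_banach) = - x"
  using scaleC_of_real[of "- 1" x] by simp

lemma strongly_measurable_simple: "simple_function M F \<Longrightarrow> strongly_measurable M F"
  unfolding strongly_measurable_def by (intro exI[of _ "\<lambda>_. F"]) auto

lemma strongly_measurable_compose2:
  fixes F :: "'a \<Rightarrow> 'b::real_normed_vector" and G :: "'a \<Rightarrow> 'c::real_normed_vector"
    and h :: "'b \<Rightarrow> 'c \<Rightarrow> 'd::real_normed_vector"
  assumes "strongly_measurable M F" "strongly_measurable M G"
    and h: "\<And>X Y x y. X \<longlonglongrightarrow> x \<Longrightarrow> Y \<longlonglongrightarrow> y \<Longrightarrow> (\<lambda>n. h (X n) (Y n)) \<longlonglongrightarrow> h x y"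
  shows "strongly_measurable M (\<lambda>x. h (F x) (G x))"
proof -
  from assms(1) obtain s where "\<And>n::nat. simple_function M (s n)"
    and "\<And>x. x \<in> space M \<Longrightarrow> (\<lambda>n. s n x) \<longlonglongrightarrow> F x"
    unfolding strongly_measurable_def by blast
  moreover from assms(2) obtain t where "\<And>n::nat. simple_function M (t n)"
    and "\<And>x. x \<in> space M \<Longrightarrow> (\<lambda>n. t n x) \<longlonglongrightarrow> G x"
    unfolding strongly_measurable_def by blast
  ultimately show ?thesis
    unfolding strongly_measurable_def
    using h by (intro exI[of _ "\<lambda>n x. h (s n x) (t n x)"]) (simp add: simple_function_compose2[of M _ _ h])
qed

lemma strongly_measurable_add:
  "strongly_measurable M F \<Longrightarrow> strongly_measurable M G \<Longrightarrow> strongly_measurable M (\<lambda>x. F x + G x)"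
  by (rule strongly_measurable_compose2) (auto intro: tendsto_add)

lemma strongly_measurable_diff:
  "strongly_measurable M F \<Longrightarrow> strongly_measurable M G \<Longrightarrow> strongly_measurable M (\<lambda>x. F x - G x)"
  by (rule strongly_measurable_compose2) (auto intro: tendsto_diff)

lemma strongly_measurable_const: "strongly_measurable M (\<lambda>_. c)"
  by (simp add: strongly_measurable_simple)

lemma strongly_measurable_scaleC:
  fixes F :: "'a \<Rightarrow> 'b::complex_banach"
  shows "strongly_measurable M f \<Longrightarrow> strongly_measurable M F \<Longrightarrow> strongly_measurable M (\<lambda>x. f x *\<^sub>C F x)"
  by (rule strongly_measurable_compose2) (auto intro: tendsto_scaleC)

lemma strongly_measurable_sum:
  "(\<And>i. i \<in> I \<Longrightarrow> strongly_measurable M (F i)) \<Longrightarrow> strongly_measurable M (\<lambda>x. \<Sum>i\<in>I. F i x)"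
  by (induction I rule: infinite_finite_induct)
    (auto simp: strongly_measurable_const intro: strongly_measurable_add)

lemma strongly_measurable_norm:
  assumes "strongly_measurable M F"
  shows "(\<lambda>x. norm (F x)) \<in> borel_measurable M"
proof -
  from assms obtain s where s: "\<And>n::nat. simple_function M (s n)"
    and lim: "\<And>x. x \<in> space M \<Longrightarrow> (\<lambda>n. s n x) \<longlonglongrightarrow> F x"
    unfolding strongly_measurable_def by blast
  show ?thesis
  proof (rule borel_measurable_LIMSEQ_real)
    show "(\<lambda>n. norm (s n x)) \<longlonglongrightarrow> norm (F x)" if "x \<in> space M" for x
      using lim[OF that] by (rule tendsto_norm)
    show "(\<lambda>x. norm (s n x)) \<in> borel_measurable M" for n
      using simple_function_compose1[OF s, of norm n] by (rule borel_measurable_simple_function)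
  qed
qed

abbreviation Lpn :: "'a measure \<Rightarrow> real \<Rightarrow> ('a \<Rightarrow> 'b::real_normed_vector) \<Rightarrow> ennreal"
  where "Lpn M p F \<equiv> Bochner_norm M (ennreal p) F"

abbreviation Lps :: "'a measure \<Rightarrow> real \<Rightarrow> ('a \<Rightarrow> 'b::real_normed_vector) set"
  where "Lps M p \<equiv> Lspace M (ennreal p)"

lemma LpsD: "F \<in> Lspace M q \<Longrightarrow> strongly_measurable M F" "F \<in> Lspace M q \<Longrightarrow> Bochner_norm M q F < \<infinity>"
  by (auto simp: Lspace_def)

lemma Lpn_measurable:
  "strongly_measurable M F \<Longrightarrow> (\<lambda>x. ennreal (norm (F x))) \<in> borel_measurable M"
  by (intro measurable_compose[OF strongly_measurable_norm]) auto

section \<open>Norm estimates, density, completeness and extension of operators in Bochner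
  spaces\<close>

context
  fixes M :: "'a measure" and p :: real
  assumes p: "1 \<le> p"
begin

lemma p_pos: "0 < p"
  using p by simp

lemma Lpn_cong_AE: "AE x in M. F x = G x \<Longrightarrow> Lpn M p F = Lpn M p G"
  unfolding Bochner_norm_def by (rule Lp_norm_cong_AE[OF p_pos]) (auto elim!: eventually_mono)

lemma Lpn_add_le:
  assumes "strongly_measurable M F" "strongly_measurable M G"
  shows "Lpn M p (\<lambda>x. F x + G x) \<le> Lpn M p F + Lpn M p G"
proof -
  have "Lpn M p (\<lambda>x. F x + G x) \<le> Lp_norm M (ennreal p) (\<lambda>x. ennreal (norm (F x)) + ennreal (norm (G x)))"
    unfolding Bochner_norm_def
    by (rule Lp_norm_mono_AE[OF p_pos])
      (auto simp: norm_triangle_ineq intro!: AE_I2 ennreal_leI simp flip: ennreal_plus)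
  also have "\<dots> \<le> Lpn M p F + Lpn M p G"
    unfolding Bochner_norm_def using assms by (intro Lp_norm_add p Lpn_measurable)
  finally show ?thesis .
qed

lemma Lpn_minus_commute: "Lpn M p (\<lambda>x. F x - G x) = Lpn M p (\<lambda>x. G x - F x)"
  unfolding Bochner_norm_def by (simp add: norm_minus_commute)

lemma Lpn_uminus: "Lpn M p (\<lambda>x. - F x) = Lpn M p F"
  unfolding Bochner_norm_def by simp

lemma Lpn_diff_le:
  assumes "strongly_measurable M F" "strongly_measurable M G"
  shows "Lpn M p (\<lambda>x. F x - G x) \<le> Lpn M p F + Lpn M p G"
  using Lpn_add_le[OF assms(1) strongly_measurable_diff[OF strongly_measurable_const[of _ 0] assms(2)]]
  by (simp add: Lpn_uminus)

lemma Lpn_triangle: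
  assumes "strongly_measurable M F" "strongly_measurable M G" "strongly_measurable M H"
  shows "Lpn M p (\<lambda>x. F x - H x) \<le> Lpn M p (\<lambda>x. F x - G x) + Lpn M p (\<lambda>x. G x - H x)"
  using Lpn_add_le[of "\<lambda>x. F x - G x" "\<lambda>x. G x - H x"] assms by (simp add: strongly_measurable_diff)

lemma Lpn_triangle_le:
  assumes "Lpn M p (\<lambda>x. F x - G x) \<le> ennreal a" "Lpn M p (\<lambda>x. G x - H x) \<le> ennreal b" "0 \<le> a" "0 \<le> b"
    and "strongly_measurable M F" "strongly_measurable M G" "strongly_measurable M H"
  shows "Lpn M p (\<lambda>x. F x - H x) \<le> ennreal (a + b)"
  using order_trans[OF Lpn_triangle[OF assms(5-7)] add_mono[OF assms(1,2)]] assms(3,4) by simp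

lemma Lpn_le_add_diff:
  assumes "strongly_measurable M F" "strongly_measurable M G"
  shows "Lpn M p F \<le> Lpn M p G + Lpn M p (\<lambda>x. F x - G x)"
  using Lpn_add_le[of G "\<lambda>x. F x - G x"] assms by (simp add: strongly_measurable_diff)

lemma Lpn_scaleC:
  fixes F :: "'a \<Rightarrow> 'b::complex_banach"
  assumes "strongly_measurable M F"
  shows "Lpn M p (\<lambda>x. c *\<^sub>C F x) = ennreal (cmod c) * Lpn M p F"
  unfolding Bochner_norm_def using assms
  by (simp add: norm_scaleC ennreal_mult Lp_norm_cmult[OF p_pos Lpn_measurable[OF assms]])

lemma Lpn_sum_le:
  assumes "\<And>i. i \<in> I \<Longrightarrow> strongly_measurable M (F i)"
  shows "Lpn M p (\<lambda>x. \<Sum>i\<in>I. F i x) \<le> (\<Sum>i\<in>I. Lpn M p (F i))"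
proof -
  have "Lpn M p (\<lambda>x. \<Sum>i\<in>I. F i x) \<le> Lp_norm M (ennreal p) (\<lambda>x. \<Sum>i\<in>I. ennreal (norm (F i x)))"
    unfolding Bochner_norm_def
    by (rule Lp_norm_mono_AE[OF p_pos]) (auto intro!: AE_I2 ennreal_leI norm_sum simp: sum_ennreal)
  also have "\<dots> \<le> (\<Sum>i\<in>I. Lpn M p (F i))"
    unfolding Bochner_norm_def using assms by (intro Lp_norm_sum p Lpn_measurable)
  finally show ?thesis .
qed

lemma Lps_add: "F \<in> Lps M p \<Longrightarrow> G \<in> Lps M p \<Longrightarrow> (\<lambda>x. F x + G x) \<in> Lps M p"
  unfolding Lspace_def using Lpn_add_le[of F G]
  by (auto simp: strongly_measurable_add intro: le_less_trans)

lemma Lps_diff: "F \<in> Lps M p \<Longrightarrow> G \<in> Lps M p \<Longrightarrow> (\<lambda>x. F x - G x) \<in> Lps M p"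
  unfolding Lspace_def using Lpn_diff_le[of F G]
  by (auto simp: strongly_measurable_diff intro: le_less_trans)

lemma Lps_scaleC: "(F :: 'a \<Rightarrow> 'b::complex_banach) \<in> Lps M p \<Longrightarrow> (\<lambda>x. c *\<^sub>C F x) \<in> Lps M p"
  unfolding Lspace_def
  by (auto simp: Lpn_scaleC strongly_measurable_scaleC strongly_measurable_const ennreal_mult_less_top)

lemma Lps_zero: "(\<lambda>_. 0) \<in> Lps M p"
  using p_pos by (simp add: Lspace_def strongly_measurable_const Bochner_norm_def)

lemma Lps_sum: "(\<And>i. i \<in> I \<Longrightarrow> F i \<in> Lps M p) \<Longrightarrow> (\<lambda>x. \<Sum>i\<in>I. F i x) \<in> Lps M p"
  by (induction I rule: infinite_finite_induct) (auto simp: Lps_zero intro: Lps_add)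

lemma Lpn_eq_0_AE:
  assumes "strongly_measurable M F" "Lpn M p F = 0"
  shows "AE x in M. F x = 0"
  using Lp_norm_eq_0_AE[OF p_pos Lpn_measurable[OF assms(1)]] assms(2)
  by (auto simp: Bochner_norm_def elim!: eventually_mono)

lemma Lp_norm_dominated:
  fixes h :: "nat \<Rightarrow> 'a \<Rightarrow> real"
  assumes [measurable]: "\<And>n. h n \<in> borel_measurable M" "w \<in> borel_measurable M"
    and "AE x in M. (\<lambda>n. h n x) \<longlonglongrightarrow> 0"
    and "\<And>n. AE x in M. ennreal (h n x) \<le> w x"
    and nonneg: "\<And>n x. 0 \<le> h n x"
    and "Lp_norm M (ennreal p) w < \<infinity>"
  shows "(\<lambda>n. Lp_norm M (ennreal p) (\<lambda>x. ennreal (h n x))) \<longlonglongrightarrow> 0"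
proof -
  have "(\<lambda>n. \<integral>\<^sup>+x. ennreal (h n x powr p) \<partial>M) \<longlonglongrightarrow> (\<integral>\<^sup>+x. 0 \<partial>M)"
  proof (rule nn_integral_dominated_convergence[where w="\<lambda>x. ennreal_powr (w x) p"])
    show "AE x in M. ennreal (h n x powr p) \<le> ennreal_powr (w x) p" for n
      using assms(4)[of n]
      by eventually_elim (use p_pos nonneg in \<open>auto simp flip: ennreal_powr_ennreal intro: ennreal_powr_mono\<close>)
    show "(\<integral>\<^sup>+x. ennreal_powr (w x) p \<partial>M) < \<infinity>"
      unfolding Lp_norm_powr[OF p_pos, symmetric] using assms(6) by (simp add: ennreal_powr_def)
    show "AE x in M. (\<lambda>n. ennreal (h n x powr p)) \<longlonglongrightarrow> 0"
      using assms(3)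
    proof eventually_elim
      case (elim x)
      have "(\<lambda>n. h n x powr p) \<longlonglongrightarrow> 0"
        using tendsto_powr'[OF elim tendsto_const[of p]] p_pos nonneg by auto
      then show ?case
        using tendsto_ennrealI by fastforce
    qed
  qed auto
  then have lim: "(\<lambda>n. \<integral>\<^sup>+x. ennreal (h n x powr p) \<partial>M) \<longlonglongrightarrow> 0" by simp
  show ?thesis
    unfolding order_tendsto_iff
  proof safe
    fix e :: ennreal
    assume e: "0 < e"
    then obtain d where d: "0 < d" "d < e" using dense by blast
    have "0 < ennreal_powr d p"
      using d p_pos by (cases d) (auto simp: ennreal_powr_ennreal ennreal_less_zero_iff)
    from order_tendstoD(2)[OF lim this]
    show "\<forall>\<^sub>F n in sequentially. Lp_norm M (ennreal p) (\<lambda>x. ennreal (h n x)) < e"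
    proof eventually_elim
      case (elim n)
      then have "Lp_norm M (ennreal p) (\<lambda>x. ennreal (h n x)) \<le> d"
        by (simp add: Lp_norm_le_iff[OF p_pos] ennreal_powr_ennreal nonneg)
      with d show ?case by simp
    qed
  qed auto
qed

text \<open>The given simple functions converge pointwise but may be large. Keeping
  \<open>s n x\<close> only where its norm is at most twice that of \<open>F x\<close> makes
  \<open>3 * norm (F x)\<close> a dominating function and preserves convergence:
  \<open>t n x\<close> is 0 where \<open>F x\<close> is 0 and eventually equals \<open>s n x\<close>
  elsewhere.\<close>

lemma simple_dense:
  fixes F :: "'a \<Rightarrow> 'b::real_normed_vector"
  assumes F: "F \<in> Lps M p" and e: "0 < e"
  obtains s where "simple_function M s" "s \<in> Lps M p" "Lpn M p (\<lambda>x. s x - F x) < e"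
proof -
  from F obtain s where s: "\<And>n::nat. simple_function M (s n)"
    and lim: "\<And>x. x \<in> space M \<Longrightarrow> (\<lambda>n. s n x) \<longlonglongrightarrow> F x"
    unfolding Lspace_def strongly_measurable_def by blast
  have F_meas [measurable]: "(\<lambda>x. norm (F x)) \<in> borel_measurable M"
    using F by (intro strongly_measurable_norm LpsD)
  have [measurable]: "(\<lambda>x. norm (s n x)) \<in> borel_measurable M" for n
    by (intro strongly_measurable_norm strongly_measurable_simple s)
  define t where "t n x = (if norm (s n x) \<le> 2 * norm (F x) then s n x else 0)" for n x
  have t: "simple_function M (t n)" for n
    unfolding t_def by (rule simple_function_If) (auto intro: s)
  have t_le: "norm (t n x) \<le> 2 * norm (F x)" for n x
    by (simp add: t_def)
  have w: "Lp_norm M (ennreal p) (\<lambda>x. ennreal c * ennreal (norm (F x))) < \<infinity>" for c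
    using F by (simp add: Lp_norm_cmult[OF p_pos] ennreal_mult_less_top Lspace_def Bochner_norm_def)
  have "(\<lambda>n. Lp_norm M (ennreal p) (\<lambda>x. ennreal (norm (t n x - F x)))) \<longlonglongrightarrow> 0"
  proof (rule Lp_norm_dominated[where w="\<lambda>x. ennreal 3 * ennreal (norm (F x))"])
    show "(\<lambda>x. norm (t n x - F x)) \<in> borel_measurable M" for n
      using F by (intro strongly_measurable_norm strongly_measurable_diff strongly_measurable_simple t LpsD)
    show "AE x in M. ennreal (norm (t n x - F x)) \<le> ennreal 3 * ennreal (norm (F x))" for n
    proof (rule AE_I2)
      fix x
      have "norm (t n x - F x) \<le> 3 * norm (F x)"
        using norm_triangle_ineq4[of "t n x" "F x"] t_le[of n x] by simp
      then show "ennreal (norm (t n x - F x)) \<le> ennreal 3 * ennreal (norm (F x))"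
        by (subst ennreal_mult[symmetric]) (auto intro: ennreal_leI)
    qed
    show "AE x in M. (\<lambda>n. norm (t n x - F x)) \<longlonglongrightarrow> 0"
    proof (rule AE_I2)
      fix x
      assume x: "x \<in> space M"
      have "(\<lambda>n. t n x) \<longlonglongrightarrow> F x"
      proof (cases "F x = 0")
        case False
        then have "\<forall>\<^sub>F n in sequentially. norm (s n x) < 2 * norm (F x)"
          by (intro order_tendstoD(2)[OF tendsto_norm[OF lim[OF x]]]) simp
        then have "\<forall>\<^sub>F n in sequentially. s n x = t n x"
          by eventually_elim (simp add: t_def)
        with lim[OF x] show ?thesis by (rule Lim_transform_eventually)
      next
        case True
        then have "t n x = 0" for n by (simp add: t_def)
        with True show ?thesis by simp
      qed
      then show "(\<lambda>n. norm (t n x - F x)) \<longlonglongrightarrow> 0"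
        using tendsto_norm_zero LIM_zero by blast
    qed
  qed (use w[of 3] in auto)
  from order_tendstoD(2)[OF this e] obtain n where n: "Lpn M p (\<lambda>x. t n x - F x) < e"
    unfolding Bochner_norm_def by (auto simp: eventually_sequentially)
  have "Lpn M p (t n) \<le> Lp_norm M (ennreal p) (\<lambda>x. ennreal 2 * ennreal (norm (F x)))"
    unfolding Bochner_norm_def using t_le[of n]
    by (intro Lp_norm_mono_AE[OF p_pos] AE_I2) (subst ennreal_mult[symmetric], auto intro: ennreal_leI)
  then have "t n \<in> Lps M p"
    using w[of 2] t[of n] by (auto simp: Lspace_def strongly_measurable_simple intro: le_less_trans)
  with that t n show ?thesis by blast
qed

text \<open>The Riesz-Fischer argument for a rapidly convergent sequence of simple functions. With
  simple terms the limit is strongly measurable by definition; general Cauchy sequences are reduced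
  to this case by approximation.\<close>

lemma simple_complete:
  fixes s :: "nat \<Rightarrow> 'a \<Rightarrow> 'b::banach"
  assumes s: "\<And>n. simple_function M (s n)" "\<And>n. s n \<in> Lps M p"
    and fast: "\<And>n. Lpn M p (\<lambda>x. s (Suc n) x - s n x) \<le> ennreal ((1/2) ^ n)"
  obtains G where "G \<in> Lps M p" "\<And>n. Lpn M p (\<lambda>x. s n x - G x) \<le> ennreal (2 * (1/2) ^ n)"
proof -
  define d where "d n x = norm (s (Suc n) x - s n x)" for n x
  have d_meas [measurable]: "d n \<in> borel_measurable M" for n
    unfolding d_def by (intro strongly_measurable_norm strongly_measurable_diff strongly_measurable_simple s)
  \<comment> \<open>The \<open>n\<close>-th tail of the series of increments dominates the distance
    from \<open>s n\<close> to the limit pointwise; \<open>2 * (1/2) ^ n\<close> is the tail of the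
    geometric series.\<close>
  have tail: "Lp_norm M (ennreal p) (\<lambda>x. \<Sum>k. ennreal (d (k + n) x)) \<le> ennreal (2 * (1/2) ^ n)" for n
  proof -
    have sums: "(\<lambda>k. (1/2 :: real) ^ (k + n)) sums (2 * (1/2) ^ n)"
      using sums_mult2[OF geometric_sums[of "1/2 :: real"], of "(1/2) ^ n"] by (simp add: power_add)
    have "Lp_norm M (ennreal p) (\<lambda>x. SUP m. \<Sum>k<m. ennreal (d (k + n) x)) \<le> ennreal (2 * (1/2) ^ n)"
    proof (rule Lp_norm_SUP_le[OF p_pos])
      fix m
      have "Lp_norm M (ennreal p) (\<lambda>x. \<Sum>k<m. ennreal (d (k + n) x))
          \<le> (\<Sum>k<m. Lp_norm M (ennreal p) (\<lambda>x. ennreal (d (k + n) x)))"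
        by (intro Lp_norm_sum p) auto
      also have "\<dots> \<le> (\<Sum>k<m. ennreal ((1/2) ^ (k + n)))"
        using fast by (intro sum_mono) (auto simp: d_def Bochner_norm_def)
      also have "\<dots> = ennreal (\<Sum>k<m. (1/2) ^ (k + n))"
        by (simp add: sum_ennreal)
      also have "\<dots> \<le> ennreal (2 * (1/2) ^ n)"
        unfolding sums_unique[OF sums] using sums_summable[OF sums] by (intro ennreal_leI sum_le_suminf) auto
      finally show "Lp_norm M (ennreal p) (\<lambda>x. \<Sum>k<m. ennreal (d (k + n) x)) \<le> ennreal (2 * (1/2) ^ n)" .
    qed (auto simp: incseq_Suc_iff)
    then show ?thesis by (simp add: suminf_eq_SUP)
  qed
  define w where "w x = (\<Sum>k. ennreal (d k x))" for x
  have [measurable]: "w \<in> borel_measurable M" unfolding w_def by measurable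
  have "Lp_norm M (ennreal p) w \<le> ennreal 2"
    using tail[of 0] by (simp add: w_def[abs_def])
  then have "(\<integral>\<^sup>+x. ennreal_powr (w x) p \<partial>M) \<noteq> \<infinity>"
    unfolding Lp_norm_le_iff[OF p_pos] by (auto simp: ennreal_powr_ennreal top_unique simp del: ennreal_numeral)
  then have "AE x in M. ennreal_powr (w x) p \<noteq> \<infinity>"
    by (intro nn_integral_PInf_AE) auto
  then have w_fin: "AE x in M. w x < \<infinity>"
    by eventually_elim (auto simp: ennreal_powr_def less_top split: if_splits)
  \<comment> \<open>The increments are summable on \<open>A\<close>, whose complement is a null set.
    Outside \<open>A\<close> the sequence and its limit are replaced by 0, since strong
    measurability demands convergence at every point.\<close>
  define A where "A = {x \<in> space M. w x < \<infinity>}"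
  have A: "A \<in> sets M" unfolding A_def by measurable
  have summ: "summable (\<lambda>k. d k x)" if "x \<in> A" for x
    using that by (intro summable_suminf_not_top) (auto simp: A_def w_def d_def)
  have conv: "convergent (\<lambda>n. s n x)" if "x \<in> A" for x
  proof -
    have "summable (\<lambda>k. s (Suc k) x - s k x)"
      using summ[OF that] unfolding d_def by (rule summable_norm_cancel)
    then have "(\<lambda>n. s 0 x + (\<Sum>k<n. s (Suc k) x - s k x)) \<longlonglongrightarrow> s 0 x + (\<Sum>k. s (Suc k) x - s k x)"
      by (intro tendsto_add tendsto_const summable_LIMSEQ)
    then show ?thesis
      unfolding sum_lessThan_telescope[of "\<lambda>k. s k x"] convergent_def by auto
  qed
  define G where "G x = (if x \<in> A then lim (\<lambda>n. s n x) else 0)" for x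
  have lim: "(\<lambda>n. s n x) \<longlonglongrightarrow> G x" if "x \<in> A" for x
    using conv[OF that] that by (simp add: G_def convergent_LIMSEQ_iff)
  have G_meas: "strongly_measurable M G"
    unfolding strongly_measurable_def
  proof (intro exI[of _ "\<lambda>n x. if x \<in> A then s n x else 0"] conjI allI ballI)
    show "simple_function M (\<lambda>x. if x \<in> A then s n x else 0)" for n
      using A by (intro simple_function_If_set s) auto
    show "(\<lambda>n. if x \<in> A then s n x else 0) \<longlonglongrightarrow> G x" for x
      using lim[of x] by (auto simp: G_def)
  qed
  have bound: "Lpn M p (\<lambda>x. s n x - G x) \<le> ennreal (2 * (1/2) ^ n)" for n
  proof -
    have "Lpn M p (\<lambda>x. s n x - G x) \<le> Lp_norm M (ennreal p) (\<lambda>x. \<Sum>k. ennreal (d (k + n) x))"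
      unfolding Bochner_norm_def
    proof (rule Lp_norm_mono_AE[OF p_pos])
      show "AE x in M. ennreal (norm (s n x - G x)) \<le> (\<Sum>k. ennreal (d (k + n) x))"
        using w_fin AE_space
      proof eventually_elim
        case (elim x)
        then have x: "x \<in> A" by (simp add: A_def)
        have summ': "summable (\<lambda>k. d (k + n) x)"
          using summ[OF x] by (subst summable_iff_shift[of "\<lambda>k. d k x"])
        have le: "norm (s n x - s (n + m) x) \<le> (\<Sum>k. d (k + n) x)" for m
        proof -
          have "s (n + m) x - s n x = (\<Sum>k<m. s (Suc (k + n)) x - s (k + n) x)"
            by (induction m) (auto simp: algebra_simps)
          then have "norm (s n x - s (n + m) x) \<le> (\<Sum>k<m. d (k + n) x)"
            unfolding d_def by (subst norm_minus_commute) (auto intro: norm_sum)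
          also have "\<dots> \<le> (\<Sum>k. d (k + n) x)"
            by (rule sum_le_suminf[OF summ']) (auto simp: d_def)
          finally show ?thesis .
        qed
        have "(\<lambda>m. norm (s n x - s (n + m) x)) \<longlonglongrightarrow> norm (s n x - G x)"
          using LIMSEQ_ignore_initial_segment[OF lim[OF x], of n]
          by (intro tendsto_norm tendsto_diff tendsto_const) (simp add: add.commute)
        then have "norm (s n x - G x) \<le> (\<Sum>k. d (k + n) x)"
          by (rule LIMSEQ_le_const2) (use le in auto)
        then show ?case
          using summ' by (subst suminf_ennreal2) (auto simp: d_def intro: ennreal_leI)
      qed
    qed
    with tail[of n] show ?thesis by simp
  qed
  have "Lpn M p (\<lambda>x. s 0 x - (s 0 x - G x)) \<le> Lpn M p (s 0) + Lpn M p (\<lambda>x. s 0 x - G x)"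
    using s G_meas by (intro Lpn_diff_le strongly_measurable_diff) (auto intro: LpsD)
  also have "\<dots> < \<infinity>"
    using LpsD(2)[OF s(2)[of 0]] le_less_trans[OF bound[of 0]] by simp
  finally have "G \<in> Lps M p"
    using G_meas by (simp add: Lspace_def)
  with that bound show ?thesis by blast
qed

text \<open>Each \<open>G (r k)\<close> is replaced by a simple function at distance below
  \<open>(1/2) ^ k / 4\<close>. The indices \<open>r k\<close> make the sequence Cauchy at the same
  rate, so the simple functions have geometrically small increments.\<close>

lemma Lps_complete:
  fixes G :: "nat \<Rightarrow> 'a \<Rightarrow> 'b::banach"
  assumes G: "\<And>n. G n \<in> Lps M p"
    and Cauchy: "\<And>e. 0 < e \<Longrightarrow> \<exists>K. \<forall>m\<ge>K. \<forall>n\<ge>K. Lpn M p (\<lambda>x. G m x - G n x) \<le> ennreal e"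
  obtains H where "H \<in> Lps M p" "(\<lambda>n. Lpn M p (\<lambda>x. G n x - H x)) \<longlonglongrightarrow> 0"
proof -
  have "\<exists>K. \<forall>m\<ge>K. \<forall>n\<ge>K. Lpn M p (\<lambda>x. G m x - G n x) \<le> ennreal ((1/2) ^ k / 4)" for k :: nat
    by (rule Cauchy) simp
  then obtain r where r: "\<And>k m n. r k \<le> m \<Longrightarrow> r k \<le> n \<Longrightarrow> Lpn M p (\<lambda>x. G m x - G n x) \<le> ennreal ((1/2) ^ k / 4)"
    by metis
  have "\<exists>s. simple_function M s \<and> s \<in> Lps M p \<and> Lpn M p (\<lambda>x. s x - G (r k) x) < ennreal ((1/2) ^ k / 4)" for k
    by (rule simple_dense[OF G[of "r k"], of "ennreal ((1/2) ^ k / 4)"]) auto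
  then obtain s where s: "\<And>k. simple_function M (s k)" "\<And>k. s k \<in> Lps M p"
    and sG: "\<And>k. Lpn M p (\<lambda>x. s k x - G (r k) x) < ennreal ((1/2) ^ k / 4)"
    by metis
  note meas = LpsD(1)[OF G] LpsD(1)[OF s(2)]
  have Gs: "Lpn M p (\<lambda>x. G (r k) x - s k x) \<le> ennreal ((1/2) ^ k / 4)" for k
    using less_imp_le[OF sG[of k]] by (subst Lpn_minus_commute)
  have "Lpn M p (\<lambda>x. s (Suc k) x - s k x) \<le> ennreal ((1/2) ^ k)" for k
  proof -
    \<comment> \<open>\<open>r\<close> is not known to be increasing, so the passage from
      \<open>r k\<close> to \<open>r (Suc k)\<close> goes through the larger of the two; the four
      errors add up to three quarters of \<open>(1/2) ^ k\<close>.\<close>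
    let ?m = "max (r k) (r (Suc k))"
    have "Lpn M p (\<lambda>x. G ?m x - s k x) \<le> ennreal ((1/2) ^ k / 4 + (1/2) ^ k / 4)"
      by (rule Lpn_triangle_le[where G="G (r k)"])
        (use r[of k ?m "r k"] Gs[of k] meas in auto)
    then have "Lpn M p (\<lambda>x. G (r (Suc k)) x - s k x) \<le> ennreal ((1/2) ^ Suc k / 4 + ((1/2) ^ k / 4 + (1/2) ^ k / 4))"
      by (rule Lpn_triangle_le[where G="G ?m", rotated])
        (use r[of "Suc k" "r (Suc k)" ?m] meas in auto)
    then have "Lpn M p (\<lambda>x. s (Suc k) x - s k x)
      \<le> ennreal ((1/2) ^ Suc k / 4 + ((1/2) ^ Suc k / 4 + ((1/2) ^ k / 4 + (1/2) ^ k / 4)))"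
      by (rule Lpn_triangle_le[where G="G (r (Suc k))", rotated])
        (use less_imp_le[OF sG[of "Suc k"]] meas in auto)
    also have "\<dots> \<le> ennreal ((1/2) ^ k)"
      by (rule ennreal_leI) simp
    finally show ?thesis .
  qed
  from simple_complete[OF s this] obtain H where H: "H \<in> Lps M p"
    and sH: "\<And>k. Lpn M p (\<lambda>x. s k x - H x) \<le> ennreal (2 * (1/2) ^ k)" by blast
  have GH: "Lpn M p (\<lambda>x. G n x - H x) \<le> ennreal (3 * (1/2) ^ k)" if "r k \<le> n" for n k
  proof -
    have "Lpn M p (\<lambda>x. G (r k) x - H x) \<le> ennreal ((1/2) ^ k / 4 + 2 * (1/2) ^ k)"
      by (rule Lpn_triangle_le[where G="s k"]) (use Gs[of k] sH[of k] meas LpsD(1)[OF H] in auto)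
    then have "Lpn M p (\<lambda>x. G n x - H x) \<le> ennreal ((1/2) ^ k / 4 + ((1/2) ^ k / 4 + 2 * (1/2) ^ k))"
      by (rule Lpn_triangle_le[where G="G (r k)", rotated]) (use r[OF that order_refl] meas LpsD(1)[OF H] in auto)
    also have "\<dots> \<le> ennreal (3 * (1/2) ^ k)"
      by (rule ennreal_leI) simp
    finally show ?thesis .
  qed
  have "(\<lambda>n. Lpn M p (\<lambda>x. G n x - H x)) \<longlonglongrightarrow> 0"
    unfolding order_tendsto_iff
  proof safe
    fix e :: ennreal
    assume "0 < e"
    have "(\<lambda>k. ennreal (3 * (1/2) ^ k)) \<longlonglongrightarrow> ennreal 0"
      by (intro tendsto_ennrealI tendsto_mult_right_zero LIMSEQ_power_zero) simp
    then have "\<forall>\<^sub>F k in sequentially. ennreal (3 * (1/2) ^ k) < e"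
      using \<open>0 < e\<close> by (intro order_tendstoD) auto
    then obtain k where "ennreal (3 * (1/2) ^ k) < e" by (auto simp: eventually_sequentially)
    then show "\<forall>\<^sub>F n in sequentially. Lpn M p (\<lambda>x. G n x - H x) < e"
      using GH[of k] by (intro eventually_sequentiallyI[of "r k"]) (auto intro: le_less_trans)
  qed auto
  with that H show ?thesis by blast
qed

theorem bounded_operator_extension:
  fixes R :: "('a \<Rightarrow> 'b::complex_banach) \<Rightarrow> ('a \<Rightarrow> 'b) \<Rightarrow> bool"
  assumes R_Lps: "\<And>F G. R F G \<Longrightarrow> F \<in> Lps M p \<and> G \<in> Lps M p"
    and R_add: "\<And>F G F' G'. R F G \<Longrightarrow> R F' G' \<Longrightarrow> R (\<lambda>x. F x + F' x) (\<lambda>x. G x + G' x)"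
    and R_scale: "\<And>c F G. R F G \<Longrightarrow> R (\<lambda>x. c *\<^sub>C F x) (\<lambda>x. c *\<^sub>C G x)"
    and R_bound: "\<And>F G. R F G \<Longrightarrow> Lpn M p G \<le> ennreal C * Lpn M p F"
    and R_dense: "\<And>F e. F \<in> Lps M p \<Longrightarrow> 0 < e \<Longrightarrow> \<exists>H K. R H K \<and> Lpn M p (\<lambda>x. H x - F x) \<le> ennreal e"
    and C: "0 \<le> C"
  shows "\<exists>S. bounded_operator M (ennreal p) S \<and>
    (\<forall>F\<in>Lps M p. Lpn M p (S F) \<le> ennreal C * Lpn M p F) \<and>
    (\<forall>F G. R F G \<longrightarrow> (AE x in M. S F x = G x))"
proof -
  have R_diff: "R (\<lambda>x. F x - F' x) (\<lambda>x. G x - G' x)" if "R F G" "R F' G'" for F G F' G'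
    using R_add[OF that(1) R_scale[OF that(2), of "- 1"]] by (simp add: scaleC_minus1)
  \<comment> \<open>\<open>L\<close> is the closure of \<open>R\<close> in the product of two copies
    of the space.\<close>
  define L where "L F G \<longleftrightarrow> F \<in> Lps M p \<and> G \<in> Lps M p \<and>
    (\<forall>e>0. \<exists>H K. R H K \<and> Lpn M p (\<lambda>x. H x - F x) \<le> ennreal e \<and> Lpn M p (\<lambda>x. K x - G x) \<le> ennreal e)" for F G
  have L_R: "L F G" if "R F G" for F G
    unfolding L_def using R_Lps[OF that] that p_pos
    by (intro conjI allI impI exI[of _ F] exI[of _ G]) (auto simp: Bochner_norm_def)
  have L_ex: "\<exists>G. L F G" if F: "F \<in> Lps M p" for F
  proof -
    have "\<exists>H K. R H K \<and> Lpn M p (\<lambda>x. H x - F x) \<le> ennreal (1 / Suc n)" for n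
      by (rule R_dense[OF F]) simp
    then obtain H K where HK: "\<And>n::nat. R (H n) (K n)"
      and HF: "\<And>n. Lpn M p (\<lambda>x. H n x - F x) \<le> ennreal (1 / Suc n)"
      by metis
    note meas = LpsD(1)[OF conjunct1[OF R_Lps[OF HK]]] LpsD(1)[OF conjunct2[OF R_Lps[OF HK]]] LpsD(1)[OF F]
    have small: "\<exists>N. \<forall>n\<ge>N. 1 / Suc n \<le> e" if "0 < e" for e :: real
    proof -
      obtain N where "1 / Suc N < e" using nat_approx_posE[OF \<open>0 < e\<close>] by blast
      then have "1 / Suc n \<le> e" if "N \<le> n" for n
        using that by (intro order_trans[OF _ less_imp_le[OF \<open>1 / Suc N < e\<close>]]) (simp add: frac_le)
      then show ?thesis by blast
    qed
    obtain G where G: "G \<in> Lps M p" and KG: "(\<lambda>n. Lpn M p (\<lambda>x. K n x - G x)) \<longlonglongrightarrow> 0"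
    proof (rule Lps_complete[where G=K])
      show "K n \<in> Lps M p" for n using R_Lps[OF HK] by simp
      fix e :: real
      assume e: "0 < e"
      \<comment> \<open>The bound turns a distance \<open>d\<close> of arguments into a distance
        \<open>C * d\<close> of values; the summand 1 covers \<open>C = 0\<close>.\<close>
      define d where "d = e / (C + 1)"
      have d: "0 < d" "C * d \<le> e" using e C by (auto simp: d_def field_simps)
      obtain N where N: "\<And>n. N \<le> n \<Longrightarrow> 1 / Suc n \<le> d / 2" using small[of "d / 2"] d by auto
      have HF': "Lpn M p (\<lambda>x. H n x - F x) \<le> ennreal (d / 2)" if "N \<le> n" for n
        using HF[of n] ennreal_leI[OF N[OF that]] by (rule order_trans)
      show "\<exists>N. \<forall>m\<ge>N. \<forall>n\<ge>N. Lpn M p (\<lambda>x. K m x - K n x) \<le> ennreal e"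
      proof (intro exI allI impI)
        fix m n assume mn: "N \<le> m" "N \<le> n"
        have "Lpn M p (\<lambda>x. H m x - H n x) \<le> ennreal (d / 2 + d / 2)"
          by (rule Lpn_triangle_le[where G=F])
            (use HF'[OF mn(1)] HF'[OF mn(2)] Lpn_minus_commute[of F "H n"] d meas in auto)
        then have "Lpn M p (\<lambda>x. K m x - K n x) \<le> ennreal C * ennreal d"
          by (intro order_trans[OF R_bound[OF R_diff[OF HK HK]]] mult_left_mono) auto
        also have "\<dots> = ennreal (C * d)" using C d by (simp add: ennreal_mult)
        also have "\<dots> \<le> ennreal e" using d by (intro ennreal_leI)
        finally show "Lpn M p (\<lambda>x. K m x - K n x) \<le> ennreal e" .
      qed
    qed
    have "L F G" unfolding L_def
    proof (intro conjI F G allI impI)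
      fix e :: real
      assume e: "0 < e"
      obtain N where N: "\<And>n. N \<le> n \<Longrightarrow> 1 / Suc n \<le> e" using small[OF e] by auto
      have "\<forall>\<^sub>F n in sequentially. Lpn M p (\<lambda>x. K n x - G x) < ennreal e"
        using e by (intro order_tendstoD(2)[OF KG]) simp
      then obtain n where "N \<le> n" "Lpn M p (\<lambda>x. K n x - G x) < ennreal e"
        unfolding eventually_sequentially by (metis nle_le)
      then show "\<exists>H K. R H K \<and> Lpn M p (\<lambda>x. H x - F x) \<le> ennreal e \<and> Lpn M p (\<lambda>x. K x - G x) \<le> ennreal e"
        using HK[of n] order_trans[OF HF[of n] ennreal_leI[OF N]] by (blast intro: less_imp_le)
    qed
    then show ?thesis by blast
  qed
  have L_lin: "L (\<lambda>x. F x + c *\<^sub>C F' x) (\<lambda>x. G x + c *\<^sub>C G' x)" if L: "L F G" "L F' G'" for F G F' G' c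
    unfolding L_def
  proof (intro conjI allI impI)
    show "(\<lambda>x. F x + c *\<^sub>C F' x) \<in> Lps M p" "(\<lambda>x. G x + c *\<^sub>C G' x) \<in> Lps M p"
      using L by (auto simp: L_def intro!: Lps_add Lps_scaleC)
    fix e :: real
    assume e: "0 < e"
    define d where "d = e / (1 + cmod c)"
    have "1 + cmod c \<noteq> 0" using norm_ge_zero[of c] by linarith
    then have "d * (1 + cmod c) = e" by (simp add: d_def)
    then have "d + cmod c * d = e" by (simp only: distrib_left mult.right_neutral mult.commute)
    moreover have "0 < d"
      using e by (simp add: d_def add_pos_nonneg)
    ultimately have d: "0 < d" "d + cmod c * d = e" by auto
    obtain H K where HK: "R H K" "Lpn M p (\<lambda>x. H x - F x) \<le> ennreal d" "Lpn M p (\<lambda>x. K x - G x) \<le> ennreal d"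
      using L d by (auto simp: L_def)
    obtain H' K' where HK': "R H' K'" "Lpn M p (\<lambda>x. H' x - F' x) \<le> ennreal d" "Lpn M p (\<lambda>x. K' x - G' x) \<le> ennreal d"
      using L d by (auto simp: L_def)
    have est: "Lpn M p (\<lambda>x. (X x + c *\<^sub>C X' x) - (Y x + c *\<^sub>C Y' x)) \<le> ennreal e"
      if "X \<in> Lps M p" "X' \<in> Lps M p" "Y \<in> Lps M p" "Y' \<in> Lps M p"
        "Lpn M p (\<lambda>x. X x - Y x) \<le> ennreal d" "Lpn M p (\<lambda>x. X' x - Y' x) \<le> ennreal d"
      for X X' Y Y' :: "'a \<Rightarrow> 'b"
    proof -
      have m: "strongly_measurable M (\<lambda>x. X x - Y x)" "strongly_measurable M (\<lambda>x. X' x - Y' x)"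
        using that by (auto intro!: strongly_measurable_diff intro: LpsD)
      have "(\<lambda>x. (X x + c *\<^sub>C X' x) - (Y x + c *\<^sub>C Y' x)) = (\<lambda>x. (X x - Y x) + c *\<^sub>C (X' x - Y' x))"
        by (auto simp: scaleC_diff_right)
      then have "Lpn M p (\<lambda>x. (X x + c *\<^sub>C X' x) - (Y x + c *\<^sub>C Y' x))
          \<le> Lpn M p (\<lambda>x. X x - Y x) + ennreal (cmod c) * Lpn M p (\<lambda>x. X' x - Y' x)"
        using Lpn_add_le[OF m(1) strongly_measurable_scaleC[OF strongly_measurable_const[of M c] m(2)]] m
        by (simp add: Lpn_scaleC)
      also have "\<dots> \<le> ennreal d + ennreal (cmod c) * ennreal d"
        using that by (intro add_mono mult_left_mono) auto
      also have "\<dots> = ennreal e"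
        using d by (simp flip: ennreal_mult ennreal_plus)
      finally show ?thesis .
    qed
    show "\<exists>H K. R H K \<and> Lpn M p (\<lambda>x. H x - (F x + c *\<^sub>C F' x)) \<le> ennreal e \<and>
        Lpn M p (\<lambda>x. K x - (G x + c *\<^sub>C G' x)) \<le> ennreal e"
      using R_add[OF HK(1) R_scale[OF HK'(1), of c]] R_Lps[OF HK(1)] R_Lps[OF HK'(1)] L HK HK'
      by (intro exI[of _ "\<lambda>x. H x + c *\<^sub>C H' x"] exI[of _ "\<lambda>x. K x + c *\<^sub>C K' x"]) (auto simp: L_def intro!: est)
  qed
  have L_bound: "Lpn M p G \<le> ennreal C * Lpn M p F" if L: "L F G" for F G
  proof -
    show ?thesis
    proof (rule ennreal_le_epsilon)
      fix e :: real
      assume e: "0 < e"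
      define d where "d = e / (1 + C)"
      have "d * (1 + C) = e" using C by (simp add: d_def)
      then have "d + C * d = e" by (simp only: distrib_left mult.right_neutral mult.commute)
      moreover have "0 < d"
        using e C by (simp add: d_def)
      ultimately have d: "0 < d" "d + C * d = e" by auto
      obtain H K where HK: "R H K" "Lpn M p (\<lambda>x. H x - F x) \<le> ennreal d" "Lpn M p (\<lambda>x. K x - G x) \<le> ennreal d"
        using L d by (auto simp: L_def)
      note meas = LpsD(1)[OF conjunct1[OF R_Lps[OF HK(1)]]] LpsD(1)[OF conjunct2[OF R_Lps[OF HK(1)]]]
      have F: "strongly_measurable M F" "strongly_measurable M G" using L by (auto simp: L_def intro: LpsD)
      have "Lpn M p G \<le> Lpn M p K + Lpn M p (\<lambda>x. G x - K x)"
        by (intro Lpn_le_add_diff meas F)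
      also have "\<dots> \<le> ennreal C * Lpn M p H + ennreal d"
        using R_bound[OF HK(1)] HK(3) by (intro add_mono) (auto simp: Lpn_minus_commute[of G])
      also have "\<dots> \<le> ennreal C * (Lpn M p F + ennreal d) + ennreal d"
        using Lpn_le_add_diff[of H F] meas F HK(2)
        by (intro add_mono mult_left_mono) (auto elim!: order_trans intro: add_left_mono)
      also have "\<dots> = ennreal C * Lpn M p F + ennreal e"
        using d C by (simp add: distrib_left add.assoc add.commute flip: ennreal_mult ennreal_plus)
      finally show "Lpn M p G \<le> ennreal C * Lpn M p F + ennreal e" .
    qed
  qed
  have L_unique: "AE x in M. G x = G' x" if "L F G" "L F' G'" "AE x in M. F x = F' x" for F G F' G'
  proof -
    have "Lpn M p (\<lambda>x. F x - F' x) = 0"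
      using Lpn_cong_AE[of "\<lambda>x. F x - F' x" "\<lambda>_. 0"] that(3) p_pos by (simp add: Bochner_norm_def)
    then have "Lpn M p (\<lambda>x. G x - G' x) = 0"
      using L_bound[OF L_lin[OF that(1,2), of "- 1"]] by (simp add: scaleC_minus1)
    then have "AE x in M. G x - G' x = 0"
      using that by (intro Lpn_eq_0_AE strongly_measurable_diff) (auto simp: L_def intro: LpsD)
    then show ?thesis by eventually_elim simp
  qed
  define S where "S F = (SOME G. L F G)" for F
  have S: "L F (S F)" if "F \<in> Lps M p" for F :: "'a \<Rightarrow> 'b"
    unfolding S_def using L_ex[OF that] by (rule someI_ex)
  have S_eq: "AE x in M. S F x = G x" if "L F G" for F G
    using L_unique[OF S that] that by (auto simp: L_def)
  show ?thesis
  proof (intro exI[of _ S] conjI ballI allI impI)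
    show "bounded_operator M (ennreal p) S"
      unfolding bounded_operator_def
    proof (intro conjI ballI allI impI)
      fix F :: "'a \<Rightarrow> 'b" assume F: "F \<in> Lps M p"
      show "S F \<in> Lps M p" using S[OF F] by (simp add: L_def)
      fix G :: "'a \<Rightarrow> 'b" assume G: "G \<in> Lps M p"
      show "AE x in M. S F x = S G x" if "AE x in M. F x = G x"
        using L_unique[OF S[OF F] S[OF G] that] .
      show "AE x in M. S (\<lambda>y. F y + G y) x = S F x + S G x"
        using S_eq[OF L_lin[OF S[OF F] S[OF G], of 1]] by (simp add: scaleC_one)
    next
      fix c and F :: "'a \<Rightarrow> 'b" assume F: "F \<in> Lps M p"
      \<comment> \<open>\<open>L_lin\<close> handles combinations \<open>F + c F'\<close>. A pure
        multiple is the case where the first summand is the zero function, which is related to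
        itself as the difference of a related pair with itself.\<close>
      have "L (\<lambda>_. 0) (\<lambda>_. 0)"
        using L_lin[OF S[OF F] S[OF F], of "- 1"] by (simp add: scaleC_minus1)
      from S_eq[OF L_lin[OF this S[OF F], of c]]
      show "AE x in M. S (\<lambda>y. c *\<^sub>C F y) x = c *\<^sub>C S F x" by simp
    qed (use L_bound S in blast)
  qed (use L_bound S S_eq L_R in blast)+
qed

end

section \<open>Operators contracting \<open>L\<^sup>1\<close> and \<open>L\<^sup>\<infinity>\<close>\<close>

text \<open>The functions in both L^1 and L^\<infinity>. This class is contained in every L^q with
  \<open>1 \<le> q\<close>, dense for finite \<open>q\<close>, and mapped into itself by the
  operators in question, so both contraction properties can be used and iterated on it.\<close>

definition bdd_integrable :: "'a measure \<Rightarrow> ('a \<Rightarrow> complex) set"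
  where "bdd_integrable M = {f. integrable M f \<and> (\<exists>c. AE x in M. cmod (f x) \<le> c)}"

text \<open>The sum of the elementary tensors of \<open>f k\<close> and \<open>u k\<close>. Vectors
  and components are kept as data, so that \<open>S\<close> can be applied to the components without
  first being shown independent of the representation.\<close>

definition tensor :: "nat \<Rightarrow> (nat \<Rightarrow> 'b::complex_banach) \<Rightarrow> (nat \<Rightarrow> 'a \<Rightarrow> complex) \<Rightarrow> 'a \<Rightarrow> 'b"
  where "tensor m u f x = (\<Sum>k<m. f k x *\<^sub>C u k)"

lemma bdd_integrable_measurable [measurable_dest]: "f \<in> bdd_integrable M \<Longrightarrow> f \<in> borel_measurable M"
  by (auto simp: bdd_integrable_def)

lemma bdd_integrable_integrable: "f \<in> bdd_integrable M \<Longrightarrow> integrable M f"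
  by (simp add: bdd_integrable_def)

lemma bdd_integrable_dominated:
  assumes f: "f \<in> bdd_integrable M" and [measurable]: "g \<in> borel_measurable M"
    and le: "AE x in M. cmod (g x) \<le> K * cmod (f x)" and K: "0 \<le> K"
  shows "g \<in> bdd_integrable M"
proof -
  have "integrable M g"
    by (rule Bochner_Integration.integrable_bound[of _ "\<lambda>x. of_real K * f x"])
      (use f le K in \<open>auto simp: bdd_integrable_def norm_mult\<close>)
  moreover obtain c where c: "AE x in M. cmod (f x) \<le> c"
    using f by (auto simp: bdd_integrable_def)
  have "AE x in M. cmod (g x) \<le> K * c"
    using le c by eventually_elim (use K in \<open>auto intro: order_trans mult_left_mono\<close>)
  ultimately show ?thesis by (auto simp: bdd_integrable_def)
qed

lemma bdd_integrable_add:
  assumes "f \<in> bdd_integrable M" "g \<in> bdd_integrable M"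
  shows "(\<lambda>x. f x + g x) \<in> bdd_integrable M"
proof -
  obtain c d where "AE x in M. cmod (f x) \<le> c" "AE x in M. cmod (g x) \<le> d"
    using assms by (auto simp: bdd_integrable_def)
  then have "AE x in M. cmod (f x + g x) \<le> c + d"
    by eventually_elim (rule norm_triangle_mono)
  then show ?thesis using assms by (auto simp: bdd_integrable_def)
qed

lemma bdd_integrable_mult:
  assumes "f \<in> bdd_integrable M" "r \<in> borel_measurable M" "\<And>x. cmod (r x) \<le> K"
  shows "(\<lambda>x. r x * f x) \<in> bdd_integrable M"
proof (rule bdd_integrable_dominated[OF assms(1)])
  show "(\<lambda>x. r x * f x) \<in> borel_measurable M"
    using assms by measurable
  show "0 \<le> K" using norm_ge_zero assms(3) by (rule order_trans)
qed (auto simp: norm_mult intro!: mult_right_mono assms)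

lemma bdd_integrable_scale: "f \<in> bdd_integrable M \<Longrightarrow> (\<lambda>x. (c::complex) * f x) \<in> bdd_integrable M"
  by (rule bdd_integrable_mult[where K="cmod c"]) auto

lemma bdd_integrable_zero: "(\<lambda>_. 0) \<in> bdd_integrable M"
  by (auto simp: bdd_integrable_def intro!: exI[of _ 0])

lemma bdd_integrable_diff:
  "f \<in> bdd_integrable M \<Longrightarrow> g \<in> bdd_integrable M \<Longrightarrow> (\<lambda>x. f x - g x) \<in> bdd_integrable M"
  using bdd_integrable_add[of f M "\<lambda>x. (- 1) * g x"] bdd_integrable_scale[of g M "- 1"] by simp

lemma bdd_integrable_sum:
  "(\<And>i. i \<in> I \<Longrightarrow> f i \<in> bdd_integrable M) \<Longrightarrow> (\<lambda>x. \<Sum>i\<in>I. f i x) \<in> bdd_integrable M"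
  by (induction I rule: infinite_finite_induct) (auto simp: bdd_integrable_zero bdd_integrable_add)

lemma bdd_integrable_indicator:
  "A \<in> sets M \<Longrightarrow> emeasure M A < \<infinity> \<Longrightarrow> indicator A \<in> bdd_integrable M"
proof -
  assume "A \<in> sets M" "emeasure M A < \<infinity>"
  then have "integrable M (\<lambda>x. complex_of_real (indicator A x))"
    by (intro integrable_of_real integrable_real_indicator)
  then have "complex_integrable M (indicator A)" by (simp only: of_real_indicator)
  then show ?thesis
    by (auto simp: bdd_integrable_def split: split_indicator intro!: exI[of _ 1] AE_I2)
qed

lemma tensor_add: "tensor m u (\<lambda>k x. f k x + g k x) x = tensor m u f x + tensor m u g x"
  by (simp add: tensor_def scaleC_add_left sum.distrib)

lemma tensor_diff: "tensor m u (\<lambda>k x. f k x - g k x) x = tensor m u f x - tensor m u g x"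
  by (simp add: tensor_def scaleC_diff_left sum_subtractf)

lemma tensor_mult: "tensor m u (\<lambda>k x. r x * f k x) x = r x *\<^sub>C tensor m u f x"
  by (simp add: tensor_def scaleC_sum_right scaleC_scaleC)

lemma tensor_sum: "tensor m u (\<lambda>k x. \<Sum>i\<in>I. f i k x) x = (\<Sum>i\<in>I. tensor m u (f i) x)"
  by (simp add: tensor_def scaleC_sum_left) (rule sum.swap)

lemma tensor_zero: "tensor m u (\<lambda>_ _. 0) x = 0"
  by (simp add: tensor_def scaleC_zero_left)

lemma tensor_cong: "(\<And>k. k < m \<Longrightarrow> f k x = g k x) \<Longrightarrow> tensor m u f x = tensor m u g x"
  by (simp add: tensor_def)

lemma tensor_cong_AE:
  assumes "\<And>k. AE x in M. f k x = g k x"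
  shows "AE x in M. tensor m u f x = tensor m u g x"
proof -
  have "AE x in M. \<forall>k. f k x = g k x"
    using assms by (simp add: AE_all_countable)
  then show ?thesis by eventually_elim (rule tensor_cong, simp)
qed

lemma norm_tensor_le: "norm (tensor m u f x) \<le> (\<Sum>k<m. norm (u k) * cmod (f k x))"
  unfolding tensor_def by (rule order_trans[OF norm_sum]) (simp add: norm_scaleC mult.commute)

lemma tensor_strongly_measurable:
  "(\<And>k. k < m \<Longrightarrow> f k \<in> borel_measurable M) \<Longrightarrow> strongly_measurable M (tensor m u f)"
  unfolding tensor_def[abs_def]
  by (intro strongly_measurable_sum strongly_measurable_scaleC strongly_measurable_const)
    (simp add: strongly_measurable_complex_iff)

lemma norm_tensor_measurable [measurable]:
  "(\<And>k. f k \<in> borel_measurable M) \<Longrightarrow> (\<lambda>x. norm (tensor m u f x)) \<in> borel_measurable M"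
  by (intro strongly_measurable_norm tensor_strongly_measurable)

lemma norm_tensor_integrable:
  assumes "\<And>k. f k \<in> bdd_integrable M"
  shows "integrable M (\<lambda>x. norm (tensor m u f x))"
proof (rule Bochner_Integration.integrable_bound)
  show "integrable M (\<lambda>x. \<Sum>k<m. norm (u k) * cmod (f k x))"
    using assms by (auto intro!: Bochner_Integration.integrable_sum simp: bdd_integrable_def)
  show "(\<lambda>x. norm (tensor m u f x)) \<in> borel_measurable M"
    using assms by (intro norm_tensor_measurable bdd_integrable_measurable)
  show "AE x in M. norm (norm (tensor m u f x)) \<le> norm (\<Sum>k<m. norm (u k) * cmod (f k x))"
    by (intro AE_I2) (simp add: order_trans[OF norm_tensor_le abs_ge_self])
qed

text \<open>A single simple function with tuples as values approximates all components at once. Its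
  level sets are common to the components, which yields disjoint sets on which a tensor is
  constant.\<close>

lemma tuple_simple_approx:
  assumes f: "\<And>k. f k \<in> borel_measurable M"
  obtains h :: "nat \<Rightarrow> 'a \<Rightarrow> nat \<Rightarrow> complex"
  where "\<And>n. simple_function M (h n)"
    and "\<And>k x. k < m \<Longrightarrow> x \<in> space M \<Longrightarrow> (\<lambda>n. h n x k) \<longlonglongrightarrow> f k x"
    and "\<And>n k x. x \<in> space M \<Longrightarrow> cmod (h n x k) \<le> 2 * cmod (f k x)"
proof -
  have "\<exists>F. (\<forall>i. simple_function M (F i)) \<and> (\<forall>x\<in>space M. (\<lambda>i. F i x) \<longlonglongrightarrow> f k x) \<and>
      (\<forall>i. \<forall>x\<in>space M. dist (F i x) 0 \<le> 2 * dist (f k x) 0)" for k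
    using f by (rule borel_measurable_implies_sequence_metric)
  then obtain s where s: "\<And>k i. simple_function M (s k i)"
    "\<And>k x. x \<in> space M \<Longrightarrow> (\<lambda>i. s k i x) \<longlonglongrightarrow> f k x"
    "\<And>k i x. x \<in> space M \<Longrightarrow> cmod (s k i x) \<le> 2 * cmod (f k x)"
    by simp metis
  \<comment> \<open>Setting the components from \<open>m\<close> on to 0 leaves only finitely many
    values among the infinite sequences.\<close>
  define h where "h n x k = (if k < m then s k n x else 0)" for n x k
  have "simple_function M (h n)" for n
    unfolding simple_function_def
  proof (intro conjI ballI)
    let ?J = "\<lambda>g k. if k < m then g k else (0::complex)"
    have "h n ` space M \<subseteq> ?J ` PiE {..<m} (\<lambda>k. s k n ` space M)"
    proof
      fix v assume "v \<in> h n ` space M"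
      then obtain x where "x \<in> space M" "v = h n x" by auto
      then show "v \<in> ?J ` PiE {..<m} (\<lambda>k. s k n ` space M)"
        by (intro image_eqI[of _ _ "\<lambda>k\<in>{..<m}. s k n x"]) (auto simp: h_def)
    qed
    then show "finite (h n ` space M)"
      by (rule finite_subset) (intro finite_imageI finite_PiE simple_functionD s finite_lessThan)
    fix v assume "v \<in> h n ` space M"
    then have "v k = 0" if "\<not> k < m" for k
      using that by (auto simp: h_def)
    then have "h n x = v \<longleftrightarrow> (\<forall>k\<in>{..<m}. s k n x = v k)" for x
      by (auto simp: h_def fun_eq_iff)
    then have "h n -` {v} \<inter> space M = {x \<in> space M. \<forall>k\<in>{..<m}. s k n x = v k}"
      by auto
    also have "\<dots> \<in> sets M"
    proof (intro sets.sets_Collect_finite_All)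
      show "{x \<in> space M. s k n x = v k} \<in> sets M" for k
        using simple_functionD(2)[OF s(1), of k n "{v k}"] by (simp add: vimage_def Int_def conj_commute)
    qed simp
    finally show "h n -` {v} \<inter> space M \<in> sets M" .
  qed
  moreover have "cmod (h n x k) \<le> 2 * cmod (f k x)" if "x \<in> space M" for n k x
    using s(3)[OF that] by (simp add: h_def)
  ultimately show ?thesis
    using s that[of h] by (simp add: h_def)
qed

section \<open>Finite tensors under an operator that contracts L^1 and L^\<infinity>\<close>

locale dunford_schwartz =
  fixes M :: "'a measure" and S :: "('a \<Rightarrow> complex) \<Rightarrow> 'a \<Rightarrow> complex"
  assumes S_in: "f \<in> bdd_integrable M \<Longrightarrow> S f \<in> bdd_integrable M"
    and S_cong: "f \<in> bdd_integrable M \<Longrightarrow> g \<in> bdd_integrable M \<Longrightarrow> AE x in M. f x = g x \<Longrightarrow>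
      AE x in M. S f x = S g x"
    and S_add: "f \<in> bdd_integrable M \<Longrightarrow> g \<in> bdd_integrable M \<Longrightarrow>
      AE x in M. S (\<lambda>y. f y + g y) x = S f x + S g x"
    and S_scale: "f \<in> bdd_integrable M \<Longrightarrow> AE x in M. S (\<lambda>y. z * f y) x = z * S f x"
    and S_L1: "f \<in> bdd_integrable M \<Longrightarrow> (\<integral>x. cmod (S f x) \<partial>M) \<le> (\<integral>x. cmod (f x) \<partial>M)"
    and S_Linf: "f \<in> bdd_integrable M \<Longrightarrow> AE x in M. cmod (f x) \<le> c \<Longrightarrow> AE x in M. cmod (S f x) \<le> c"
begin

lemma S_measurable [measurable]: "f \<in> bdd_integrable M \<Longrightarrow> S f \<in> borel_measurable M"
  by (intro bdd_integrable_measurable S_in)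

lemma S_zero: "AE x in M. S (\<lambda>_. 0) x = 0"
  using S_scale[OF bdd_integrable_zero, of 0] by simp

lemma S_sum:
  assumes "finite I" "\<And>i. i \<in> I \<Longrightarrow> f i \<in> bdd_integrable M"
  shows "AE x in M. S (\<lambda>y. \<Sum>i\<in>I. f i y) x = (\<Sum>i\<in>I. S (f i) x)"
  using assms
proof (induction I)
  case empty
  then show ?case using S_zero by simp
next
  case (insert i I)
  have "AE x in M. S (\<lambda>y. f i y + (\<Sum>i\<in>I. f i y)) x = S (f i) x + S (\<lambda>y. \<Sum>i\<in>I. f i y) x"
    using insert by (intro S_add bdd_integrable_sum) auto
  moreover have "AE x in M. S (\<lambda>y. \<Sum>i\<in>I. f i y) x = (\<Sum>i\<in>I. S (f i) x)"
    using insert by auto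
  ultimately show ?case by eventually_elim (use insert in simp)
qed

lemma S_diff_L1:
  assumes "f \<in> bdd_integrable M" "g \<in> bdd_integrable M"
  shows "(\<integral>x. cmod (S f x - S g x) \<partial>M) \<le> (\<integral>x. cmod (f x - g x) \<partial>M)"
proof -
  have neg: "(\<lambda>x. (- 1) * g x) \<in> bdd_integrable M"
    using assms(2) by (rule bdd_integrable_scale)
  have "AE x in M. S f x - S g x = S (\<lambda>y. f y + (- 1) * g y) x"
    using S_add[OF assms(1) neg] S_scale[OF assms(2), of "- 1"] by eventually_elim simp
  then have "(\<integral>x. cmod (S f x - S g x) \<partial>M) = (\<integral>x. cmod (S (\<lambda>y. f y + (- 1) * g y) x) \<partial>M)"
    using S_in[OF bdd_integrable_add[OF assms(1) neg]] assms
    by (intro integral_cong_AE) (auto elim!: eventually_mono)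
  also have "\<dots> \<le> (\<integral>x. cmod (f x + (- 1) * g x) \<partial>M)"
    by (intro S_L1 bdd_integrable_add assms neg)
  finally show ?thesis by simp
qed

text \<open>
  The pointwise bound on the sum of the absolute values is obtained by testing \<open>S\<close> on combinations of
  the indicators whose coefficients run through a countable dense subset of the unit disc.
\<close>

lemma S_indicators:
  assumes V: "finite V" and A: "\<And>v. v \<in> V \<Longrightarrow> A v \<in> sets M" "\<And>v. v \<in> V \<Longrightarrow> emeasure M (A v) < \<infinity>"
    and disj: "disjoint_family_on A V"
  shows "AE x in M. (\<Sum>v\<in>V. cmod (S (indicator (A v)) x)) \<le> 1"
proof -
  obtain T :: "complex set" where T: "countable T" "T \<subseteq> cball 0 1" "cball 0 1 \<subseteq> closure T"
    using separable[of "cball (0::complex) 1"] by auto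
  have "AE x in M. \<forall>z\<in>PiE V (\<lambda>_. T). cmod (\<Sum>v\<in>V. z v * S (indicator (A v)) x) \<le> 1"
  proof (subst AE_ball_countable)
    show "countable (PiE V (\<lambda>_. T))" using V T by (intro countable_PiE)
    show "\<forall>z\<in>PiE V (\<lambda>_. T). AE x in M. cmod (\<Sum>v\<in>V. z v * S (indicator (A v)) x) \<le> 1"
    proof
      fix z assume z: "z \<in> PiE V (\<lambda>_. T)"
      have D: "(\<lambda>x. z v * indicator (A v) x) \<in> bdd_integrable M" if "v \<in> V" for v
        using A that by (intro bdd_integrable_scale bdd_integrable_indicator)
      have "cmod (\<Sum>v\<in>V. z v * indicator (A v) x) \<le> 1" for x
      proof (cases "\<exists>v\<in>V. x \<in> A v")
        case True
        then obtain v where v: "v \<in> V" "x \<in> A v" by blast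
        have "x \<notin> A w" if "w \<in> V - {v}" for w
          using disj v that by (auto simp: disjoint_family_on_def)
        then have "(\<Sum>v\<in>V. z v * indicator (A v) x) = z v"
          using V v by (subst sum.remove[of _ v]) (auto intro!: sum.neutral)
        then show ?thesis using z v T by (auto simp: PiE_iff)
      next
        case False
        then have "(\<Sum>v\<in>V. z v * indicator (A v) x) = 0" by (intro sum.neutral) auto
        then show ?thesis by simp
      qed
      then have "AE x in M. cmod (S (\<lambda>y. \<Sum>v\<in>V. z v * indicator (A v) y) x) \<le> 1"
        using D by (intro S_Linf bdd_integrable_sum) auto
      moreover have "AE x in M. S (\<lambda>y. \<Sum>v\<in>V. z v * indicator (A v) y) x = (\<Sum>v\<in>V. S (\<lambda>y. z v * indicator (A v) y) x)"
        using V D by (intro S_sum)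
      moreover have "AE x in M. \<forall>v\<in>V. S (\<lambda>y. z v * indicator (A v) y) x = z v * S (indicator (A v)) x"
        using V S_scale[OF bdd_integrable_indicator[OF A]] by (subst AE_finite_all) auto
      ultimately show "AE x in M. cmod (\<Sum>v\<in>V. z v * S (indicator (A v)) x) \<le> 1"
        by eventually_elim simp
    qed
  qed
  then show ?thesis
  proof eventually_elim
    case (elim x)
    define y where "y v = S (indicator (A v)) x" for v
    have "(\<Sum>v\<in>V. cmod (y v)) \<le> 1 + e" if "0 < e" for e
    proof -
      define d where "d = e / (1 + (\<Sum>v\<in>V. cmod (y v)))"
      have pos: "0 < 1 + (\<Sum>v\<in>V. cmod (y v))" by (simp add: add_pos_nonneg sum_nonneg)
      have d: "0 < d" using that pos by (simp add: d_def)
      \<comment> \<open>The ideal coefficient is \<open>cnj (sgn (y v))\<close>, which turns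
        \<open>y v\<close> into its modulus. Replacing it by an element of \<open>T\<close> within
        \<open>d\<close> costs at most \<open>d\<close> times the sum of the moduli, and
        \<open>d\<close> was chosen to make this \<open>e - d\<close>.\<close>
      have "\<exists>z\<in>T. cmod (z - cnj (sgn (y v))) < d" for v
      proof -
        have "cnj (sgn (y v)) \<in> closure T" using T by (auto simp: norm_sgn intro!: subsetD[OF T(3)])
        then show ?thesis using d by (simp add: closure_approachable dist_norm)
      qed
      then obtain z where z: "\<And>v. z v \<in> T" "\<And>v. cmod (z v - cnj (sgn (y v))) < d" by metis
      have sgn: "cnj (sgn w) * w = of_real (cmod w)" for w
      proof (cases "w = 0")
        case False
        then show ?thesis
          by (simp add: sgn_eq complex_norm_square[symmetric] power2_eq_square mult.commute)
      qed simp
      have "(\<Sum>v\<in>V. cmod (y v)) = cmod (of_real (\<Sum>v\<in>V. cmod (y v)))"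
        unfolding norm_of_real by (simp add: sum_nonneg)
      also have "of_real (\<Sum>v\<in>V. cmod (y v)) = (\<Sum>v\<in>V. z v * y v) - (\<Sum>v\<in>V. (z v - cnj (sgn (y v))) * y v)"
        by (simp add: left_diff_distrib sum_subtractf sgn)
      also have "cmod \<dots> \<le> cmod (\<Sum>v\<in>V. z v * y v) + cmod (\<Sum>v\<in>V. (z v - cnj (sgn (y v))) * y v)"
        by (rule norm_triangle_ineq4)
      also have "\<dots> \<le> 1 + (\<Sum>v\<in>V. d * cmod (y v))"
      proof (rule add_mono)
        have "cmod (\<Sum>v\<in>V. (restrict z V) v * y v) \<le> 1"
          using z unfolding y_def by (intro bspec[OF elim]) auto
        then show "cmod (\<Sum>v\<in>V. z v * y v) \<le> 1" by simp
        have "cmod ((z v - cnj (sgn (y v))) * y v) \<le> d * cmod (y v)" for v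
          using z(2)[of v] by (auto simp: norm_mult intro!: mult_right_mono)
        then show "cmod (\<Sum>v\<in>V. (z v - cnj (sgn (y v))) * y v) \<le> (\<Sum>v\<in>V. d * cmod (y v))"
          by (intro order_trans[OF norm_sum] sum_mono)
      qed
      also have "(\<Sum>v\<in>V. d * cmod (y v)) = e - d"
      proof -
        have "d * (1 + (\<Sum>v\<in>V. cmod (y v))) = e" using pos by (simp add: d_def)
        then show ?thesis by (simp add: sum_distrib_left distrib_left)
      qed
      also have "1 + (e - d) \<le> 1 + e" using d by simp
      finally show ?thesis .
    qed
    then show ?case unfolding y_def by (rule field_le_epsilon)
  qed
qed

text \<open>The sets are the level sets of the tuple-valued function. The zero tuple is left out
  because its level set can have infinite measure; for any other value \<open>v\<close> some
  \<open>v k\<close> is nonzero, and the integrable function \<open>h x k / v k\<close> equals 1 on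
  the level set.\<close>

lemma tuple_simple_decomposition:
  fixes h :: "'a \<Rightarrow> nat \<Rightarrow> complex"
  assumes h: "simple_function M h"
    and h_in: "\<And>k. (\<lambda>x. h x k) \<in> bdd_integrable M"
  obtains V :: "(nat \<Rightarrow> complex) set" and A
  where "finite V" "V \<subseteq> h ` space M" "\<And>v. v \<in> V \<Longrightarrow> A v \<in> sets M" "\<And>v. v \<in> V \<Longrightarrow> emeasure M (A v) < \<infinity>"
    and "disjoint_family_on A V"
    and "\<And>x k. x \<in> space M \<Longrightarrow> h x k = (\<Sum>v\<in>V. v k * indicator (A v) x)"
    and "\<And>k. AE x in M. S (\<lambda>x. h x k) x = (\<Sum>v\<in>V. v k * S (indicator (A v)) x)"
proof -
  define V where "V = h ` space M - {\<lambda>_. 0}"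
  define A where "A v = h -` {v} \<inter> space M" for v
  have V: "finite V" unfolding V_def using simple_functionD(1)[OF h] by (rule finite_Diff)
  have A: "A v \<in> sets M" for v unfolding A_def by (rule simple_functionD(2)[OF h])
  have fin: "emeasure M (A v) < \<infinity>" if "v \<in> V" for v
  proof -
    have "v \<noteq> (\<lambda>_. 0)" using that by (simp add: V_def)
    then have "\<exists>k. v k \<noteq> 0" unfolding fun_eq_iff by simp
    then obtain k where k: "v k \<noteq> 0" ..
    have "integrable M (indicat_real (A v))"
    proof (rule Bochner_Integration.integrable_bound)
      show "integrable M (\<lambda>x. h x k / v k)"
        using h_in[of k] by (auto dest: bdd_integrable_integrable)
      show "AE x in M. norm (indicat_real (A v) x) \<le> norm (h x k / v k)"
        using k by (intro AE_I2) (auto simp: A_def split: split_indicator)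
    qed (use A in simp)
    then show ?thesis using A[of v] by (simp add: integrable_indicator_iff sets.Int_space_eq2)
  qed
  have disj: "disjoint_family_on A V" by (auto simp: disjoint_family_on_def A_def)
  have h_eq: "h x k = (\<Sum>v\<in>V. v k * indicator (A v) x)" if x: "x \<in> space M" for x k
  proof (cases "h x = (\<lambda>_. 0)")
    case True
    then have "(\<Sum>v\<in>V. v k * indicator (A v) x) = 0"
      by (intro sum.neutral) (auto simp: V_def A_def)
    then show ?thesis using True by simp
  next
    case False
    then have "h x \<in> V" using x by (simp add: V_def)
    then have "(\<Sum>v\<in>V. v k * indicator (A v) x) = h x k * indicator (A (h x)) x"
      using V by (subst sum.remove[of _ "h x"]) (auto intro!: sum.neutral simp: A_def)
    then show ?thesis using x by (simp add: A_def)
  qed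
  have "AE x in M. S (\<lambda>x. h x k) x = (\<Sum>v\<in>V. v k * S (indicator (A v)) x)" for k
  proof -
    have D: "(\<lambda>x. v k * indicator (A v) x) \<in> bdd_integrable M" if "v \<in> V" for v
      using A fin that by (intro bdd_integrable_scale bdd_integrable_indicator)
    have "AE x in M. S (\<lambda>x. h x k) x = S (\<lambda>x. \<Sum>v\<in>V. v k * indicator (A v) x) x"
      using D by (intro S_cong h_in bdd_integrable_sum) (auto simp: h_eq)
    moreover have "AE x in M. S (\<lambda>x. \<Sum>v\<in>V. v k * indicator (A v) x) x = (\<Sum>v\<in>V. S (\<lambda>x. v k * indicator (A v) x) x)"
      using V D by (intro S_sum)
    moreover have "AE x in M. \<forall>v\<in>V. S (\<lambda>x. v k * indicator (A v) x) x = v k * S (indicator (A v)) x"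
      using V S_scale[OF bdd_integrable_indicator[OF A fin]] by (subst AE_finite_all) auto
    ultimately show ?thesis by eventually_elim simp
  qed
  moreover have "V \<subseteq> h ` space M" by (auto simp: V_def)
  ultimately show ?thesis by (intro that[OF V _ A fin disj h_eq])
qed

text \<open>Since the sets \<open>A v\<close> are disjoint, the norm of the tensor is the sum of the
  \<open>indicator (A v) x * norm (w v)\<close> without any loss. After \<open>S\<close> has been
  applied, the triangle inequality remains: integrated term by term it gives the first bound, and
  the bound on the sum of the moduli of \<open>S (indicator (A v))\<close> gives the second.\<close>

lemma tensor_simple:
  fixes h :: "'a \<Rightarrow> nat \<Rightarrow> complex" and u :: "nat \<Rightarrow> 'b::complex_banach"
  assumes h: "simple_function M h"
    and h_in: "\<And>k. (\<lambda>x. h x k) \<in> bdd_integrable M"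
  shows tensor_simple_L1: "(\<integral>x. norm (tensor m u (\<lambda>k. S (\<lambda>x. h x k)) x) \<partial>M)
      \<le> (\<integral>x. norm (tensor m u (\<lambda>k x. h x k) x) \<partial>M)" (is ?L1)
    and tensor_simple_Linf: "(\<And>x. x \<in> space M \<Longrightarrow> norm (tensor m u (\<lambda>k x. h x k) x) \<le> a) \<Longrightarrow> 0 \<le> a \<Longrightarrow>
      AE x in M. norm (tensor m u (\<lambda>k. S (\<lambda>x. h x k)) x) \<le> a"
proof -
  obtain V A where V: "finite V" "V \<subseteq> h ` space M"
    and A: "\<And>v. v \<in> V \<Longrightarrow> A v \<in> sets M" "\<And>v. v \<in> V \<Longrightarrow> emeasure M (A v) < \<infinity>"
    and disj: "disjoint_family_on A V"
    and h_eq: "\<And>x k. x \<in> space M \<Longrightarrow> h x k = (\<Sum>v\<in>V. v k * indicator (A v) x)"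
    and Sh: "\<And>k. AE x in M. S (\<lambda>x. h x k) x = (\<Sum>v\<in>V. v k * S (indicator (A v)) x)"
    by (rule tuple_simple_decomposition[OF assms]) blast
  define w where "w v = (\<Sum>k<m. v k *\<^sub>C u k)" for v
  have tens: "tensor m u (\<lambda>k x. \<Sum>v\<in>V. v k * g v x) x = (\<Sum>v\<in>V. g v x *\<^sub>C w v)" for g and x :: 'a
    unfolding tensor_def w_def scaleC_sum_left scaleC_sum_right scaleC_scaleC
    by (subst sum.swap) (simp add: mult.commute)
  have "AE x in M. \<forall>k. S (\<lambda>x. h x k) x = (\<Sum>v\<in>V. v k * S (indicator (A v)) x)"
    using Sh by (simp add: AE_all_countable)
  then have "AE x in M. tensor m u (\<lambda>k. S (\<lambda>x. h x k)) x = (\<Sum>v\<in>V. S (indicator (A v)) x *\<^sub>C w v)"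
    unfolding tens[of "\<lambda>v. S (indicator (A v))", symmetric] by eventually_elim (rule tensor_cong, simp)
  then have le: "AE x in M. norm (tensor m u (\<lambda>k. S (\<lambda>x. h x k)) x) \<le> (\<Sum>v\<in>V. cmod (S (indicator (A v)) x) * norm (w v))"
    by eventually_elim (auto simp: norm_scaleC intro!: order_trans[OF norm_sum])
  have th: "tensor m u (\<lambda>k x. h x k) x = (\<Sum>v\<in>V. indicator (A v) x *\<^sub>C w v)" if "x \<in> space M" for x
    unfolding tens[of "\<lambda>v. indicator (A v)", symmetric] using that by (intro tensor_cong h_eq)
  have nt: "norm (tensor m u (\<lambda>k x. h x k) x) = (\<Sum>v\<in>V. indicator (A v) x * norm (w v))" if x: "x \<in> space M" for x
  proof (cases "\<exists>v\<in>V. x \<in> A v")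
    case True
    then obtain v where v: "v \<in> V" "x \<in> A v" by blast
    have "x \<notin> A w" if "w \<in> V - {v}" for w
      using disj v that by (auto simp: disjoint_family_on_def)
    then have "(\<Sum>v\<in>V. indicator (A v) x * norm (w v)) = norm (w v)" "(\<Sum>v\<in>V. indicator (A v) x *\<^sub>C w v) = w v"
      using V v by (auto simp: sum.remove[of _ v] scaleC_one scaleC_zero_left intro!: sum.neutral)
    then show ?thesis using th[OF x] by simp
  next
    case False
    then have "(\<Sum>v\<in>V. indicator (A v) x * norm (w v)) = 0" "(\<Sum>v\<in>V. indicator (A v) x *\<^sub>C w v) = 0"
      by (auto simp: scaleC_zero_left intro!: sum.neutral)
    then show ?thesis using th[OF x] by simp
  qed
  have ind: "indicator (A v) \<in> bdd_integrable M" if "v \<in> V" for v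
    using A that by (intro bdd_integrable_indicator)
  have indr: "integrable M (indicat_real (A v))" if "v \<in> V" for v
    using A that by (intro integrable_real_indicator)
  show ?L1
  proof -
    have "(\<integral>x. norm (tensor m u (\<lambda>k. S (\<lambda>x. h x k)) x) \<partial>M)
        \<le> (\<integral>x. (\<Sum>v\<in>V. cmod (S (indicator (A v)) x) * norm (w v)) \<partial>M)"
      using ind h_in by (intro integral_mono_AE le norm_tensor_integrable S_in Bochner_Integration.integrable_sum)
        (auto intro!: integrable_norm bdd_integrable_integrable S_in)
    also have "\<dots> = (\<Sum>v\<in>V. (\<integral>x. cmod (S (indicator (A v)) x) \<partial>M) * norm (w v))"
      using ind by (subst Bochner_Integration.integral_sum)
        (auto intro!: integrable_norm bdd_integrable_integrable S_in)
    also have "\<dots> \<le> (\<Sum>v\<in>V. (\<integral>x. cmod (indicator (A v) x) \<partial>M) * norm (w v))"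
      using ind by (intro sum_mono mult_right_mono S_L1) auto
    also have "\<dots> = (\<Sum>v\<in>V. (\<integral>x. indicator (A v) x \<partial>M) * norm (w v))"
      by (intro sum.cong refl arg_cong2[where f="(*)"] Bochner_Integration.integral_cong) (simp_all split: split_indicator)
    also have "\<dots> = (\<integral>x. (\<Sum>v\<in>V. indicator (A v) x * norm (w v)) \<partial>M)"
      using indr by (subst Bochner_Integration.integral_sum) auto
    also have "\<dots> = (\<integral>x. norm (tensor m u (\<lambda>k x. h x k) x) \<partial>M)"
      by (intro Bochner_Integration.integral_cong) (auto simp: nt)
    finally show ?thesis .
  qed
  show "AE x in M. norm (tensor m u (\<lambda>k. S (\<lambda>x. h x k)) x) \<le> a"
    if a: "\<And>x. x \<in> space M \<Longrightarrow> norm (tensor m u (\<lambda>k x. h x k) x) \<le> a" "0 \<le> a"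
  proof -
    \<comment> \<open>Every \<open>v\<close> in \<open>V\<close> is a value of \<open>h\<close>, but
      possibly attained on a null set only; the hypothesis is therefore imposed at every point of
      the space.\<close>
    have w: "norm (w v) \<le> a" if v: "v \<in> V" for v
    proof -
      obtain x where "x \<in> space M" "v = h x" using v V by auto
      then show ?thesis using a(1)[of x] by (simp add: tensor_def w_def)
    qed
    have "AE x in M. (\<Sum>v\<in>V. cmod (S (indicator (A v)) x)) \<le> 1"
      using V A disj by (intro S_indicators) auto
    with le show ?thesis
    proof eventually_elim
      case (elim x)
      note elim(1)
      also have "(\<Sum>v\<in>V. cmod (S (indicator (A v)) x) * norm (w v)) \<le> (\<Sum>v\<in>V. cmod (S (indicator (A v)) x) * a)"
        using w by (intro sum_mono mult_left_mono) auto
      also have "\<dots> \<le> 1 * a"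
        unfolding sum_distrib_right[symmetric] using elim(2) a(2) by (intro mult_right_mono)
      finally show ?case by simp
    qed
  qed
qed

text \<open>This estimate depends on the representation through the numbers
  \<open>norm (u k)\<close> and is no contraction; it serves to control approximation errors that
  tend to 0 for fixed \<open>m\<close> and \<open>u\<close>.\<close>

lemma tensor_S_diff_L1:
  assumes "\<And>k. f k \<in> bdd_integrable M" "\<And>k. g k \<in> bdd_integrable M"
  shows "(\<integral>x. norm (tensor m u (\<lambda>k. S (f k)) x - tensor m u (\<lambda>k. S (g k)) x) \<partial>M)
    \<le> (\<Sum>k<m. norm (u k) * (\<integral>x. cmod (f k x - g k x) \<partial>M))"
proof -
  have D: "(\<lambda>x. S (f k) x - S (g k) x) \<in> bdd_integrable M" for k
    using assms by (intro bdd_integrable_diff S_in)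
  have "(\<integral>x. norm (tensor m u (\<lambda>k. S (f k)) x - tensor m u (\<lambda>k. S (g k)) x) \<partial>M)
    = (\<integral>x. norm (tensor m u (\<lambda>k x. S (f k) x - S (g k) x) x) \<partial>M)"
    by (simp add: tensor_diff)
  also have "\<dots> \<le> (\<integral>x. (\<Sum>k<m. norm (u k) * cmod (S (f k) x - S (g k) x)) \<partial>M)"
    using D by (intro integral_mono norm_tensor_le norm_tensor_integrable Bochner_Integration.integrable_sum
        integrable_mult_right integrable_norm bdd_integrable_integrable)
  also have "\<dots> = (\<Sum>k<m. norm (u k) * (\<integral>x. cmod (S (f k) x - S (g k) x) \<partial>M))"
    using D by (subst Bochner_Integration.integral_sum) (auto intro!: integrable_norm dest: bdd_integrable_integrable)
  also have "\<dots> \<le> (\<Sum>k<m. norm (u k) * (\<integral>x. cmod (f k x - g k x) \<partial>M))"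
    using assms by (intro sum_mono mult_left_mono S_diff_L1) auto
  finally show ?thesis .
qed

lemma bdd_integrable_L1_approx:
  fixes h :: "nat \<Rightarrow> 'a \<Rightarrow> complex"
  assumes f: "f \<in> bdd_integrable M" and [measurable]: "\<And>n. h n \<in> borel_measurable M"
    and lim: "AE x in M. (\<lambda>n. h n x) \<longlonglongrightarrow> f x"
    and le: "\<And>n x. x \<in> space M \<Longrightarrow> cmod (h n x) \<le> 2 * cmod (f x)"
  shows "(\<lambda>n. \<integral>x. cmod (h n x - f x) \<partial>M) \<longlonglongrightarrow> 0"
proof -
  have "(\<lambda>n. \<integral>x. cmod (h n x - f x) \<partial>M) \<longlonglongrightarrow> (\<integral>x. 0 \<partial>M)"
  proof (rule integral_dominated_convergence[where w="\<lambda>x. 3 * cmod (f x)"])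
    show "AE x in M. norm (cmod (h n x - f x)) \<le> 3 * cmod (f x)" for n
    proof (rule AE_I2)
      fix x assume "x \<in> space M"
      then show "norm (cmod (h n x - f x)) \<le> 3 * cmod (f x)"
        using norm_triangle_ineq4[of "h n x" "f x"] le[of x n] by simp
    qed
    show "AE x in M. (\<lambda>n. cmod (h n x - f x)) \<longlonglongrightarrow> 0"
      using lim by eventually_elim (auto intro: tendsto_norm_zero LIM_zero)
  qed (use f in \<open>auto dest: bdd_integrable_integrable\<close>)
  then show ?thesis by simp
qed

text \<open>The contraction holds for simple approximants with common level sets. Passing between
  them and \<open>f\<close> costs at most \<open>\<epsilon> n\<close> on either side, and
  \<open>\<epsilon> n\<close> tends to 0 by dominated convergence in each component.\<close>

lemma tensor_S_L1:
  assumes f: "\<And>k. f k \<in> bdd_integrable M"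
  shows "(\<integral>x. norm (tensor m u (\<lambda>k. S (f k)) x) \<partial>M) \<le> (\<integral>x. norm (tensor m u f x) \<partial>M)"
proof -
  obtain h where h: "\<And>n. simple_function M (h n)"
    "\<And>k x. k < m \<Longrightarrow> x \<in> space M \<Longrightarrow> (\<lambda>n. h n x k) \<longlonglongrightarrow> f k x"
    "\<And>n k x. x \<in> space M \<Longrightarrow> cmod (h n x k) \<le> 2 * cmod (f k x)"
    using tuple_simple_approx[of f M m] f by (metis bdd_integrable_measurable)
  have h_meas: "(\<lambda>x. h n x k) \<in> borel_measurable M" for n k
    using simple_function_compose1[OF h(1), of "\<lambda>v. v k" n] by (rule borel_measurable_simple_function)
  have h_in: "(\<lambda>x. h n x k) \<in> bdd_integrable M" for n k
    using h by (intro bdd_integrable_dominated[OF f[of k] h_meas, of _ _ 2] AE_I2) auto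
  define \<epsilon> where "\<epsilon> n = (\<Sum>k<m. norm (u k) * (\<integral>x. cmod (h n x k - f k x) \<partial>M))" for n
  have \<epsilon>: "\<epsilon> \<longlonglongrightarrow> 0"
    unfolding \<epsilon>_def using h f h_meas
    by (intro tendsto_null_sum tendsto_mult_right_zero bdd_integrable_L1_approx AE_I2) auto
  have "(\<integral>x. norm (tensor m u (\<lambda>k. S (f k)) x) \<partial>M) \<le> (\<integral>x. norm (tensor m u f x) \<partial>M) + 2 * \<epsilon> n" for n
  proof -
    let ?h = "\<lambda>k x. h n x k"
    have ineq: "(\<integral>x. norm (tensor m u F x) \<partial>M)
        \<le> (\<integral>x. norm (tensor m u G x) \<partial>M) + (\<integral>x. norm (tensor m u F x - tensor m u G x) \<partial>M)"
      if "\<And>k. F k \<in> bdd_integrable M" "\<And>k. G k \<in> bdd_integrable M" for F G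
    proof -
      have i: "integrable M (\<lambda>x. norm (tensor m u F x - tensor m u G x))"
        unfolding tensor_diff[symmetric] using that by (intro norm_tensor_integrable bdd_integrable_diff)
      have "(\<integral>x. norm (tensor m u F x) \<partial>M) \<le> (\<integral>x. norm (tensor m u G x) + norm (tensor m u F x - tensor m u G x) \<partial>M)"
        using that i by (intro integral_mono norm_tensor_integrable Bochner_Integration.integrable_add norm_triangle_sub)
      then show ?thesis using that i by (simp add: norm_tensor_integrable)
    qed
    have 1: "(\<integral>x. norm (tensor m u (\<lambda>k. S (f k)) x - tensor m u (\<lambda>k. S (?h k)) x) \<partial>M) \<le> \<epsilon> n"
      using tensor_S_diff_L1[of f ?h m u] f h_in by (simp add: \<epsilon>_def norm_minus_commute)
    have 2: "(\<integral>x. norm (tensor m u ?h x - tensor m u f x) \<partial>M) \<le> \<epsilon> n"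
    proof -
      have "(\<integral>x. norm (tensor m u ?h x - tensor m u f x) \<partial>M) \<le> (\<integral>x. (\<Sum>k<m. norm (u k) * cmod (?h k x - f k x)) \<partial>M)"
        unfolding tensor_diff[symmetric] using f h_in
        by (intro integral_mono norm_tensor_le norm_tensor_integrable Bochner_Integration.integrable_sum
            integrable_mult_right integrable_norm bdd_integrable_integrable bdd_integrable_diff)
      also have "\<dots> = \<epsilon> n"
        unfolding \<epsilon>_def using f h_in
        by (subst Bochner_Integration.integral_sum)
          (auto intro!: integrable_norm bdd_integrable_integrable bdd_integrable_diff)
      finally show ?thesis .
    qed
    have "(\<integral>x. norm (tensor m u (\<lambda>k. S (f k)) x) \<partial>M) \<le> (\<integral>x. norm (tensor m u (\<lambda>k. S (?h k)) x) \<partial>M) + \<epsilon> n"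
      using ineq[of "\<lambda>k. S (f k)" "\<lambda>k. S (?h k)"] 1 f h_in S_in by fastforce
    also have "(\<integral>x. norm (tensor m u (\<lambda>k. S (?h k)) x) \<partial>M) \<le> (\<integral>x. norm (tensor m u ?h x) \<partial>M)"
      using h h_in by (intro tensor_simple_L1)
    also have "\<dots> \<le> (\<integral>x. norm (tensor m u f x) \<partial>M) + \<epsilon> n"
      using ineq[of ?h f] 2 f h_in by fastforce
    finally show ?thesis by simp
  qed
  moreover have "(\<lambda>n. (\<integral>x. norm (tensor m u f x) \<partial>M) + 2 * \<epsilon> n) \<longlonglongrightarrow> (\<integral>x. norm (tensor m u f x) \<partial>M) + 2 * 0"
    by (intro tendsto_intros \<epsilon>)
  ultimately show ?thesis by (intro LIMSEQ_le_const[of _ "\<integral>x. norm (tensor m u f x) \<partial>M"]) auto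
qed

text \<open>Simple approximants of the components need not respect the bound \<open>a\<close>. Their
  values are therefore scaled back radially to tensors of norm at most \<open>a\<close>, which keeps
  them simple; as the limit satisfies the bound already, the scaling factor tends to 1.\<close>

lemma tensor_S_Linf:
  assumes f: "\<And>k. f k \<in> bdd_integrable M" and a: "0 < a"
    and le: "AE x in M. norm (tensor m u f x) \<le> a"
  shows "AE x in M. norm (tensor m u (\<lambda>k. S (f k)) x) \<le> a"
proof -
  obtain h0 where h0: "\<And>n. simple_function M (h0 n)"
    "\<And>k x. k < m \<Longrightarrow> x \<in> space M \<Longrightarrow> (\<lambda>n. h0 n x k) \<longlonglongrightarrow> f k x"
    "\<And>n k x. x \<in> space M \<Longrightarrow> cmod (h0 n x k) \<le> 2 * cmod (f k x)"
    using tuple_simple_approx[of f M m] f by (metis bdd_integrable_measurable)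
  define w where "w v = norm (\<Sum>k<m. v k *\<^sub>C u k)" for v
  \<comment> \<open>The scaling is performed on the coefficient tuple \<open>v\<close>, so that the
    result is again given by scalar components to which \<open>S\<close> applies.\<close>
  define \<phi> where "\<phi> v k = of_real (a / max a (w v)) * v k" for v and k :: nat
  define h where "h n x = \<phi> (h0 n x)" for n x
  have h: "simple_function M (h n)" for n
    using simple_function_compose1[OF h0(1), of \<phi> n] by (simp add: h_def[abs_def])
  have h_le: "cmod (h n x k) \<le> 2 * cmod (f k x)" if "x \<in> space M" for n x k
  proof -
    have "a / max a (w (h0 n x)) \<le> 1" "0 \<le> a / max a (w (h0 n x))" using a by auto
    then have "cmod (h n x k) \<le> 1 * cmod (h0 n x k)"
      unfolding h_def \<phi>_def norm_mult norm_of_real by (intro mult_right_mono) auto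
    with h0(3)[OF that, of n k] show ?thesis by simp
  qed
  have h_meas: "(\<lambda>x. h n x k) \<in> borel_measurable M" for n k
    using simple_function_compose1[OF h, of "\<lambda>v. v k" n] by (rule borel_measurable_simple_function)
  have h_in: "(\<lambda>x. h n x k) \<in> bdd_integrable M" for n k
    using h_le by (intro bdd_integrable_dominated[OF f[of k] h_meas, of _ _ 2] AE_I2) auto
  have h_bound: "norm (tensor m u (\<lambda>k x. h n x k) x) \<le> a" for n x
  proof -
    have "tensor m u (\<lambda>k x. h n x k) x = of_real (a / max a (w (h0 n x))) *\<^sub>C (\<Sum>k<m. h0 n x k *\<^sub>C u k)"
      by (simp add: tensor_def h_def \<phi>_def scaleC_sum_right scaleC_scaleC)
    then have "norm (tensor m u (\<lambda>k x. h n x k) x) = a / max a (w (h0 n x)) * w (h0 n x)"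
      using a by (simp add: norm_scaleC w_def[symmetric] norm_divide)
    also have "\<dots> \<le> a"
      using a by (simp add: divide_le_eq max_def)
    finally show ?thesis .
  qed
  have h_lim: "AE x in M. (\<lambda>n. h n x k) \<longlonglongrightarrow> f k x" if k: "k < m" for k
    using le AE_space
  proof eventually_elim
    case (elim x)
    have "(\<lambda>n. w (h0 n x)) \<longlonglongrightarrow> norm (tensor m u f x)"
      unfolding w_def tensor_def using h0(2) elim
      by (intro tendsto_norm tendsto_sum tendsto_scaleC tendsto_const) auto
    then have "(\<lambda>n. a / max a (w (h0 n x))) \<longlonglongrightarrow> a / max a (norm (tensor m u f x))"
      using a by (intro tendsto_intros) auto
    then have "(\<lambda>n. h n x k) \<longlonglongrightarrow> of_real (a / max a (norm (tensor m u f x))) * f k x"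
      unfolding h_def \<phi>_def using h0(2)[OF k elim(2)] by (intro tendsto_mult tendsto_of_real)
    then show ?case using elim(1) a by (simp add: max_def)
  qed
  define \<epsilon> where "\<epsilon> n = (\<Sum>k<m. norm (u k) * (\<integral>x. cmod (h n x k - f k x) \<partial>M))" for n
  have \<epsilon>: "\<epsilon> \<longlonglongrightarrow> 0"
    unfolding \<epsilon>_def using h_le f h_meas h_lim
    by (intro tendsto_null_sum tendsto_mult_right_zero bdd_integrable_L1_approx) auto
  \<comment> \<open>The excess \<open>g\<close> over the height \<open>a\<close> is at most the
    distance to a function bounded by \<open>a\<close>, so its integral is at most every
    \<open>\<epsilon> n\<close> and vanishes in the limit.\<close>
  define g where "g x = max 0 (norm (tensor m u (\<lambda>k. S (f k)) x) - a)" for x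
  have [measurable]: "(\<lambda>x. norm (tensor m u (\<lambda>k. S (f k)) x)) \<in> borel_measurable M"
    using f by (intro norm_tensor_measurable S_measurable)
  have g_int: "integrable M g"
    by (rule Bochner_Integration.integrable_bound[OF norm_tensor_integrable[of "\<lambda>k. S (f k)" _ m u]])
      (use f S_in a in \<open>auto simp: g_def[abs_def] max_def\<close>)
  have "(\<integral>x. g x \<partial>M) \<le> \<epsilon> n" for n
  proof -
    let ?h = "\<lambda>k x. h n x k"
    have "AE x in M. norm (tensor m u (\<lambda>k. S (?h k)) x) \<le> a"
      using h h_in h_bound a by (intro tensor_simple_Linf) auto
    then have "AE x in M. g x \<le> norm (tensor m u (\<lambda>k. S (?h k)) x - tensor m u (\<lambda>k. S (f k)) x)"
    proof eventually_elim
      case (elim x)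
      then show ?case
        using norm_triangle_ineq2[of "tensor m u (\<lambda>k. S (f k)) x" "tensor m u (\<lambda>k. S (?h k)) x"]
        by (simp add: g_def norm_minus_commute)
    qed
    then have "(\<integral>x. g x \<partial>M) \<le> (\<integral>x. norm (tensor m u (\<lambda>k. S (?h k)) x - tensor m u (\<lambda>k. S (f k)) x) \<partial>M)"
      unfolding tensor_diff[symmetric] using f h_in g_int
      by (intro integral_mono_AE norm_tensor_integrable bdd_integrable_diff S_in)
    also have "\<dots> \<le> \<epsilon> n"
      unfolding \<epsilon>_def using f h_in by (intro tensor_S_diff_L1)
    finally show ?thesis .
  qed
  then have "(\<integral>x. g x \<partial>M) \<le> 0"
    by (intro LIMSEQ_le_const[OF \<epsilon>]) auto
  then have "(\<integral>x. g x \<partial>M) = 0"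
    by (intro antisym) (auto simp: g_def intro!: Bochner_Integration.integral_nonneg)
  then have "AE x in M. g x = 0"
    using g_int by (subst (asm) integral_nonneg_eq_0_iff_AE) (auto simp: g_def)
  then show ?thesis by eventually_elim (simp add: g_def max_def split: if_splits)
qed

end

section \<open>The discrete maximal inequality\<close>

lemma nn_integral_powr_Ioo:
  fixes a c :: real
  assumes "- 1 < a" "0 \<le> c"
  shows "(\<integral>\<^sup>+s. ennreal (s powr a) * indicator {0<..<c} s \<partial>lborel) = ennreal (c powr (a + 1) / (a + 1))"
proof -
  have "(\<integral>\<^sup>+s. ennreal (s powr a) * indicator {0<..<c} s \<partial>lborel)
      = (\<integral>\<^sup>+s. ennreal (s powr a) * indicator {0..c} s \<partial>lborel)"
  proof (rule nn_integral_cong_AE)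
    have "AE s in lborel. s \<noteq> (0::real)" "AE s in lborel. s \<noteq> c"
      by (rule AE_lborel_singleton)+
    then show "AE s in lborel. ennreal (s powr a) * indicator {0<..<c} s = ennreal (s powr a) * indicator {0..c} s"
      by eventually_elim (auto split: split_indicator)
  qed
  also have "\<dots> = ennreal (c powr (a + 1) / (a + 1))"
    using assms by (intro nn_integral_has_integral_lebesgue' has_integral_powr_from_0) auto
  finally show ?thesis .
qed

text \<open>The right-hand side of \<open>weak\<close> involves only the part of \<open>h\<close>
  above the level \<open>a\<close>. After multiplication by \<open>a powr (p - 2)\<close> the inner
  integral over \<open>a\<close> therefore extends from 0 to \<open>h x\<close>, where it converges
  because \<open>p > 1\<close>. The order of integration is interchanged by Tonelli's
  theorem.\<close>

lemma (in sigma_finite_measure) weak_type_imp_strong_type: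
  fixes g h :: "'a \<Rightarrow> real" and p :: real
  assumes [measurable]: "g \<in> borel_measurable M" "h \<in> borel_measurable M"
    and nonneg: "\<And>x. 0 \<le> g x" "\<And>x. 0 \<le> h x" and p: "1 < p"
    and weak: "\<And>a. 0 < a \<Longrightarrow>
      ennreal a * emeasure M {x \<in> space M. 2 * a < g x} \<le> (\<integral>\<^sup>+x. ennreal (h x) * indicator {x. a < h x} x \<partial>M)"
  shows "(\<integral>\<^sup>+x. ennreal (g x powr p) \<partial>M) \<le> ennreal (2 powr p * (p / (p - 1))) * (\<integral>\<^sup>+x. ennreal (h x powr p) \<partial>M)"
proof -
  interpret pair_sigma_finite M lborel ..
  \<comment> \<open>\<open>I\<close> and \<open>J\<close> are the integrands of the two sides of
    \<open>weak\<close>, multiplied by \<open>a powr (p - 2)\<close>. Integration over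
    \<open>a\<close> turns them into \<open>(g x / 2) powr p / p\<close> and
    \<open>h x powr p / (p - 1)\<close>, whence both parts of the constant.\<close>
  define I where "I a x = (if 0 < a \<and> 2 * a < g x then ennreal (a powr (p - 1)) else 0)" for a x
  define J where "J a x = (if 0 < a \<and> a < h x then ennreal (a powr (p - 2)) * ennreal (h x) else 0)" for a x
  have [measurable]: "case_prod I \<in> borel_measurable (lborel \<Otimes>\<^sub>M M)" "case_prod J \<in> borel_measurable (lborel \<Otimes>\<^sub>M M)"
    unfolding I_def J_def by measurable
  have [measurable]: "(\<lambda>(x, a). I a x) \<in> borel_measurable (M \<Otimes>\<^sub>M lborel)" "(\<lambda>(x, a). J a x) \<in> borel_measurable (M \<Otimes>\<^sub>M lborel)"
    unfolding I_def J_def by measurable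
  have I_int: "(\<integral>\<^sup>+a. I a x \<partial>lborel) = ennreal ((g x / 2) powr p / p)" for x
  proof -
    have "(\<integral>\<^sup>+a. I a x \<partial>lborel) = (\<integral>\<^sup>+a. ennreal (a powr (p - 1)) * indicator {0<..<g x / 2} a \<partial>lborel)"
      by (intro nn_integral_cong) (auto simp: I_def split: split_indicator)
    then show ?thesis using nn_integral_powr_Ioo[of "p - 1" "g x / 2"] p nonneg by simp
  qed
  have J_int: "(\<integral>\<^sup>+a. J a x \<partial>lborel) = ennreal (h x powr p / (p - 1))" for x
  proof -
    have "(\<integral>\<^sup>+a. J a x \<partial>lborel) = (\<integral>\<^sup>+a. ennreal (a powr (p - 2)) * indicator {0<..<h x} a * ennreal (h x) \<partial>lborel)"
      by (intro nn_integral_cong) (auto simp: J_def split: split_indicator)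
    also have "\<dots> = ennreal (h x powr (p - 1) / (p - 1)) * ennreal (h x)"
      using nn_integral_powr_Ioo[of "p - 2" "h x"] p nonneg by (subst nn_integral_multc) auto
    also have "\<dots> = ennreal (h x powr p / (p - 1))"
    proof -
      have "h x powr (p - 1) * h x = h x powr p"
        using nonneg(2)[of x] by (cases "h x = 0") (auto simp: powr_diff)
      then show ?thesis using p nonneg by (simp flip: ennreal_mult)
    qed
    finally show ?thesis .
  qed
  have IJ: "(\<integral>\<^sup>+x. I a x \<partial>M) \<le> (\<integral>\<^sup>+x. J a x \<partial>M)" for a
  proof (cases "0 < a")
    case True
    have "(\<integral>\<^sup>+x. I a x \<partial>M) = (\<integral>\<^sup>+x. ennreal (a powr (p - 1)) * indicator {x \<in> space M. 2 * a < g x} x \<partial>M)"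
      using True by (intro nn_integral_cong) (auto simp: I_def split: split_indicator)
    also have "\<dots> = ennreal (a powr (p - 1)) * emeasure M {x \<in> space M. 2 * a < g x}"
      by (simp add: nn_integral_cmult_indicator)
    also have "ennreal (a powr (p - 1)) = ennreal (a powr (p - 2)) * ennreal a"
      using True by (simp add: powr_diff power2_eq_square flip: ennreal_mult)
    also have "ennreal (a powr (p - 2)) * ennreal a * emeasure M {x \<in> space M. 2 * a < g x}
        \<le> ennreal (a powr (p - 2)) * (\<integral>\<^sup>+x. ennreal (h x) * indicator {x. a < h x} x \<partial>M)"
      using weak[OF True] by (simp add: mult.assoc mult_left_mono)
    also have "\<dots> = (\<integral>\<^sup>+x. J a x \<partial>M)"
      using True by (subst nn_integral_cmult[symmetric])
        (auto intro!: nn_integral_cong simp: J_def split: split_indicator)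
    finally show ?thesis .
  qed (simp add: I_def)
  have "(\<integral>\<^sup>+a. \<integral>\<^sup>+x. I a x \<partial>M \<partial>lborel) \<le> (\<integral>\<^sup>+a. \<integral>\<^sup>+x. J a x \<partial>M \<partial>lborel)"
    by (rule nn_integral_mono) (rule IJ)
  then have le: "(\<integral>\<^sup>+x. ennreal ((g x / 2) powr p / p) \<partial>M) \<le> (\<integral>\<^sup>+x. ennreal (h x powr p / (p - 1)) \<partial>M)"
    by (simp add: Fubini' I_int J_int)
  have "(\<integral>\<^sup>+x. ennreal (g x powr p) \<partial>M) = (\<integral>\<^sup>+x. ennreal (2 powr p * p) * ennreal ((g x / 2) powr p / p) \<partial>M)"
    using p nonneg by (intro nn_integral_cong) (simp add: powr_divide flip: ennreal_mult)
  also have "\<dots> = ennreal (2 powr p * p) * (\<integral>\<^sup>+x. ennreal ((g x / 2) powr p / p) \<partial>M)"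
    by (simp add: nn_integral_cmult)
  also have "\<dots> \<le> ennreal (2 powr p * p) * (\<integral>\<^sup>+x. ennreal (h x powr p / (p - 1)) \<partial>M)"
    using le by (rule mult_left_mono) simp
  also have "\<dots> = (\<integral>\<^sup>+x. ennreal (2 powr p * p) * ennreal (h x powr p / (p - 1)) \<partial>M)"
    by (simp add: nn_integral_cmult)
  also have "\<dots> = (\<integral>\<^sup>+x. ennreal (2 powr p * (p / (p - 1))) * ennreal (h x powr p) \<partial>M)"
    using p by (intro nn_integral_cong) (simp flip: ennreal_mult)
  also have "\<dots> = ennreal (2 powr p * (p / (p - 1))) * (\<integral>\<^sup>+x. ennreal (h x powr p) \<partial>M)"
    by (simp add: nn_integral_cmult)
  finally show ?thesis .
qed

section \<open>The filling scheme and the maximal inequality for one operator\<close>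

context dunford_schwartz
begin

text \<open>Up to null sets, the sum of the iterates \<open>S^j f\<close> with \<open>j < n\<close>.
  The Horner form applies \<open>S\<close> once to a single function, which matches the recursion of
  the filling scheme.\<close>

primrec orbit_sum :: "('a \<Rightarrow> complex) \<Rightarrow> nat \<Rightarrow> 'a \<Rightarrow> complex"
  where
    "orbit_sum f 0 = (\<lambda>_. 0)"
  | "orbit_sum f (Suc n) = (\<lambda>x. f x + S (orbit_sum f n) x)"

lemma orbit_sum_in: "f \<in> bdd_integrable M \<Longrightarrow> orbit_sum f n \<in> bdd_integrable M"
  by (induction n) (auto simp: bdd_integrable_zero bdd_integrable_add S_in)

lemma orbit_sum_add:
  assumes "f \<in> bdd_integrable M" "g \<in> bdd_integrable M"
  shows "AE x in M. orbit_sum (\<lambda>y. f y + g y) n x = orbit_sum f n x + orbit_sum g n x"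
proof (induction n)
  case (Suc n)
  have "AE x in M. S (orbit_sum (\<lambda>y. f y + g y) n) x = S (\<lambda>x. orbit_sum f n x + orbit_sum g n x) x"
    using Suc assms by (intro S_cong orbit_sum_in bdd_integrable_add)
  moreover have "AE x in M. S (\<lambda>x. orbit_sum f n x + orbit_sum g n x) x = S (orbit_sum f n) x + S (orbit_sum g n) x"
    using assms by (intro S_add orbit_sum_in)
  ultimately show ?case by eventually_elim simp
qed simp

lemma orbit_sum_bound:
  assumes f: "\<And>k. f k \<in> bdd_integrable M" and a: "0 < a" and le: "AE x in M. norm (tensor m u (f :: nat \<Rightarrow> _) x) \<le> a"
  shows "AE x in M. norm (tensor m u (\<lambda>k. orbit_sum (f k) n) x) \<le> real n * a"
proof (induction n)
  case (Suc n)
  \<comment> \<open>For \<open>n = 0\<close> the bound is 0, whereas \<open>tensor_S_Linf\<close> is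
    stated for positive bounds.\<close>
  have "AE x in M. norm (tensor m u (\<lambda>k. S (orbit_sum (f k) n)) x) \<le> real n * a"
  proof (cases "n = 0")
    case True
    have "AE x in M. tensor m u (\<lambda>k. S (\<lambda>_. 0)) x = tensor m u (\<lambda>_ _. 0) x"
      by (rule tensor_cong_AE) (rule S_zero)
    then show ?thesis using True by (simp add: tensor_zero)
  next
    case False
    then show ?thesis using Suc f a by (intro tensor_S_Linf orbit_sum_in) auto
  qed
  with le show ?case
  proof eventually_elim
    case (elim x)
    have "norm (tensor m u f x + tensor m u (\<lambda>k. S (orbit_sum (f k) n)) x) \<le> a + real n * a"
      using elim by (rule norm_triangle_mono)
    then show ?case by (simp add: tensor_add algebra_simps)
  qed
qed (simp add: tensor_zero)

text \<open>
  Chacon's filling scheme. At each point there is room for a total norm \<open>a\<close>; of the vector arriving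
  in step \<open>j\<close> the part \<open>d j\<close>, a nonnegative multiple of it, is stored as far as there is room, and
  \<open>S\<close> is applied to the remainder \<open>e j\<close>; \<open>c j\<close> is the total norm stored before step \<open>j\<close>. Since
  \<open>S\<close> does not increase the \<open>L\<^sup>1\<close> norm, the integral of \<open>c N\<close> is bounded by that of the original
  function. The \<open>n\<close>-th orbit sum is the sum of the remainders \<open>e j\<close>, \<open>j < n\<close>, and of a part
  which by the \<open>L\<^sup>\<infinity>\<close> contraction property is bounded by \<open>n * a\<close>; hence where it exceeds
  \<open>n * a\<close>, some remainder is nonzero and all the room is used up.
\<close>

lemma maximal_weak_type:
  assumes f: "\<And>k. f k \<in> bdd_integrable M" and a: "0 < a"
  shows "ennreal a * emeasure M {x \<in> space M. \<exists>n\<in>{1..N}. real n * a < norm (tensor m u (\<lambda>k. orbit_sum (f k) n) x)}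
    \<le> ennreal (\<integral>x. norm (tensor m u f x) \<partial>M)"
proof -
  \<comment> \<open>\<open>r\<close> is the fraction of a vector of norm \<open>y\<close> that fits
    into the remaining room \<open>a - c\<close>. For \<open>y = 0\<close> division gives
    \<open>r = 0\<close>, and there is nothing to store.\<close>
  define r where "r c y = min 1 ((a - c) / y)" for c y :: real
  \<comment> \<open>The recursion carries the stored norm together with the components that arrive;
    it starts with nothing stored and \<open>f\<close> arriving.\<close>
  define G where "G = rec_nat ((\<lambda>_. 0) :: 'a \<Rightarrow> real, f) (\<lambda>_ (c, g).
    (\<lambda>x. c x + r (c x) (norm (tensor m u g x)) * norm (tensor m u g x),
     \<lambda>k. S (\<lambda>x. of_real (1 - r (c x) (norm (tensor m u g x))) * g k x)))"
  define c where "c j = fst (G j)" for j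
  define g where "g j = snd (G j)" for j
  define y where "y j x = norm (tensor m u (g j) x)" for j x
  define d where "d j k x = of_real (r (c j x) (y j x)) * g j k x" for j k x
  define e where "e j k x = of_real (1 - r (c j x) (y j x)) * g j k x" for j k x
  have c_0: "c 0 x = 0" and g_0: "g 0 = f" for x by (simp_all add: c_def g_def G_def)
  have c_Suc: "c (Suc j) x = c j x + r (c j x) (y j x) * y j x" for j x
    by (simp add: c_def g_def G_def y_def case_prod_beta)
  have g_Suc: "g (Suc j) k = S (e j k)" for j k
    by (simp add: c_def g_def G_def y_def e_def[abs_def] case_prod_beta)
  have y_nonneg: "0 \<le> y j x" for j x by (simp add: y_def)
  have c_range: "0 \<le> c j x \<and> c j x \<le> a" for j x
  proof (induction j)
    case (Suc j)
    have "r (c j x) (y j x) * y j x \<le> a - c j x"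
    proof (cases "y j x = 0")
      case False
      then show ?thesis
        using y_nonneg[of j x] by (simp add: r_def flip: pos_le_divide_eq)
    qed (use Suc in simp)
    moreover have "0 \<le> r (c j x) (y j x)"
      using Suc y_nonneg[of j x] by (simp add: r_def)
    ultimately show ?case using Suc y_nonneg[of j x] by (auto simp: c_Suc)
  qed (use a c_0 in auto)
  have r_range: "0 \<le> r (c j x) (y j x)" "r (c j x) (y j x) \<le> 1" for j x
    using c_range[of j x] y_nonneg[of j x] by (auto simp: r_def)
  have meas: "c j \<in> borel_measurable M \<and> (\<forall>k. g j k \<in> bdd_integrable M)" for j
  proof (induction j)
    case 0
    have "c 0 = (\<lambda>_. 0)" using c_0 by auto
    then show ?case using f g_0 by simp
  next
    case (Suc j)
    then have [measurable]: "c j \<in> borel_measurable M" "y j \<in> borel_measurable M"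
      unfolding y_def by (auto intro!: norm_tensor_measurable bdd_integrable_measurable)
    have "c (Suc j) \<in> borel_measurable M"
      unfolding c_Suc[abs_def] r_def by measurable
    moreover have "e j k \<in> bdd_integrable M" for k
      unfolding e_def[abs_def] using Suc r_range[of j]
      by (intro bdd_integrable_mult[where K=1]) (auto simp: r_def norm_of_real simp del: of_real_diff)
    ultimately show ?case using S_in by (simp add: g_Suc)
  qed
  have g_in: "g j k \<in> bdd_integrable M" for j k using meas by blast
  have c_meas [measurable]: "c j \<in> borel_measurable M" for j using meas by blast
  have y_meas [measurable]: "y j \<in> borel_measurable M" for j
    unfolding y_def using g_in by (auto intro!: norm_tensor_measurable bdd_integrable_measurable)
  have y_int: "integrable M (y j)" for j
    unfolding y_def using g_in by (rule norm_tensor_integrable)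
  have e_in: "e j k \<in> bdd_integrable M" for j k
    unfolding e_def[abs_def] using g_in r_range[of j]
    by (intro bdd_integrable_mult[where K=1]) (auto simp: r_def norm_of_real simp del: of_real_diff)
  have d_in: "d j k \<in> bdd_integrable M" for j k
    unfolding d_def[abs_def] using g_in r_range[of j]
    by (intro bdd_integrable_mult[where K=1]) (auto simp: r_def norm_of_real)
  have norm_d: "norm (tensor m u (d j) x) = c (Suc j) x - c j x" for j x
    unfolding d_def tensor_mult norm_scaleC norm_of_real using r_range(1)[of j x] by (simp add: c_Suc y_def)
  have norm_e: "norm (tensor m u (e j) x) = y j x - (c (Suc j) x - c j x)" for j x
    unfolding e_def tensor_mult norm_scaleC norm_of_real using r_range(2)[of j x]
    by (simp add: c_Suc y_def left_diff_distrib)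
  \<comment> \<open>A remainder is left only if \<open>r < 1\<close>, and then the norm stored is
    exactly the remaining room.\<close>
  have e_full: "c (Suc j) x = a" if "tensor m u (e j) x \<noteq> 0" for j x
  proof -
    have "0 < norm (tensor m u (e j) x)" using that by simp
    then have "y j x \<noteq> 0" "r (c j x) (y j x) \<noteq> 1" unfolding norm_e c_Suc by auto
    then show ?thesis by (auto simp: c_Suc r_def min_def split: if_splits)
  qed
  have c_incseq: "mono (\<lambda>j. c j x)" for x
    unfolding mono_iff_le_Suc
  proof
    show "c j x \<le> c (Suc j) x" for j
      using norm_ge_zero[of "tensor m u (d j) x"] unfolding norm_d by simp
  qed
  \<comment> \<open>Balance of mass: the integral of stored plus arriving norm never increases,
    because the remainder lacks exactly what has been stored and \<open>S\<close> contracts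
    L^1.\<close>
  have c_int: "integrable M (c j) \<and> (\<integral>x. c j x \<partial>M) + (\<integral>x. y j x \<partial>M) \<le> (\<integral>x. norm (tensor m u f x) \<partial>M)" for j
  proof (induction j)
    case 0
    have "c 0 = (\<lambda>_. 0)" using c_0 by auto
    then show ?case by (simp add: y_def g_0)
  next
    case (Suc j)
    have ci: "integrable M (c (Suc j))"
    proof (rule Bochner_Integration.integrable_bound)
      show "integrable M (\<lambda>x. c j x + y j x)" using Suc y_int by simp
      show "AE x in M. norm (c (Suc j) x) \<le> norm (c j x + y j x)"
      proof (rule AE_I2)
        show "norm (c (Suc j) x) \<le> norm (c j x + y j x)" for x
          using norm_ge_zero[of "tensor m u (e j) x"] c_range[of "Suc j" x] unfolding norm_e by simp
      qed
    qed simp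
    have "(\<integral>x. y (Suc j) x \<partial>M) \<le> (\<integral>x. norm (tensor m u (e j) x) \<partial>M)"
      unfolding y_def g_Suc using e_in by (rule tensor_S_L1)
    also have "\<dots> = (\<integral>x. y j x \<partial>M) - ((\<integral>x. c (Suc j) x \<partial>M) - (\<integral>x. c j x \<partial>M))"
      unfolding norm_e using y_int ci Suc by simp
    finally show ?case using Suc ci by simp
  qed
  \<comment> \<open>Unfolded, \<open>W n\<close> is up to null sets the sum over
    \<open>i < n\<close> of \<open>S^i\<close> applied to the sum of the \<open>d l\<close> with
    \<open>l < n - i\<close>. The norms of the \<open>d l\<close> telescope, so each inner sum has
    norm at most \<open>a\<close>, and there are \<open>n\<close> of them.\<close>
  define W where "W = rec_nat (\<lambda>_ _. 0) (\<lambda>n w k x. S (w k) x + (\<Sum>l\<le>n. d l k x))"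
  have W_0: "W 0 = (\<lambda>_ _. 0)" and W_Suc: "W (Suc n) k x = S (W n k) x + (\<Sum>l\<le>n. d l k x)" for n k x
    by (simp_all add: W_def)
  have W_in: "W n k \<in> bdd_integrable M" for n k
    by (induction n) (auto simp: W_0 W_Suc[abs_def] bdd_integrable_zero S_in d_in intro!: bdd_integrable_add bdd_integrable_sum)
  have W_bound: "AE x in M. norm (tensor m u (W n) x) \<le> real n * a" for n
  proof (induction n)
    case (Suc n)
    have "AE x in M. norm (tensor m u (\<lambda>k. S (W n k)) x) \<le> real n * a"
    proof (cases "n = 0")
      case True
      have "AE x in M. tensor m u (\<lambda>k. S (\<lambda>_. 0)) x = tensor m u (\<lambda>_ _. 0) x"
        by (rule tensor_cong_AE) (rule S_zero)
      then show ?thesis using True by (simp add: W_0 tensor_zero)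
    next
      case False
      then show ?thesis using Suc a by (intro tensor_S_Linf W_in) auto
    qed
    then show ?case
    proof eventually_elim
      case (elim x)
      have "norm (\<Sum>l\<le>n. tensor m u (d l) x) \<le> (\<Sum>l\<le>n. c (Suc l) x - c l x)"
        unfolding norm_d[symmetric] by (rule norm_sum)
      also have "\<dots> = c (Suc n) x - c 0 x"
        by (induction n) auto
      also have "\<dots> \<le> a" using c_range[of "Suc n" x] c_0 by simp
      finally have "norm (tensor m u (\<lambda>k. S (W n k)) x + (\<Sum>l\<le>n. tensor m u (d l) x)) \<le> real n * a + a"
        using elim by (intro norm_triangle_mono)
      then show ?case by (simp add: W_Suc[abs_def] tensor_add tensor_sum algebra_simps)
    qed
  qed (simp add: W_0 tensor_zero)
  \<comment> \<open>As \<open>S (e j) = g (Suc j)\<close>, applying \<open>S\<close> to the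
    remainders and adding \<open>f\<close> returns the arriving vectors up to step \<open>n\<close>;
    each of them splits again as \<open>e j + d j\<close>, and the new stored parts are absorbed by
    \<open>W (Suc n)\<close>.\<close>
  have decomp: "AE x in M. orbit_sum (f k) n x = (\<Sum>j<n. e j k x) + W n k x" for n k
  proof (induction n)
    case (Suc n)
    have "AE x in M. S (orbit_sum (f k) n) x = S (\<lambda>x. (\<Sum>j<n. e j k x) + W n k x) x"
      using Suc f e_in W_in by (intro S_cong orbit_sum_in bdd_integrable_add bdd_integrable_sum)
    moreover have "AE x in M. S (\<lambda>x. (\<Sum>j<n. e j k x) + W n k x) x = S (\<lambda>x. \<Sum>j<n. e j k x) x + S (W n k) x"
      using e_in W_in by (intro S_add bdd_integrable_sum)
    moreover have "AE x in M. S (\<lambda>x. \<Sum>j<n. e j k x) x = (\<Sum>j<n. S (e j k) x)"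
      using e_in by (intro S_sum) auto
    ultimately show ?case
    proof eventually_elim
      case (elim x)
      have "(\<Sum>j<Suc n. e j k x) + (\<Sum>j\<le>n. d j k x) = (\<Sum>j<Suc n. g j k x)"
        unfolding lessThan_Suc_atMost sum.distrib[symmetric] d_def e_def
        by (intro sum.cong refl) (simp flip: distrib_right of_real_add)
      also have "\<dots> = f k x + (\<Sum>j<n. S (e j k) x)"
        unfolding sum.lessThan_Suc_shift g_Suc g_0 ..
      finally show ?case using elim by (simp add: W_Suc algebra_simps)
    qed
  qed (simp add: W_0)
  have "AE x in M. \<forall>n. norm (tensor m u (W n) x) \<le> real n * a"
    using W_bound by (simp add: AE_all_countable)
  moreover have "AE x in M. \<forall>n k. orbit_sum (f k) n x = (\<Sum>j<n. e j k x) + W n k x"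
    using decomp by (simp add: AE_all_countable)
  ultimately have full: "AE x in M. (\<exists>n\<in>{1..N}. real n * a < norm (tensor m u (\<lambda>k. orbit_sum (f k) n) x)) \<longrightarrow> c N x = a"
  proof eventually_elim
    case (elim x)
    show ?case
    proof (intro impI, elim bexE)
      fix n assume n: "n \<in> {1..N}" and big: "real n * a < norm (tensor m u (\<lambda>k. orbit_sum (f k) n) x)"
      have "tensor m u (\<lambda>k. orbit_sum (f k) n) x = tensor m u (\<lambda>k x. (\<Sum>j<n. e j k x) + W n k x) x"
        using elim(2) by (intro tensor_cong) auto
      also have "\<dots> = (\<Sum>j<n. tensor m u (e j) x) + tensor m u (W n) x"
        by (simp add: tensor_add tensor_sum)
      finally have "(\<Sum>j<n. tensor m u (e j) x) \<noteq> 0"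
        using big elim(1)[rule_format, of n] by auto
      then obtain j where j: "j < n" "tensor m u (e j) x \<noteq> 0"
        by (meson lessThan_iff sum.not_neutral_contains_not_neutral)
      then have "c (Suc j) x \<le> c N x" using n by (intro monoD[OF c_incseq]) auto
      then show "c N x = a" using e_full[OF j(2)] c_range[of N x] by simp
    qed
  qed
  let ?E = "{x \<in> space M. \<exists>n\<in>{1..N}. real n * a < norm (tensor m u (\<lambda>k. orbit_sum (f k) n) x)}"
  have "(\<lambda>x. norm (tensor m u (\<lambda>k. orbit_sum (f k) n) x)) \<in> borel_measurable M" for n
    using f by (intro norm_tensor_measurable bdd_integrable_measurable orbit_sum_in)
  then have "?E \<in> sets M" by measurable
  then have "ennreal a * emeasure M ?E = (\<integral>\<^sup>+x. ennreal a * indicator ?E x \<partial>M)"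
    by (rule nn_integral_cmult_indicator[symmetric])
  also have "\<dots> \<le> (\<integral>\<^sup>+x. ennreal (c N x) \<partial>M)"
    using full by (intro nn_integral_mono_AE) (auto elim!: eventually_mono split: split_indicator)
  also have "\<dots> = ennreal (\<integral>x. c N x \<partial>M)"
    using c_int c_range by (intro nn_integral_eq_integral) auto
  also have "\<dots> \<le> ennreal (\<integral>x. norm (tensor m u f x) \<partial>M)"
  proof (rule ennreal_leI)
    have "0 \<le> (\<integral>x. y N x \<partial>M)" using y_nonneg by (simp add: Bochner_Integration.integral_nonneg)
    then show "(\<integral>x. c N x \<partial>M) \<le> (\<integral>x. norm (tensor m u f x) \<partial>M)" using c_int[of N] by simp
  qed
  finally show ?thesis .
qed

text \<open>The part \<open>l\<close> of norm at most \<open>a\<close> contributes at most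
  \<open>n * a\<close> to the \<open>n\<close>-th orbit sum. Where the whole exceeds
  \<open>2 * n * a\<close>, the rest \<open>g\<close> contributes more than \<open>n * a\<close>,
  and \<open>g\<close> is supported where the norm of the tensor exceeds \<open>a\<close>.\<close>

lemma maximal_weak_type_truncated:
  assumes f: "\<And>k. f k \<in> bdd_integrable M" and a: "0 < a"
  shows "ennreal a * emeasure M {x \<in> space M. \<exists>n\<in>{1..N}. real n * (2 * a) < norm (tensor m u (\<lambda>k. orbit_sum (f k) n) x)}
    \<le> (\<integral>\<^sup>+x. ennreal (norm (tensor m u f x)) * indicator {x. a < norm (tensor m u f x)} x \<partial>M)"
proof -
  \<comment> \<open>The cut is radial: both parts are multiples of the original tensor by scalar
    functions, hence tensors with the same vectors \<open>u\<close>.\<close>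
  define r where "r x = a / max a (norm (tensor m u f x))" for x
  define l where "l k x = of_real (r x) * f k x" for k x
  define g where "g k x = of_real (1 - r x) * f k x" for k x
  have [measurable]: "(\<lambda>x. norm (tensor m u f x)) \<in> borel_measurable M"
    using f by (intro norm_tensor_measurable bdd_integrable_measurable)
  have [measurable]: "r \<in> borel_measurable M" unfolding r_def by measurable
  have r: "0 \<le> r x" "r x \<le> 1" for x using a by (auto simp: r_def)
  have l_in: "l k \<in> bdd_integrable M" for k
    unfolding l_def[abs_def] using f r by (intro bdd_integrable_mult[where K=1]) (auto simp: norm_of_real)
  have g_in: "g k \<in> bdd_integrable M" for k
    unfolding g_def[abs_def] using f r
    by (intro bdd_integrable_mult[where K=1]) (auto simp: norm_of_real simp del: of_real_diff)
  have f_eq: "f k = (\<lambda>x. l k x + g k x)" for k by (simp add: l_def g_def left_diff_distrib)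
  have l_le: "norm (tensor m u l x) \<le> a" for x
    unfolding l_def tensor_mult norm_scaleC norm_of_real using a
    by (simp add: r_def max_def divide_le_eq)
  have g_le: "norm (tensor m u g x) \<le> norm (tensor m u f x) * indicator {x. a < norm (tensor m u f x)} x" for x
    unfolding g_def tensor_mult norm_scaleC norm_of_real using a r[of x]
    by (auto simp: r_def max_def split: split_indicator intro: mult_left_le_one_le)
  have "AE x in M. norm (tensor m u (\<lambda>k. orbit_sum (l k) n) x) \<le> real n * a" for n
    using l_in a l_le by (intro orbit_sum_bound) auto
  then have 1: "AE x in M. \<forall>n. norm (tensor m u (\<lambda>k. orbit_sum (l k) n) x) \<le> real n * a"
    by (simp add: AE_all_countable)
  have "AE x in M. orbit_sum (f k) n x = orbit_sum (l k) n x + orbit_sum (g k) n x" for k n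
    unfolding f_eq[of k] using l_in g_in by (rule orbit_sum_add)
  then have 2: "AE x in M. \<forall>k n. orbit_sum (f k) n x = orbit_sum (l k) n x + orbit_sum (g k) n x"
    by (simp add: AE_all_countable)
  let ?E = "\<lambda>f a. {x \<in> space M. \<exists>n\<in>{1..N}. real n * a < norm (tensor m u (\<lambda>k. orbit_sum (f k) n) x)}"
  have E_meas: "?E f a \<in> sets M" if f: "\<And>k. f k \<in> bdd_integrable M" for f a
  proof -
    have [measurable]: "(\<lambda>x. norm (tensor m u (\<lambda>k. orbit_sum (f k) n) x)) \<in> borel_measurable M" for n
      using f by (intro norm_tensor_measurable bdd_integrable_measurable orbit_sum_in)
    show ?thesis by measurable
  qed
  from 1 2 have "AE x in M. x \<in> ?E f (2 * a) \<longrightarrow> x \<in> ?E g a"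
  proof eventually_elim
    case (elim x)
    have "real n * a < norm (tensor m u (\<lambda>k. orbit_sum (g k) n) x)"
      if "real n * (2 * a) < norm (tensor m u (\<lambda>k. orbit_sum (f k) n) x)" for n
    proof -
      have "tensor m u (\<lambda>k. orbit_sum (f k) n) x = tensor m u (\<lambda>k x. orbit_sum (l k) n x + orbit_sum (g k) n x) x"
        using elim(2) by (intro tensor_cong) auto
      then have "norm (tensor m u (\<lambda>k. orbit_sum (f k) n) x)
          \<le> norm (tensor m u (\<lambda>k. orbit_sum (l k) n) x) + norm (tensor m u (\<lambda>k. orbit_sum (g k) n) x)"
        by (simp add: tensor_add norm_triangle_ineq)
      then show ?thesis using that elim(1)[rule_format, of n] by simp
    qed
    then show ?case by auto
  qed
  then have "emeasure M (?E f (2 * a)) \<le> emeasure M (?E g a)"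
    by (rule emeasure_mono_AE) (intro E_meas g_in)
  then have "ennreal a * emeasure M (?E f (2 * a)) \<le> ennreal a * emeasure M (?E g a)"
    by (rule mult_left_mono) simp
  also have "\<dots> \<le> ennreal (\<integral>x. norm (tensor m u g x) \<partial>M)"
    using g_in a by (rule maximal_weak_type)
  also have "\<dots> = (\<integral>\<^sup>+x. ennreal (norm (tensor m u g x)) \<partial>M)"
    using g_in by (intro nn_integral_eq_integral[symmetric] norm_tensor_integrable) auto
  also have "\<dots> \<le> (\<integral>\<^sup>+x. ennreal (norm (tensor m u f x)) * indicator {x. a < norm (tensor m u f x)} x \<partial>M)"
  proof (rule nn_integral_mono)
    show "ennreal (norm (tensor m u g x)) \<le> ennreal (norm (tensor m u f x)) * indicator {x. a < norm (tensor m u f x)} x" for x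
      using ennreal_leI[OF g_le[of x]] by (auto split: split_indicator_asm split_indicator)
  qed
  finally show ?thesis .
qed

theorem maximal_strong_type:
  assumes "sigma_finite_measure M" and f: "\<And>k. f k \<in> bdd_integrable M" and p: "1 < p"
  shows "Lp_norm M (ennreal p) (\<lambda>x. SUP n\<in>{1..N}. ennreal (norm (tensor m u (\<lambda>k. orbit_sum (f k) n) x) / real n))
    \<le> ennreal (2 * (p / (p - 1)) powr (1 / p)) * Lpn M p (tensor m u f)"
proof -
  interpret sigma_finite_measure M by fact
  define q where "q n x = norm (tensor m u (\<lambda>k. orbit_sum (f k) n) x) / real n" for n x
  have [measurable]: "q n \<in> borel_measurable M" for n
    unfolding q_def using f by (intro borel_measurable_divide norm_tensor_measurable bdd_integrable_measurable orbit_sum_in) auto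
  \<comment> \<open>The inserted 0 gives the maximum a meaning for \<open>N = 0\<close>; comparisons
    with positive levels are unaffected.\<close>
  define g where "g x = Max (insert 0 ((\<lambda>n. q n x) ` {1..N}))" for x
  have g_less: "b < g x \<longleftrightarrow> (\<exists>n\<in>{1..N}. b < q n x)" if "0 < b" for b x
    using that by (simp add: g_def Max_gr_iff)
  have g_nonneg: "0 \<le> g x" for x by (simp add: g_def)
  have g_meas [measurable]: "g \<in> borel_measurable M"
    unfolding g_def
  proof -
    \<comment> \<open>The index 0 stands for the inserted value, so that the maximum runs over a
      fixed nonempty index range.\<close>
    have "(\<lambda>x. Max ((\<lambda>n. if n = 0 then 0 else q n x) ` {0..N})) \<in> borel_measurable M"
      by (intro borel_measurable_Max) auto
    also have "(\<lambda>x. Max ((\<lambda>n. if n = 0 then 0 else q n x) ` {0..N})) = (\<lambda>x. Max (insert 0 ((\<lambda>n. q n x) ` {1..N})))"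
    proof
      fix x
      have "(\<lambda>n. if n = 0 then 0 else q n x) ` {0..N} = insert 0 ((\<lambda>n. q n x) ` {1..N})"
        by (force simp: image_iff)
      then show "Max ((\<lambda>n. if n = 0 then 0 else q n x) ` {0..N}) = Max (insert 0 ((\<lambda>n. q n x) ` {1..N}))" by simp
    qed
    finally show "(\<lambda>x. Max (insert 0 ((\<lambda>n. q n x) ` {1..N}))) \<in> borel_measurable M" .
  qed
  have f_meas [measurable]: "(\<lambda>x. norm (tensor m u f x)) \<in> borel_measurable M"
    using f by (intro norm_tensor_measurable bdd_integrable_measurable)
  have p_pos: "0 < p" using p by simp
  have strong: "(\<integral>\<^sup>+x. ennreal (g x powr p) \<partial>M)
      \<le> ennreal (2 powr p * (p / (p - 1))) * (\<integral>\<^sup>+x. ennreal (norm (tensor m u f x) powr p) \<partial>M)"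
  proof (rule weak_type_imp_strong_type[OF g_meas f_meas g_nonneg norm_ge_zero p])
    fix a :: real
    assume a: "0 < a"
    have "{x \<in> space M. 2 * a < g x}
      = {x \<in> space M. \<exists>n\<in>{1..N}. real n * (2 * a) < norm (tensor m u (\<lambda>k. orbit_sum (f k) n) x)}"
      using a by (auto simp: g_less q_def less_divide_eq mult.commute)
    then show "ennreal a * emeasure M {x \<in> space M. 2 * a < g x}
        \<le> (\<integral>\<^sup>+x. ennreal (norm (tensor m u f x)) * indicator {x. a < norm (tensor m u f x)} x \<partial>M)"
      using maximal_weak_type_truncated[OF f a] by simp
  qed
  have "Lp_norm M (ennreal p) (\<lambda>x. SUP n\<in>{1..N}. ennreal (q n x)) \<le> Lp_norm M (ennreal p) (\<lambda>x. ennreal (g x))"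
    unfolding g_def by (intro Lp_norm_mono_AE[OF p_pos] AE_I2 SUP_least ennreal_leI Max_ge) auto
  also have "\<dots> \<le> ennreal (2 * (p / (p - 1)) powr (1 / p)) * Lpn M p (tensor m u f)"
    unfolding Lp_norm_le_iff[OF p_pos] ennreal_powr_mult Bochner_norm_def Lp_norm_powr[OF p_pos]
    using strong p g_nonneg by (simp add: ennreal_powr_ennreal powr_mult powr_powr)
  finally show ?thesis unfolding q_def .
qed

end

section \<open>The semigroup on \<open>L\<^sup>p\<close>\<close>

text \<open>Boundedness gives \<open>cmod (f x) powr q \<le> d powr (q - 1) * cmod (f x)\<close>,
  and the right-hand side is integrable.\<close>

lemma bdd_integrable_Lps:
  assumes f: "f \<in> bdd_integrable M" and q: "1 \<le> q"
  shows "f \<in> Lps M q"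
proof -
  obtain c where c: "AE x in M. cmod (f x) \<le> c" using f by (auto simp: bdd_integrable_def)
  define d where "d = max 1 c"
  have "AE x in M. ennreal_powr (ennreal (cmod (f x))) q \<le> ennreal (d powr (q - 1)) * ennreal (cmod (f x))"
    using c
  proof eventually_elim
    case (elim x)
    have "cmod (f x) powr q = cmod (f x) powr (q - 1) * cmod (f x)"
      using q by (cases "f x = 0") (auto simp: powr_diff)
    also have "\<dots> \<le> d powr (q - 1) * cmod (f x)"
      using elim q by (intro mult_right_mono powr_mono2) (auto simp: d_def)
    finally show ?case
      by (simp add: ennreal_powr_ennreal ennreal_leI flip: ennreal_mult)
  qed
  then have "(\<integral>\<^sup>+x. ennreal_powr (ennreal (cmod (f x))) q \<partial>M) \<le> (\<integral>\<^sup>+x. ennreal (d powr (q - 1)) * ennreal (cmod (f x)) \<partial>M)"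
    by (rule nn_integral_mono_AE)
  also have "\<dots> = ennreal (d powr (q - 1)) * (\<integral>\<^sup>+x. ennreal (cmod (f x)) \<partial>M)"
    using f by (intro nn_integral_cmult) (auto dest: bdd_integrable_measurable)
  also have "\<dots> < \<infinity>"
    using f by (simp add: bdd_integrable_def integrable_iff_bounded ennreal_mult_less_top)
  finally have "Lpn M q f < \<infinity>"
    using q by (auto simp: Bochner_norm_def Lp_norm_real ennreal_powr_def)
  then show ?thesis
    using f by (simp add: Lspace_def strongly_measurable_complex_iff bdd_integrable_measurable)
qed

text \<open>The vectors enumerate the nonzero values of \<open>s\<close> and the components are the
  indicators of their level sets, which have finite measure because the L^q norm of \<open>s\<close>
  is finite.\<close>

lemma simple_function_Lps_decomposition:
  fixes s :: "'a \<Rightarrow> 'b::complex_banach"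
  assumes s: "simple_function M s" "s \<in> Lps M q" and q: "1 \<le> q"
  obtains m u f where "\<And>k :: nat. f k \<in> bdd_integrable M" "\<And>x. x \<in> space M \<Longrightarrow> s x = tensor m u f x"
proof -
  define V where "V = s ` space M - {0}"
  define A where "A v = s -` {v} \<inter> space M" for v
  have V: "finite V" unfolding V_def using simple_functionD(1)[OF s(1)] by (rule finite_Diff)
  have A: "A v \<in> sets M" for v unfolding A_def by (rule simple_functionD(2)[OF s(1)])
  have fin: "emeasure M (A v) < \<infinity>" if "v \<in> V" for v
  proof -
    have v: "v \<noteq> 0" using that by (simp add: V_def)
    have "(\<integral>\<^sup>+x. ennreal_powr (ennreal (norm v)) q * indicator (A v) x \<partial>M) \<le> (\<integral>\<^sup>+x. ennreal_powr (ennreal (norm (s x))) q \<partial>M)"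
      by (intro nn_integral_mono) (auto simp: A_def split: split_indicator)
    also have "\<dots> < \<infinity>"
      using LpsD(2)[OF s(2)] q by (subst Lp_norm_powr[symmetric]) (auto simp: Bochner_norm_def ennreal_powr_def)
    finally have "ennreal_powr (ennreal (norm v)) q * emeasure M (A v) < \<infinity>"
      using A by (simp add: nn_integral_cmult_indicator)
    then show ?thesis
      using v by (auto simp: ennreal_mult_less_top ennreal_powr_ennreal)
  qed
  obtain u where u: "bij_betw u {..<card V} V"
    using ex_bij_betw_nat_finite[OF V] by (auto simp: atLeast0LessThan)
  define f where "f k = (if k < card V then indicator (A (u k)) else (\<lambda>_. 0) :: 'a \<Rightarrow> complex)" for k
  have "f k \<in> bdd_integrable M" for k
    using A fin bij_betwE[OF u] by (auto simp: f_def bdd_integrable_zero intro!: bdd_integrable_indicator)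
  moreover have "s x = tensor (card V) u f x" if x: "x \<in> space M" for x
  proof -
    have "tensor (card V) u f x = (\<Sum>k<card V. indicator (A (u k)) x *\<^sub>C u k)"
      by (simp add: tensor_def f_def)
    also have "\<dots> = (\<Sum>v\<in>V. indicator (A v) x *\<^sub>C v)"
      by (rule sum.reindex_bij_betw[OF u])
    also have "\<dots> = s x"
    proof (cases "s x = 0")
      case True
      then show ?thesis
        by (simp, intro sum.neutral) (auto simp: V_def A_def scaleC_zero_left)
    next
      case False
      then have "s x \<in> V" using x by (simp add: V_def)
      then have "(\<Sum>v\<in>V. indicator (A v) x *\<^sub>C v) = indicator (A (s x)) x *\<^sub>C s x"
        using V by (subst sum.remove[of _ "s x"]) (auto intro!: sum.neutral simp: A_def scaleC_zero_left split: split_indicator_asm)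
      then show ?thesis using x by (simp add: A_def scaleC_one)
    qed
    finally show ?thesis by simp
  qed
  ultimately show ?thesis using that by blast
qed

lemma tensor_dense:
  fixes F :: "'a \<Rightarrow> 'b::complex_banach"
  assumes "F \<in> Lps M q" "0 < e" "1 \<le> q"
  obtains m u f where "\<And>k :: nat. f k \<in> bdd_integrable M" "Lpn M q (\<lambda>x. tensor m u f x - F x) \<le> ennreal e"
proof -
  obtain s where s: "simple_function M s" "s \<in> Lps M q" "Lpn M q (\<lambda>x. s x - F x) < ennreal e"
    using simple_dense[of q F M "ennreal e"] assms by auto
  obtain m u f where f: "\<And>k :: nat. f k \<in> bdd_integrable M"
    and eq: "\<And>x. x \<in> space M \<Longrightarrow> s x = tensor m u f x"
    by (rule simple_function_Lps_decomposition[OF s(1,2) assms(3)]) blast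
  have "Lpn M q (\<lambda>x. tensor m u f x - F x) = Lpn M q (\<lambda>x. s x - F x)"
    using assms(3) by (intro Lpn_cong_AE) (auto simp: eq intro!: AE_I2)
  with s(3) have "Lpn M q (\<lambda>x. tensor m u f x - F x) \<le> ennreal e" by (simp add: less_imp_le)
  with f show ?thesis by (rule that)
qed

text \<open>For complex vectors a tensor is a linear combination of its components, so this is the
  scalar case of the density of tensors.\<close>

lemma bdd_integrable_dense:
  assumes "f \<in> Lps M q" "0 < e" "1 \<le> q"
  obtains g where "g \<in> bdd_integrable M" "Lpn M q (\<lambda>x. g x - f x) \<le> ennreal e"
proof -
  obtain m u and g :: "nat \<Rightarrow> 'a \<Rightarrow> complex"
    where g: "\<And>k. g k \<in> bdd_integrable M" "Lpn M q (\<lambda>x. tensor m u g x - f x) \<le> ennreal e"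
    by (rule tensor_dense[OF assms]) blast
  have "tensor m u g \<in> bdd_integrable M"
    unfolding tensor_def[abs_def] scaleC_complex_eq using g
    by (intro bdd_integrable_sum) (subst mult.commute, intro bdd_integrable_scale)
  with that g show ?thesis by blast
qed

lemma Bochner_norm_1: "Bochner_norm M 1 f = (\<integral>\<^sup>+x. ennreal (norm (f x)) \<partial>M)"
  using Lp_norm_real[of 1 M "\<lambda>x. ennreal (norm (f x))"] by (simp add: Bochner_norm_def)

lemma dunford_schwartz_semigroup:
  assumes "semigroup_L2 M T" "contraction_property M T" "0 \<le> t"
  shows "dunford_schwartz M (T t)"
proof -
  have bo: "bounded_operator M 2 (T t)" using assms by (auto simp: semigroup_L2_def)
  have L2: "f \<in> Lspace M 2" if "f \<in> bdd_integrable M" for f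
    using bdd_integrable_Lps[OF that, of 2] by simp
  have contr: "Bochner_norm M q (T t f) \<le> Bochner_norm M q f" if "1 \<le> q" "f \<in> bdd_integrable M" "f \<in> Lspace M q" for q f
    using assms(2,3) that L2 unfolding contraction_property_def by blast
  have meas: "T t f \<in> borel_measurable M" if "f \<in> bdd_integrable M" for f
    using bo L2[OF that] by (auto simp: bounded_operator_def Lspace_def strongly_measurable_complex_iff)
  have L1: "(\<integral>\<^sup>+x. ennreal (cmod (T t f x)) \<partial>M) \<le> (\<integral>\<^sup>+x. ennreal (cmod (f x)) \<partial>M)" if "f \<in> bdd_integrable M" for f
    using contr[of 1 f] that bdd_integrable_Lps[OF that, of 1] by (simp add: Bochner_norm_1)
  have Linf: "AE x in M. cmod (T t f x) \<le> c" if f: "f \<in> bdd_integrable M" and c: "AE x in M. cmod (f x) \<le> c" for f c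
  proof -
    have [measurable]: "f \<in> borel_measurable M" using f by (rule bdd_integrable_measurable)
    have "AE x in M. ennreal (cmod (f x)) \<le> ennreal c"
      using c by eventually_elim (rule ennreal_leI)
    then have le: "Bochner_norm M \<infinity> f \<le> ennreal c"
      by (auto simp: Bochner_norm_def Lp_norm_def intro!: esssup_I)
    then have "f \<in> Lspace M \<infinity>"
      using f by (auto simp: Lspace_def strongly_measurable_complex_iff intro: le_less_trans)
    then have "esssup M (\<lambda>x. ennreal (cmod (T t f x))) \<le> ennreal c"
      using contr[of \<infinity> f] f le by (auto simp: Bochner_norm_def Lp_norm_def)
    then have "AE x in M. ennreal (cmod (T t f x)) \<le> ennreal c"
      using esssup_AE[of "\<lambda>x. ennreal (cmod (T t f x))" M] by (auto elim!: eventually_mono)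
    with c show ?thesis
    proof eventually_elim
      case (elim x)
      \<comment> \<open>\<open>ennreal\<close> maps negative reals to 0, so the sign of
        \<open>c\<close> has to be read off from the bound for \<open>f\<close> at the
        point.\<close>
      then have "0 \<le> c" using norm_ge_zero order_trans by blast
      with elim show ?case by simp
    qed
  qed
  have intg: "integrable M (T t f)" if "f \<in> bdd_integrable M" for f
    using that meas[OF that] L1[OF that]
    by (auto simp: integrable_iff_bounded bdd_integrable_def intro: le_less_trans)
  show ?thesis
  proof
    fix f assume f: "f \<in> bdd_integrable M"
    show "T t f \<in> bdd_integrable M"
      using intg[OF f] Linf[OF f] f by (auto simp: bdd_integrable_def)
    show "(\<integral>x. cmod (T t f x) \<partial>M) \<le> (\<integral>x. cmod (f x) \<partial>M)"
      using L1[OF f] intg[OF f] f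
      by (subst (asm) (1 2) nn_integral_eq_integral) (auto simp: bdd_integrable_def Bochner_Integration.integral_nonneg)
  next
    fix f and z :: complex assume f: "f \<in> bdd_integrable M"
    show "AE x in M. T t (\<lambda>y. z * f y) x = z * T t f x"
      using bo L2[OF f] by (auto simp: bounded_operator_def scaleC_complex_eq)
  qed (use bo L2 Linf in \<open>auto simp: bounded_operator_def\<close>)
qed

section \<open>The semigroup on L^p and its strong continuity\<close>

locale contraction_semigroup = sigma_finite_measure M
  for M :: "'a measure" +
  fixes T :: "real \<Rightarrow> ('a \<Rightarrow> complex) \<Rightarrow> 'a \<Rightarrow> complex" and p :: real
  assumes semigroup: "semigroup_L2 M T" and continuous: "strongly_continuous_L2 M T"
    and contraction: "contraction_property M T" and p_gt_1: "1 < p"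
begin

lemma p_ge_1: "1 \<le> p"
  using p_gt_1 by simp

lemma p_gt_0: "0 < p"
  using p_gt_1 by simp

lemma ds: "0 \<le> t \<Longrightarrow> dunford_schwartz M (T t)"
  using semigroup contraction by (rule dunford_schwartz_semigroup)

lemma bdd_integrable_L2: "f \<in> bdd_integrable M \<Longrightarrow> f \<in> Lspace M 2"
  using bdd_integrable_Lps[of f M 2] by simp

lemma T_in: "0 \<le> t \<Longrightarrow> f \<in> bdd_integrable M \<Longrightarrow> T t f \<in> bdd_integrable M"
  using ds dunford_schwartz.S_in by blast

lemma T_0: "f \<in> bdd_integrable M \<Longrightarrow> AE x in M. T 0 f x = f x"
  using semigroup bdd_integrable_L2 by (auto simp: semigroup_L2_def)

lemma T_add: "0 \<le> s \<Longrightarrow> 0 \<le> t \<Longrightarrow> f \<in> bdd_integrable M \<Longrightarrow> AE x in M. T (s + t) f x = T s (T t f) x"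
  using semigroup bdd_integrable_L2 by (auto simp: semigroup_L2_def)

lemma bdd_integrable_L2_Lps: "f \<in> bdd_integrable M \<Longrightarrow> f \<in> Lspace M 2 \<inter> Lps M p"
  using bdd_integrable_L2 bdd_integrable_Lps[OF _ p_ge_1] by blast

lemma T_contraction_Lps:
  assumes "0 \<le> t" "f \<in> Lspace M 2 \<inter> Lps M p"
  shows "Lpn M p (T t f) \<le> Lpn M p f"
proof -
  have "1 \<le> ennreal p" using p_ge_1 by (simp flip: ennreal_1)
  with contraction assms show ?thesis unfolding contraction_property_def by blast
qed

lemmas T_contraction = T_contraction_Lps[OF _ bdd_integrable_L2_Lps]

lemma T_diff:
  assumes t: "0 \<le> t" and fg: "f \<in> bdd_integrable M" "g \<in> bdd_integrable M"
  shows "AE x in M. T t (\<lambda>y. f y - g y) x = T t f x - T t g x"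
proof -
  interpret dunford_schwartz M "T t" using t by (rule ds)
  show ?thesis
    using S_add[OF fg(1) bdd_integrable_scale[OF fg(2), of "- 1"]] S_scale[OF fg(2), of "- 1"]
    by eventually_elim simp
qed

abbreviation E :: "real \<Rightarrow> ('a \<Rightarrow> complex) \<Rightarrow> 'a \<Rightarrow> complex"
  where "E t \<equiv> Lp_extension M (ennreal p) (T t)"

text \<open>The choice that defines \<open>Lp_extension\<close> has a witness: the contraction
  property with exponent \<open>p\<close> gives the bound on the intersection of L^2 and L^p, which
  is dense in L^p because it contains all bounded integrable functions.\<close>

lemma Lp_extension_props:
  assumes t: "0 \<le> t"
  shows "bounded_operator M (ennreal p) (E t) \<and>
    (\<forall>f\<in>Lps M p. Lpn M p (E t f) \<le> Lpn M p f) \<and>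
    (\<forall>f\<in>Lspace M 2 \<inter> Lps M p. AE x in M. E t f x = T t f x)"
proof -
  have bo: "bounded_operator M 2 (T t)" using semigroup t by (auto simp: semigroup_L2_def)
  \<comment> \<open>The graph is taken up to null sets: \<open>T t\<close> is additive almost
    everywhere only, so sums of pairs \<open>(f, T t f)\<close> need not be such pairs.\<close>
  define R where "R f g \<longleftrightarrow> f \<in> Lspace M 2 \<inter> Lps M p \<and> g \<in> Lps M p \<and> (AE x in M. g x = T t f x)" for f g
  note contr = T_contraction_Lps[OF t]
  have Tf: "T t f \<in> Lps M p" if "f \<in> Lspace M 2 \<inter> Lps M p" for f
    using contr[OF that] that bo by (auto simp: bounded_operator_def Lspace_def intro: le_less_trans)
  have R_T: "R f (T t f)" if "f \<in> Lspace M 2 \<inter> Lps M p" for f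
    using that Tf by (simp add: R_def)
  have two: "(1::real) \<le> 2" "(2::ennreal) = ennreal 2" by simp_all
  have "\<exists>S. bounded_operator M (ennreal p) S \<and>
    (\<forall>F\<in>Lps M p. Lpn M p (S F) \<le> ennreal 1 * Lpn M p F) \<and>
    (\<forall>F G. R F G \<longrightarrow> (AE x in M. S F x = G x))"
  proof (rule bounded_operator_extension[OF p_ge_1])
    show "F \<in> Lps M p \<and> G \<in> Lps M p" if "R F G" for F G using that by (simp add: R_def)
    show "R (\<lambda>x. F x + F' x) (\<lambda>x. G x + G' x)" if "R F G" "R F' G'" for F G F' G'
    proof -
      have "AE x in M. T t (\<lambda>y. F y + F' y) x = T t F x + T t F' x"
        using bo that by (auto simp: R_def bounded_operator_def)
      moreover have "AE x in M. G x = T t F x" "AE x in M. G' x = T t F' x" using that by (auto simp: R_def)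
      ultimately have "AE x in M. G x + G' x = T t (\<lambda>y. F y + F' y) x" by eventually_elim simp
      then show ?thesis
        using that Lps_add[OF p_ge_1, of F M F'] Lps_add[OF p_ge_1, of G M G'] Lps_add[OF two(1), of F M F']
        by (simp add: R_def flip: two(2))
    qed
    show "R (\<lambda>x. c *\<^sub>C F x) (\<lambda>x. c *\<^sub>C G x)" if "R F G" for c F G
    proof -
      have "AE x in M. T t (\<lambda>y. c *\<^sub>C F y) x = c *\<^sub>C T t F x"
        using bo that by (auto simp: R_def bounded_operator_def)
      moreover have "AE x in M. G x = T t F x" using that by (auto simp: R_def)
      ultimately have "AE x in M. c *\<^sub>C G x = T t (\<lambda>y. c *\<^sub>C F y) x" by eventually_elim simp
      then show ?thesis
        using that Lps_scaleC[OF p_ge_1, of F M c] Lps_scaleC[OF p_ge_1, of G M c] Lps_scaleC[OF two(1), of F M c]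
        by (simp add: R_def flip: two(2))
    qed
    show "Lpn M p G \<le> ennreal 1 * Lpn M p F" if "R F G" for F G
    proof -
      have "Lpn M p G = Lpn M p (T t F)" using that by (intro Lpn_cong_AE p_ge_1) (simp add: R_def)
      then show ?thesis using contr[of F] that by (simp add: R_def)
    qed
    show "\<exists>H K. R H K \<and> Lpn M p (\<lambda>x. H x - F x) \<le> ennreal e" if Fe: "F \<in> Lps M p" "0 < e" for F e
    proof -
      obtain g where g: "g \<in> bdd_integrable M" "Lpn M p (\<lambda>x. g x - F x) \<le> ennreal e"
        using bdd_integrable_dense[OF Fe p_ge_1] by blast
      then have "R g (T t g)" by (intro R_T) (simp add: bdd_integrable_L2 bdd_integrable_Lps p_ge_1)
      then show ?thesis using g(2) by blast
    qed
  qed simp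
  then have "\<exists>S. bounded_operator M (ennreal p) S \<and>
    (\<forall>f\<in>Lps M p. Lpn M p (S f) \<le> Lpn M p f) \<and> (\<forall>f\<in>Lspace M 2 \<inter> Lps M p. AE x in M. S f x = T t f x)"
    using R_T by (simp, blast)
  then show ?thesis unfolding Lp_extension_def by (rule someI_ex)
qed

lemma E_Lps: "0 \<le> t \<Longrightarrow> f \<in> Lps M p \<Longrightarrow> E t f \<in> Lps M p"
  using Lp_extension_props[of t] by (auto simp: bounded_operator_def)

lemma E_contraction: "0 \<le> t \<Longrightarrow> f \<in> Lps M p \<Longrightarrow> Lpn M p (E t f) \<le> Lpn M p f"
  using Lp_extension_props[of t] by auto

lemma E_eq: "0 \<le> t \<Longrightarrow> f \<in> bdd_integrable M \<Longrightarrow> AE x in M. E t f x = T t f x"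
  using Lp_extension_props[of t] bdd_integrable_L2_Lps by blast

lemma bounded_operator_diff:
  assumes "bounded_operator M (ennreal p) S" "f \<in> Lps M p" "g \<in> Lps M p"
  shows "AE x in M. S (\<lambda>y. f y - g y) x = S f x - S g x"
proof -
  have "(\<lambda>y. (- 1) *\<^sub>C g y) \<in> Lps M p" using assms(3) by (rule Lps_scaleC[OF p_ge_1])
  then have "AE x in M. S (\<lambda>y. f y + (- 1) *\<^sub>C g y) x = S f x + S (\<lambda>y. (- 1) *\<^sub>C g y) x"
    using assms by (auto simp: bounded_operator_def)
  moreover have "AE x in M. S (\<lambda>y. (- 1) *\<^sub>C g y) x = (- 1) *\<^sub>C S g x"
    using assms unfolding bounded_operator_def by blast
  ultimately show ?thesis
    by eventually_elim (simp add: scaleC_minus1)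
qed

lemma E_diff_le:
  assumes "0 \<le> t" "f \<in> Lps M p" "g \<in> Lps M p"
  shows "Lpn M p (\<lambda>x. E t f x - E t g x) \<le> Lpn M p (\<lambda>x. f x - g x)"
proof -
  have "Lpn M p (\<lambda>x. E t f x - E t g x) = Lpn M p (E t (\<lambda>x. f x - g x))"
    using bounded_operator_diff[of "E t" f g] Lp_extension_props[OF assms(1)] assms
    by (intro Lpn_cong_AE p_ge_1) (auto elim!: eventually_mono)
  also have "\<dots> \<le> Lpn M p (\<lambda>x. f x - g x)"
    using assms by (intro E_contraction Lps_diff p_ge_1)
  finally show ?thesis .
qed

text \<open>Continuity in L^2 is transferred to L^p at bounded integrable \<open>f\<close>, where
  \<open>T h f - f\<close> is bounded in L^1 and L^\<infinity> uniformly in \<open>h\<close>.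
  Splitting at a small height \<open>\<eta>\<close> dominates \<open>y powr p\<close> by a multiple
  of \<open>y\<close> plus a multiple of \<open>y powr 2\<close>, for \<open>p\<close> on either
  side of 2.\<close>

lemma T_continuous_0:
  assumes f: "f \<in> bdd_integrable M" and e: "0 < e"
  obtains d where "0 < d" "\<And>h. 0 \<le> h \<Longrightarrow> h < d \<Longrightarrow> Lpn M p (\<lambda>x. T h f x - f x) \<le> ennreal e"
proof -
  obtain c0 where c0: "AE x in M. cmod (f x) \<le> c0" using f by (auto simp: bdd_integrable_def)
  define c where "c = max 1 c0"
  have c: "0 < c" "AE x in M. cmod (f x) \<le> c" using c0 by (auto simp: c_def elim!: eventually_mono)
  define L where "L = (\<integral>x. cmod (f x) \<partial>M)"
  have L: "0 \<le> L" unfolding L_def by (simp add: Bochner_Integration.integral_nonneg)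
  \<comment> \<open>The L^1 norm of \<open>T h f - f\<close> is at most \<open>2 * L\<close>; with
    this \<open>\<eta>\<close> the linear term integrates to at most half of
    \<open>e powr p\<close>. The summand 1 covers \<open>L = 0\<close>.\<close>
  define \<eta> where "\<eta> = (e powr p / (4 * L + 1)) powr (1 / (p - 1))"
  have \<eta>: "0 < \<eta>" using e L by (simp add: \<eta>_def)
  have "\<eta> powr (p - 1) = e powr p / (4 * L + 1)"
    using p_gt_1 e L by (simp add: \<eta>_def powr_powr)
  then have "\<eta> powr (p - 1) * (4 * L + 1) = e powr p" using L by simp
  moreover have "\<eta> powr (p - 1) * (4 * L) \<le> \<eta> powr (p - 1) * (4 * L + 1)"
    by (rule mult_left_mono) auto
  ultimately have \<eta>_L: "\<eta> powr (p - 1) * (2 * L) \<le> e powr p / 2"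
    by simp
  \<comment> \<open>Between \<open>\<eta>\<close> and \<open>2 * c\<close> the power
    \<open>y powr (p - 2)\<close> is largest at one of the ends, depending on the sign of
    \<open>p - 2\<close>; the sum covers both cases.\<close>
  define C where "C = \<eta> powr (p - 2) + (2 * c) powr (p - 2)"
  have C: "0 < C" using \<eta> c by (simp add: C_def add_pos_pos)
  have pw: "y powr p \<le> \<eta> powr (p - 1) * y + C * y powr 2" if "0 \<le> y" "y \<le> 2 * c" for y :: real
  proof (cases "y \<le> \<eta>")
    case True
    have "y powr p = y powr (p - 1) * y" using that p_gt_1 by (cases "y = 0") (auto simp: powr_diff)
    also have "\<dots> \<le> \<eta> powr (p - 1) * y" using True that p_gt_1 by (intro mult_right_mono powr_mono2) auto
    finally show ?thesis using C by (simp add: add_increasing2)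
  next
    case False
    have "y powr (p - 2) \<le> C"
    proof (cases "2 \<le> p")
      case True
      then have "y powr (p - 2) \<le> (2 * c) powr (p - 2)" using that by (intro powr_mono2) auto
      then show ?thesis by (simp add: C_def add_increasing)
    next
      case False': False
      then have "y powr (p - 2) \<le> \<eta> powr (p - 2)" using False \<eta> by (intro powr_mono2') auto
      then show ?thesis by (simp add: C_def add_increasing2)
    qed
    then have "y powr (p - 2) * y powr 2 \<le> C * y powr 2" by (intro mult_right_mono) auto
    moreover have "y powr (p - 2) * y powr 2 = y powr p" by (simp flip: powr_add)
    ultimately show ?thesis using \<eta> that by (simp add: add_increasing)
  qed
  \<comment> \<open>With this bound on the L^2 norm, the quadratic term accounts for the other half
    of \<open>e powr p\<close>.\<close>
  define \<delta> where "\<delta> = (e powr p / (2 * C)) powr (1 / 2)"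
  have \<delta>: "0 < \<delta>" using e C by (simp add: \<delta>_def)
  have \<delta>2: "\<delta> powr 2 = e powr p / (2 * C)" using e C by (simp add: \<delta>_def powr_powr)
  have "((\<lambda>t. Bochner_norm M 2 (\<lambda>x. T t f x - f x)) \<longlongrightarrow> 0) (at_right 0)"
    using continuous bdd_integrable_L2[OF f] by (auto simp: strongly_continuous_L2_def)
  then have "\<forall>\<^sub>F t in at_right 0. Bochner_norm M 2 (\<lambda>x. T t f x - f x) < ennreal \<delta>"
    using \<delta> by (intro order_tendstoD) auto
  then obtain d where d: "0 < d" "\<And>t. 0 < t \<Longrightarrow> t < d \<Longrightarrow> Bochner_norm M 2 (\<lambda>x. T t f x - f x) < ennreal \<delta>"
    unfolding eventually_at_right_field by blast
  have "Lpn M p (\<lambda>x. T h f x - f x) \<le> ennreal e" if h: "0 \<le> h" "h < d" for h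
  proof (cases "h = 0")
    case True
    have "Lpn M p (\<lambda>x. T h f x - f x) = Lpn M p (\<lambda>_. 0 :: complex)"
      using T_0[OF f] True by (intro Lpn_cong_AE p_ge_1) (auto elim!: eventually_mono)
    then show ?thesis using p_gt_0 by (simp add: Bochner_norm_def)
  next
    case False
    interpret dunford_schwartz M "T h" using h(1) by (rule ds)
    define g where "g x = T h f x - f x" for x
    have g_in: "g \<in> bdd_integrable M"
      unfolding g_def[abs_def] using f by (intro bdd_integrable_diff S_in)
    have [measurable]: "g \<in> borel_measurable M" using g_in by (rule bdd_integrable_measurable)
    have g_le: "AE x in M. cmod (g x) \<le> 2 * c"
      using S_Linf[OF f c(2)] c(2)
    proof eventually_elim
      case (elim x)
      then show ?case using norm_triangle_ineq4[of "T h f x" "f x"] by (simp add: g_def)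
    qed
    have "(\<integral>x. cmod (g x) \<partial>M) \<le> (\<integral>x. cmod (T h f x) + cmod (f x) \<partial>M)"
      using g_in f S_in[OF f] norm_triangle_ineq4
      by (intro integral_mono) (auto simp: bdd_integrable_def g_def)
    also have "\<dots> = (\<integral>x. cmod (T h f x) \<partial>M) + L"
      using f S_in[OF f] by (simp add: bdd_integrable_def L_def)
    also have "\<dots> \<le> 2 * L" using S_L1[OF f] by (simp add: L_def)
    finally have "ennreal (\<integral>x. cmod (g x) \<partial>M) \<le> ennreal (2 * L)" by (rule ennreal_leI)
    then have g_L1: "(\<integral>\<^sup>+x. ennreal (cmod (g x)) \<partial>M) \<le> ennreal (2 * L)"
      using g_in by (subst nn_integral_eq_integral) (auto simp: bdd_integrable_def)
    have "Lpn M 2 g < ennreal \<delta>"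
      using d(2)[of h] h False by (simp add: g_def[abs_def])
    then have "(\<integral>\<^sup>+x. ennreal_powr (ennreal (cmod (g x))) 2 \<partial>M) \<le> ennreal_powr (ennreal \<delta>) 2"
      by (subst Lp_norm_le_iff[symmetric]) (auto simp: Bochner_norm_def)
    then have g_L2: "(\<integral>\<^sup>+x. ennreal (cmod (g x) powr 2) \<partial>M) \<le> ennreal (e powr p / (2 * C))"
      unfolding \<delta>2[symmetric] using \<delta> by (simp only: ennreal_powr_ennreal norm_ge_zero less_imp_le)
    have "(\<integral>\<^sup>+x. ennreal_powr (ennreal (cmod (g x))) p \<partial>M)
        \<le> (\<integral>\<^sup>+x. ennreal (\<eta> powr (p - 1)) * ennreal (cmod (g x)) + ennreal C * ennreal (cmod (g x) powr 2) \<partial>M)"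
    proof (rule nn_integral_mono_AE)
      show "AE x in M. ennreal_powr (ennreal (cmod (g x))) p
          \<le> ennreal (\<eta> powr (p - 1)) * ennreal (cmod (g x)) + ennreal C * ennreal (cmod (g x) powr 2)"
        using g_le
      proof eventually_elim
        case (elim x)
        then have "ennreal (cmod (g x) powr p) \<le> ennreal (\<eta> powr (p - 1) * cmod (g x) + C * cmod (g x) powr 2)"
          by (intro ennreal_leI pw) auto
        then show ?case using C by (simp add: ennreal_powr_ennreal ennreal_mult)
      qed
    qed
    also have "\<dots> = ennreal (\<eta> powr (p - 1)) * (\<integral>\<^sup>+x. ennreal (cmod (g x)) \<partial>M)
        + ennreal C * (\<integral>\<^sup>+x. ennreal (cmod (g x) powr 2) \<partial>M)"
      by (simp add: nn_integral_add nn_integral_cmult)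
    also have "\<dots> \<le> ennreal (\<eta> powr (p - 1)) * ennreal (2 * L) + ennreal C * ennreal (e powr p / (2 * C))"
      using g_L1 g_L2 by (intro add_mono mult_left_mono) auto
    also have "\<dots> = ennreal (\<eta> powr (p - 1) * (2 * L) + e powr p / 2)"
      using C L by (simp flip: ennreal_mult ennreal_plus)
    also have "\<dots> \<le> ennreal (e powr p)"
      using \<eta>_L by (intro ennreal_leI) simp
    finally show ?thesis
      using p_gt_0 e unfolding Bochner_norm_def g_def by (simp add: Lp_norm_le_iff ennreal_powr_ennreal)
  qed
  with that d(1) show ?thesis by blast
qed

text \<open>By the semigroup law the difference between times \<open>s \<le> t\<close> is
  \<open>T s\<close> applied to \<open>T (t - s) g - g\<close>, so contractivity makes continuity at
  0 uniform in \<open>s\<close>. Density of the bounded integrable functions carries this over to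
  \<open>f\<close>.\<close>

lemma E_uniformly_continuous:
  assumes f: "f \<in> Lps M p" and e: "0 < e"
  obtains d where "0 < d"
    "\<And>s t. 0 \<le> s \<Longrightarrow> 0 \<le> t \<Longrightarrow> \<bar>s - t\<bar> < d \<Longrightarrow> Lpn M p (\<lambda>x. E s f x - E t f x) \<le> ennreal e"
proof -
  obtain g where g: "g \<in> bdd_integrable M" and gf: "Lpn M p (\<lambda>x. g x - f x) \<le> ennreal (e / 3)"
    using bdd_integrable_dense[OF f _ p_ge_1, of "e / 3"] e by auto
  note gL = bdd_integrable_Lps[OF g p_ge_1]
  obtain d where d: "0 < d" "\<And>h. 0 \<le> h \<Longrightarrow> h < d \<Longrightarrow> Lpn M p (\<lambda>x. T h g x - g x) \<le> ennreal (e / 3)"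
    using T_continuous_0[OF g, of "e / 3"] e by auto
  have E_g: "Lpn M p (\<lambda>x. E t g x - E s g x) \<le> ennreal (e / 3)" if "0 \<le> s" "s \<le> t" "t - s < d" for s t
  proof -
    interpret s: dunford_schwartz M "T s" using that(1) by (rule ds)
    have T_in': "T (t - s) g \<in> bdd_integrable M" using that g by (intro T_in) auto
    have "AE x in M. E t g x - E s g x = T s (\<lambda>y. T (t - s) g y - g y) x"
      using E_eq[OF _ g, of t] E_eq[OF _ g, of s] T_add[of s "t - s" g] T_diff[OF that(1) T_in' g] that g
      by (auto elim!: eventually_elim2)
    then have "Lpn M p (\<lambda>x. E t g x - E s g x) = Lpn M p (T s (\<lambda>y. T (t - s) g y - g y))"
      by (rule Lpn_cong_AE[OF p_ge_1])
    also have "\<dots> \<le> Lpn M p (\<lambda>y. T (t - s) g y - g y)"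
      using that T_in' g by (intro T_contraction bdd_integrable_diff)
    also have "\<dots> \<le> ennreal (e / 3)" using d(2)[of "t - s"] that by simp
    finally show ?thesis .
  qed
  have "Lpn M p (\<lambda>x. E s f x - E t f x) \<le> ennreal e" if st: "0 \<le> s" "0 \<le> t" "\<bar>s - t\<bar> < d" for s t
  proof -
    have m: "strongly_measurable M (E r f)" "strongly_measurable M (E r g)" if "0 \<le> r" for r
      using that f gL by (auto intro: LpsD E_Lps)
    have gf': "Lpn M p (\<lambda>x. E r g x - E r f x) \<le> ennreal (e / 3)" if "0 \<le> r" for r
      using E_diff_le[OF that gL f] gf by (rule order_trans)
    have "Lpn M p (\<lambda>x. E s g x - E t g x) \<le> ennreal (e / 3)"
      using E_g[of s t] E_g[of t s] st Lpn_minus_commute[OF p_ge_1, of M "E s g" "E t g"] by (cases "s \<le> t") auto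
    then have "Lpn M p (\<lambda>x. E s g x - E t f x) \<le> ennreal (e / 3 + e / 3)"
      by (rule Lpn_triangle_le[OF p_ge_1]) (use gf' st m e in auto)
    then have "Lpn M p (\<lambda>x. E s f x - E t f x) \<le> ennreal (e / 3 + (e / 3 + e / 3))"
      by (rule Lpn_triangle_le[OF p_ge_1, rotated])
        (use gf'[of s] Lpn_minus_commute[OF p_ge_1, of M "E s g" "E s f"] st m e in auto)
    then show ?thesis by simp
  qed
  with that d(1) show ?thesis by blast
qed

end

text \<open>The device by which maximal inequalities pass to limits: over a finite index set,
  functions may be replaced by approximants at the cost of the sum of the errors in norm.\<close>

lemma Lp_norm_SUP_perturb:
  fixes F G :: "'i \<Rightarrow> 'a \<Rightarrow> 'b::real_normed_vector"
  assumes p: "1 \<le> p" and Q: "finite Q"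
    and F: "\<And>q. q \<in> Q \<Longrightarrow> strongly_measurable M (F q)" and G: "\<And>q. q \<in> Q \<Longrightarrow> strongly_measurable M (G q)"
  shows "Lp_norm M (ennreal p) (\<lambda>x. SUP q\<in>Q. ennreal (norm (F q x)))
    \<le> Lp_norm M (ennreal p) (\<lambda>x. SUP q\<in>Q. ennreal (norm (G q x))) + (\<Sum>q\<in>Q. Lpn M p (\<lambda>x. F q x - G q x))"
proof -
  have FG: "(\<lambda>x. ennreal (norm (F q x - G q x))) \<in> borel_measurable M" if "q \<in> Q" for q
    using that F G by (intro Lpn_measurable strongly_measurable_diff)
  have "Lp_norm M (ennreal p) (\<lambda>x. SUP q\<in>Q. ennreal (norm (F q x)))
    \<le> Lp_norm M (ennreal p) (\<lambda>x. (SUP q\<in>Q. ennreal (norm (G q x))) + (\<Sum>q\<in>Q. ennreal (norm (F q x - G q x))))"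
  proof (intro Lp_norm_mono_AE AE_I2 SUP_least)
    fix x q assume q: "q \<in> Q"
    have "ennreal (norm (F q x)) \<le> ennreal (norm (G q x) + norm (F q x - G q x))"
      by (intro ennreal_leI norm_triangle_sub)
    also have "\<dots> = ennreal (norm (G q x)) + ennreal (norm (F q x - G q x))"
      by (simp add: ennreal_plus)
    also have "\<dots> \<le> (SUP q\<in>Q. ennreal (norm (G q x))) + (\<Sum>q\<in>Q. ennreal (norm (F q x - G q x)))"
      using q Q by (intro add_mono SUP_upper member_le_sum) auto
    finally show "ennreal (norm (F q x)) \<le> (SUP q\<in>Q. ennreal (norm (G q x))) + (\<Sum>q\<in>Q. ennreal (norm (F q x - G q x)))" .
  qed (use p in simp)
  also have "\<dots> \<le> Lp_norm M (ennreal p) (\<lambda>x. SUP q\<in>Q. ennreal (norm (G q x)))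
      + Lp_norm M (ennreal p) (\<lambda>x. \<Sum>q\<in>Q. ennreal (norm (F q x - G q x)))"
    by (intro Lp_norm_add p borel_measurable_SUP borel_measurable_sum FG Lpn_measurable G countable_finite Q)
  also have "Lp_norm M (ennreal p) (\<lambda>x. \<Sum>q\<in>Q. ennreal (norm (F q x - G q x))) \<le> (\<Sum>q\<in>Q. Lpn M p (\<lambda>x. F q x - G q x))"
    unfolding Bochner_norm_def using FG by (intro Lp_norm_sum p)
  finally show ?thesis by (simp add: add_left_mono)
qed

lemma Lpn_tensor_diff_le:
  assumes p: "1 \<le> p" and "\<And>k. strongly_measurable M (f k)" "\<And>k. strongly_measurable M (g k)"
    and le: "\<And>k. k < m \<Longrightarrow> Lpn M p (\<lambda>x. f k x - g k x) \<le> ennreal d" and d: "0 \<le> d"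
  shows "Lpn M p (\<lambda>x. tensor m u f x - tensor m u g x) \<le> ennreal ((\<Sum>k<m. norm (u k)) * d)"
proof -
  have m: "(\<lambda>x. ennreal (cmod (f k x - g k x))) \<in> borel_measurable M" for k
    using assms by (intro Lpn_measurable strongly_measurable_diff)
  have "Lpn M p (\<lambda>x. tensor m u f x - tensor m u g x)
      \<le> Lp_norm M (ennreal p) (\<lambda>x. \<Sum>k<m. ennreal (norm (u k)) * ennreal (cmod (f k x - g k x)))"
    unfolding tensor_diff[symmetric] Bochner_norm_def
  proof (intro Lp_norm_mono_AE AE_I2)
    fix x
    show "ennreal (norm (tensor m u (\<lambda>k x. f k x - g k x) x)) \<le> (\<Sum>k<m. ennreal (norm (u k)) * ennreal (cmod (f k x - g k x)))"
      using ennreal_leI[OF norm_tensor_le[of m u "\<lambda>k x. f k x - g k x" x]]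
      by (simp add: sum_nonneg flip: ennreal_mult sum_ennreal)
  qed (use p in simp)
  also have "\<dots> \<le> (\<Sum>k<m. Lp_norm M (ennreal p) (\<lambda>x. ennreal (norm (u k)) * ennreal (cmod (f k x - g k x))))"
    using m by (intro Lp_norm_sum p borel_measurable_times_ennreal) auto
  also have "\<dots> = (\<Sum>k<m. ennreal (norm (u k)) * Lpn M p (\<lambda>x. f k x - g k x))"
    using p m by (simp add: Lp_norm_cmult Bochner_norm_def)
  also have "\<dots> \<le> (\<Sum>k<m. ennreal (norm (u k)) * ennreal d)"
    using le by (intro sum_mono mult_left_mono) auto
  also have "\<dots> = ennreal ((\<Sum>k<m. norm (u k)) * d)"
    using d by (simp add: sum_distrib_right flip: ennreal_mult sum_ennreal)
  finally show ?thesis .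
qed

lemma tensor_Lps:
  assumes p: "1 \<le> p" and "\<And>k. k < m \<Longrightarrow> f k \<in> Lps M p"
  shows "tensor m u f \<in> Lps M p"
  unfolding tensor_def[abs_def]
proof (intro Lps_sum p)
  fix k assume "k \<in> {..<m}"
  then have f: "f k \<in> Lps M p" using assms by simp
  have "(\<lambda>x. ennreal (norm (f k x *\<^sub>C u k))) = (\<lambda>x. ennreal (norm (u k)) * ennreal (cmod (f k x)))"
    by (simp add: norm_scaleC mult.commute flip: ennreal_mult)
  then have "Lpn M p (\<lambda>x. f k x *\<^sub>C u k) = ennreal (norm (u k)) * Lpn M p (f k)"
    using p Lp_norm_cmult[OF _ Lpn_measurable[OF LpsD(1)[OF f]]] by (simp add: Bochner_norm_def)
  then show "(\<lambda>x. f k x *\<^sub>C u k) \<in> Lps M p"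
    using f by (simp add: Lspace_def ennreal_mult_less_top strongly_measurable_scaleC strongly_measurable_const)
qed

text \<open>Concatenating the vectors and the components shows that tensors are closed under
  addition; the shift by \<open>m\<close> addresses the second list.\<close>

lemma tensor_append:
  "tensor (m + m') (\<lambda>k. if k < m then u k else u' (k - m)) (\<lambda>k. if k < m then f k else f' (k - m)) x
    = tensor m u f x + tensor m' u' f' x"
  unfolding tensor_def
  by (induction m') (auto simp: add.assoc intro!: sum.cong)

section \<open>Riemann sums and ergodic means\<close>

text \<open>Integrating the indicator of \<open>K\<close> cell by cell adds up the lengths of the
  intersections; this lets two divisions be compared on their common refinement.\<close>

lemma measure_tagged_division_Int:
  fixes K :: "real set"
  assumes D: "D tagged_division_of {0..t}" and K: "K = {a..b}" "K \<subseteq> {0..t}"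
  shows "measure lborel K = (\<Sum>(s, L)\<in>D. measure lborel (K \<inter> L))"
proof -
  have one: "((\<lambda>x. if x \<in> K then 1 else 0 :: real) has_integral measure lborel (K \<inter> L)) L" if "L = {c..d}" for L and c d :: real
    unfolding has_integral_restrict_Int
    using has_integral_const_real[of "1::real" "max a c" "min b d"] by (simp add: K that Int_atLeastAtMost)
  have 1: "((\<lambda>x. if x \<in> K then 1 else 0 :: real) has_integral (\<Sum>(s, L)\<in>D. measure lborel (K \<inter> L))) {0..t}"
  proof (rule has_integral_combine_tagged_division[OF D])
    fix s L assume "(s, L) \<in> D"
    then obtain c d where "L = {c..d}" using tagged_division_ofD(4)[OF D] by (metis box_real(2))
    then show "((\<lambda>x. if x \<in> K then 1 else 0 :: real) has_integral measure lborel (K \<inter> L)) L" by (rule one)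
  qed
  have 2: "((\<lambda>x. if x \<in> K then 1 else 0 :: real) has_integral measure lborel (K \<inter> {0..t})) {0..t}"
    by (rule one) (rule refl)
  have "K \<inter> {0..t} = K" using K by auto
  with has_integral_unique[OF 2 1] show ?thesis by simp
qed

text \<open>With left endpoints as tags, the Riemann sum of an orbit of the semigroup is
  \<open>t\<close> times the average of the \<open>n\<close> values at the times
  \<open>j * (t / n)\<close>, starting with time 0.\<close>

definition uniform_division :: "real \<Rightarrow> nat \<Rightarrow> (real \<times> real set) set"
  where "uniform_division t n = (\<lambda>j. (real j * (t / real n), {real j * (t / real n) .. real (Suc j) * (t / real n)})) ` {..<n}"

lemma uniform_division_tagged:
  assumes t: "0 < t" and n: "0 < n"
  shows "uniform_division t n tagged_division_of {0..t}"
proof -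
  define h where "h = t / real n"
  have h: "0 < h" "real n * h = t" using t n by (auto simp: h_def)
  have mono: "real i * h \<le> real j * h" if "i \<le> j" for i j
    using that h by simp
  show ?thesis
    unfolding uniform_division_def h_def[symmetric]
  proof (rule tagged_division_ofI)
    fix x K assume "(x, K) \<in> (\<lambda>j. (real j * h, {real j * h .. real (Suc j) * h})) ` {..<n}"
    then obtain j where j: "j < n" "x = real j * h" "K = {real j * h .. real (Suc j) * h}" by auto
    show "x \<in> K" using j mono[of j "Suc j"] by auto
    show "K \<subseteq> {0..t}" using j mono[of "Suc j" n] h by (auto simp: intro: order_trans)
    show "\<exists>a b. K = cbox a b" using j by auto
  next
    fix x K y L
    assume "(x, K) \<in> (\<lambda>j. (real j * h, {real j * h .. real (Suc j) * h})) ` {..<n}"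
      and "(y, L) \<in> (\<lambda>j. (real j * h, {real j * h .. real (Suc j) * h})) ` {..<n}" and ne: "(x, K) \<noteq> (y, L)"
    then obtain i j where ij: "K = {real i * h .. real (Suc i) * h}" "L = {real j * h .. real (Suc j) * h}" "i \<noteq> j" by auto
    have "real (Suc i) * h \<le> real j * h \<or> real (Suc j) * h \<le> real i * h"
      using mono[of "Suc i" j] mono[of "Suc j" i] ij(3) by (cases "i < j") auto
    then show "interior K \<inter> interior L = {}"
      unfolding ij interior_atLeastAtMost_real by auto
  next
    show "\<Union>{K. \<exists>x. (x, K) \<in> (\<lambda>j. (real j * h, {real j * h .. real (Suc j) * h})) ` {..<n}} = {0..t}" (is "?U = _")
    proof
      show "?U \<subseteq> {0..t}"
      proof
        fix y assume "y \<in> ?U"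
        then obtain j where j: "j < n" and y: "y \<in> {real j * h .. real (Suc j) * h}" by blast
        have "0 \<le> real j * h" using h by simp
        moreover have "real (Suc j) * h \<le> t" using mono[of "Suc j" n] h j by simp
        ultimately show "y \<in> {0..t}" using y unfolding atLeastAtMost_iff by linarith
      qed
      show "{0..t} \<subseteq> ?U"
      proof
        fix y assume y: "y \<in> {0..t}"
        \<comment> \<open>The minimum with \<open>n - 1\<close> assigns the right endpoint
          \<open>y = t\<close> to the last cell.\<close>
        define j where "j = min (n - 1) (nat \<lfloor>y / h\<rfloor>)"
        have j: "j < n" using n by (simp add: j_def)
        have "0 \<le> y / h" using y h by simp
        then have "real (nat \<lfloor>y / h\<rfloor>) \<le> y / h" by (rule of_nat_floor)
        then have "real j \<le> y / h" by (simp add: j_def min_def split: if_splits)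
        moreover have "y / h \<le> real (Suc j)"
        proof (cases "nat \<lfloor>y / h\<rfloor> \<le> n - 1")
          case True
          then show ?thesis by (simp add: j_def) linarith
        next
          case False
          then have "Suc j = n" using n by (simp add: j_def)
          then show ?thesis using y h by (simp add: divide_le_eq)
        qed
        ultimately have "y \<in> {real j * h .. real (Suc j) * h}" using h by (simp add: field_simps)
        then show "y \<in> ?U" using j by blast
      qed
    qed
  qed simp
qed

lemma uniform_division_fine:
  assumes "0 < t" "0 < d" "t / d < real n"
  shows "(\<lambda>s. ball s d) fine uniform_division t n"
proof -
  have "0 < real n" using assms by (meson divide_pos_pos less_trans)
  then have "t / real n < d" using assms by (simp add: field_simps)
  moreover have "real (Suc j) * (t / real n) = real j * (t / real n) + t / real n" for j
    by (simp only: of_nat_Suc distrib_right mult_1 add.commute)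
  ultimately show ?thesis
    by (fastforce simp: fine_def uniform_division_def dist_real_def simp del: of_nat_Suc times_divide_eq_right)
qed

lemma uniform_division_sum:
  fixes \<phi> :: "real \<Rightarrow> 'c::real_vector"
  assumes t: "0 < t" and n: "0 < n"
  shows "(\<Sum>(s, K)\<in>uniform_division t n. measure lborel K *\<^sub>R \<phi> s) = (\<Sum>j<n. (t / real n) *\<^sub>R \<phi> (real j * (t / real n)))"
proof -
  have "inj_on (\<lambda>j. (real j * (t / real n), {real j * (t / real n) .. real (Suc j) * (t / real n)})) {..<n}"
    using t n by (auto simp: inj_on_def)
  then show ?thesis
    unfolding uniform_division_def using t
    by (subst sum.reindex) (auto simp: algebra_simps add_divide_distrib intro!: sum.cong)
qed

section \<open>Riemann integrability of uniformly continuous maps into L^p\<close>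

context
  fixes M :: "'a measure" and p t :: real and \<phi> :: "real \<Rightarrow> 'a \<Rightarrow> complex"
  assumes p: "1 \<le> p" and t: "0 < t" and \<phi>: "\<And>s. 0 \<le> s \<Longrightarrow> s \<le> t \<Longrightarrow> \<phi> s \<in> Lps M p"
    and unif: "\<And>e. 0 < e \<Longrightarrow> \<exists>d>0. \<forall>s r. 0 \<le> s \<longrightarrow> s \<le> t \<longrightarrow> 0 \<le> r \<longrightarrow> r \<le> t \<longrightarrow> \<bar>s - r\<bar> < d \<longrightarrow>
      Lpn M p (\<lambda>x. \<phi> s x - \<phi> r x) \<le> ennreal e"
begin

abbreviation riemann_sum :: "(real \<times> real set) set \<Rightarrow> 'a \<Rightarrow> complex"
  where "riemann_sum D x \<equiv> (\<Sum>(s, K)\<in>D. measure lborel K *\<^sub>R \<phi> s x)"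

lemma riemann_sum_Lps:
  assumes D: "D tagged_division_of {0..t}"
  shows "riemann_sum D \<in> Lps M p"
proof -
  have "(\<lambda>x. case y of (s, K) \<Rightarrow> measure lborel K *\<^sub>R \<phi> s x) \<in> Lps M p" if "y \<in> D" for y
  proof -
    obtain s K where y: "y = (s, K)" by fastforce
    have "s \<in> {0..t}" using tagged_division_ofD(2,3)[OF D] that y by blast
    then have "(\<lambda>x. of_real (measure lborel K) *\<^sub>C \<phi> s x) \<in> Lps M p"
      using \<phi> by (intro Lps_scaleC p) auto
    then show ?thesis by (simp add: y scaleC_of_real)
  qed
  then show ?thesis by (rule Lps_sum[OF p])
qed

text \<open>Both sums are rewritten over the intersections of a cell of \<open>D\<close> with a cell
  of \<open>D'\<close>. Only cells that meet contribute, their tags lie close together, and the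
  lengths of the intersections add up to \<open>t\<close>.\<close>

lemma riemann_sum_diff:
  assumes e: "0 < e"
  obtains d where "0 < d"
    "\<And>D D'. D tagged_division_of {0..t} \<Longrightarrow> D' tagged_division_of {0..t} \<Longrightarrow>
      (\<lambda>s. ball s d) fine D \<Longrightarrow> (\<lambda>s. ball s d) fine D' \<Longrightarrow>
      Lpn M p (\<lambda>x. riemann_sum D x - riemann_sum D' x) \<le> ennreal e"
proof -
  obtain d where d: "0 < d" and \<phi>_d: "\<And>s r. 0 \<le> s \<Longrightarrow> s \<le> t \<Longrightarrow> 0 \<le> r \<Longrightarrow> r \<le> t \<Longrightarrow> \<bar>s - r\<bar> < d \<Longrightarrow>
      Lpn M p (\<lambda>x. \<phi> s x - \<phi> r x) \<le> ennreal (e / t)"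
    using unif[of "e / t"] e t by auto
  \<comment> \<open>Fineness is required with radius \<open>d / 2\<close>: cells that meet share a
    point within \<open>d / 2\<close> of either tag, so the tags differ by less than
    \<open>d\<close>.\<close>
  have "Lpn M p (\<lambda>x. riemann_sum D x - riemann_sum D' x) \<le> ennreal e"
    if D: "D tagged_division_of {0..t}" and D': "D' tagged_division_of {0..t}"
      and fine: "(\<lambda>s. ball s (d / 2)) fine D" "(\<lambda>s. ball s (d / 2)) fine D'" for D D'
  proof -
    have content: "measure lborel K = (\<Sum>(r, L)\<in>D'. measure lborel (K \<inter> L))"
      if c: "(s, K) \<in> D" "D tagged_division_of {0..t}" "D' tagged_division_of {0..t}" for s K D D'
    proof -
      obtain a b where "K = {a..b}" using tagged_division_ofD(4)[OF c(2,1)] by (metis box_real(2))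
      then show ?thesis
        using measure_tagged_division_Int[OF c(3)] tagged_division_ofD(3)[OF c(2,1)] by blast
    qed
    have rs: "riemann_sum D x = (\<Sum>(s, K)\<in>D. \<Sum>(r, L)\<in>D'. measure lborel (K \<inter> L) *\<^sub>R \<phi> s x)" for x
      using content[OF _ D D'] by (intro sum.cong refl) (auto simp: scaleR_sum_left case_prod_beta)
    have rs': "riemann_sum D' x = (\<Sum>(s, K)\<in>D. \<Sum>(r, L)\<in>D'. measure lborel (K \<inter> L) *\<^sub>R \<phi> r x)" for x
    proof -
      have "riemann_sum D' x = (\<Sum>(r, L)\<in>D'. \<Sum>(s, K)\<in>D. measure lborel (L \<inter> K) *\<^sub>R \<phi> r x)"
        using content[OF _ D' D] by (intro sum.cong refl) (auto simp: scaleR_sum_left case_prod_beta)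
      then show ?thesis
        unfolding case_prod_beta by (subst sum.swap) (simp add: Int_commute)
    qed
    define g where "g y z x = measure lborel (snd y \<inter> snd z) *\<^sub>R (\<phi> (fst y) x - \<phi> (fst z) x)" for y z :: "real \<times> real set" and x
    have tags: "0 \<le> s \<and> s \<le> t" if "(s, K) \<in> D \<or> (s, K) \<in> D'" for s K
    proof -
      have "s \<in> {0..t}"
        using that tagged_division_ofD(2,3)[OF D, of s K] tagged_division_ofD(2,3)[OF D', of s K] by blast
      then show ?thesis by simp
    qed
    have g_meas: "strongly_measurable M (g y z)" if "y \<in> D" "z \<in> D'" for y z
    proof -
      have "(\<lambda>x. of_real (measure lborel (snd y \<inter> snd z)) *\<^sub>C (\<phi> (fst y) x - \<phi> (fst z) x)) \<in> Lps M p"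
        using that tags[of "fst y" "snd y"] tags[of "fst z" "snd z"]
        by (intro Lps_scaleC Lps_diff p \<phi>) auto
      then show ?thesis unfolding scaleC_of_real g_def[abs_def] by (rule LpsD)
    qed
    have g_le: "Lpn M p (g y z) \<le> ennreal (measure lborel (snd y \<inter> snd z) * (e / t))"
      if yz: "y \<in> D" "z \<in> D'" for y z
    proof (cases "snd y \<inter> snd z = {}")
      case True
      then have "g y z = (\<lambda>_. 0)" by (simp add: g_def fun_eq_iff)
      then show ?thesis using p by (simp add: Bochner_norm_def)
    next
      case False
      then obtain a where "a \<in> snd y" "a \<in> snd z" by auto
      moreover have "snd y \<subseteq> ball (fst y) (d / 2)" "snd z \<subseteq> ball (fst z) (d / 2)"
        using fine yz unfolding fine_def case_prod_beta by blast+
      ultimately have "a \<in> ball (fst y) (d / 2)" "a \<in> ball (fst z) (d / 2)" by blast+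
      then have "dist (fst y) a < d / 2" "dist (fst z) a < d / 2" by (simp_all only: mem_ball)
      then have "\<bar>fst y - fst z\<bar> < d" unfolding dist_real_def by linarith
      then have le: "Lpn M p (\<lambda>x. \<phi> (fst y) x - \<phi> (fst z) x) \<le> ennreal (e / t)"
        using yz tags[of "fst y" "snd y"] tags[of "fst z" "snd z"] by (intro \<phi>_d) auto
      have "Lpn M p (g y z) = ennreal (cmod (of_real (measure lborel (snd y \<inter> snd z)))) * Lpn M p (\<lambda>x. \<phi> (fst y) x - \<phi> (fst z) x)"
        unfolding g_def[abs_def] scaleC_of_real[symmetric]
        using yz tags[of "fst y" "snd y"] tags[of "fst z" "snd z"] \<phi>
        by (intro Lpn_scaleC p strongly_measurable_diff) (auto intro: LpsD)
      also have "\<dots> \<le> ennreal (measure lborel (snd y \<inter> snd z)) * ennreal (e / t)"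
        using le by (simp add: mult_left_mono)
      finally show ?thesis using e t by (subst ennreal_mult) auto
    qed
    have "Lpn M p (\<lambda>x. riemann_sum D x - riemann_sum D' x) = Lpn M p (\<lambda>x. \<Sum>y\<in>D. \<Sum>z\<in>D'. g y z x)"
      unfolding rs rs' case_prod_beta g_def by (simp add: sum_subtractf scaleR_diff_right)
    also have "\<dots> \<le> (\<Sum>y\<in>D. Lpn M p (\<lambda>x. \<Sum>z\<in>D'. g y z x))"
      using g_meas by (intro Lpn_sum_le p strongly_measurable_sum)
    also have "\<dots> \<le> (\<Sum>y\<in>D. \<Sum>z\<in>D'. Lpn M p (g y z))"
      using g_meas by (intro sum_mono Lpn_sum_le p)
    also have "\<dots> \<le> (\<Sum>y\<in>D. \<Sum>z\<in>D'. ennreal (measure lborel (snd y \<inter> snd z) * (e / t)))"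
      using g_le by (intro sum_mono)
    also have "\<dots> = ennreal (\<Sum>y\<in>D. \<Sum>z\<in>D'. measure lborel (snd y \<inter> snd z) * (e / t))"
      using e t by (simp add: sum_nonneg)
    also have "(\<Sum>y\<in>D. \<Sum>z\<in>D'. measure lborel (snd y \<inter> snd z) * (e / t))
        = (\<Sum>y\<in>D. \<Sum>z\<in>D'. measure lborel (snd y \<inter> snd z)) * (e / t)"
      by (simp only: sum_distrib_right)
    also have "(\<Sum>y\<in>D. \<Sum>z\<in>D'. measure lborel (snd y \<inter> snd z)) = (\<Sum>y\<in>D. measure lborel (snd y))"
    proof (intro sum.cong refl)
      fix y assume "y \<in> D"
      then show "(\<Sum>z\<in>D'. measure lborel (snd y \<inter> snd z)) = measure lborel (snd y)"
        using content[of "fst y" "snd y" D D'] D D' by (simp add: case_prod_beta)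
    qed
    also have "(\<Sum>y\<in>D. measure lborel (snd y)) = t"
    proof -
      have "{0..t} \<inter> snd y = snd y" if "y \<in> D" for y
        using tagged_division_ofD(3)[OF D, of "fst y" "snd y"] that by auto
      then show ?thesis
        using measure_tagged_division_Int[OF D, of "{0..t}" 0 t] t by (simp add: case_prod_beta)
    qed
    finally show ?thesis using t by simp
  qed
  then show ?thesis using that[of "d / 2"] d by auto
qed

text \<open>Completeness yields a limit along the uniform divisions; the sum of any other fine
  division is close to those of fine uniform ones, hence to the same limit.\<close>

lemma Lp_has_integral_exists: "\<exists>g. Lp_has_integral M (ennreal p) \<phi> g 0 t"
proof -
  let ?D = "\<lambda>n. uniform_division t (Suc n)"
  have tag: "?D n tagged_division_of {0..t}" for n
    using t by (intro uniform_division_tagged) auto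
  have fine: "\<exists>N. \<forall>n\<ge>N. (\<lambda>s. ball s d) fine ?D n" if "0 < d" for d
  proof -
    obtain N :: nat where "t / d < real N" using reals_Archimedean2 by blast
    then have "(\<lambda>s. ball s d) fine ?D n" if "N \<le> n" for n
      using that t \<open>0 < d\<close> by (intro uniform_division_fine) auto
    then show ?thesis by blast
  qed
  obtain g where g: "g \<in> Lps M p" and lim: "(\<lambda>n. Lpn M p (\<lambda>x. riemann_sum (?D n) x - g x)) \<longlonglongrightarrow> 0"
  proof (rule Lps_complete[OF p, where G="\<lambda>n. riemann_sum (?D n)"])
    show "riemann_sum (?D n) \<in> Lps M p" for n using tag by (rule riemann_sum_Lps)
    fix e :: real assume "0 < e"
    then obtain d where d: "0 < d" "\<And>D D'. D tagged_division_of {0..t} \<Longrightarrow> D' tagged_division_of {0..t} \<Longrightarrow>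
      (\<lambda>s. ball s d) fine D \<Longrightarrow> (\<lambda>s. ball s d) fine D' \<Longrightarrow> Lpn M p (\<lambda>x. riemann_sum D x - riemann_sum D' x) \<le> ennreal e"
      by (rule riemann_sum_diff) blast
    then show "\<exists>K. \<forall>m\<ge>K. \<forall>n\<ge>K. Lpn M p (\<lambda>x. riemann_sum (?D m) x - riemann_sum (?D n) x) \<le> ennreal e"
      using fine[OF d(1)] tag by blast
  qed
  have "Lp_has_integral M (ennreal p) \<phi> g 0 t"
    unfolding Lp_has_integral_def
  proof (intro conjI g allI impI)
    fix e :: ennreal assume "0 < e"
    then obtain e0 where e0: "0 < e0" "ennreal e0 < e"
      by (metis dense ennreal_cases ennreal_less_zero_iff less_top top.not_eq_extremum order.strict_trans)
    obtain d where d: "0 < d" "\<And>D D'. D tagged_division_of {0..t} \<Longrightarrow> D' tagged_division_of {0..t} \<Longrightarrow>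
      (\<lambda>s. ball s d) fine D \<Longrightarrow> (\<lambda>s. ball s d) fine D' \<Longrightarrow> Lpn M p (\<lambda>x. riemann_sum D x - riemann_sum D' x) \<le> ennreal (e0 / 2)"
      by (rule riemann_sum_diff[OF half_gt_zero[OF e0(1)]]) blast
    show "\<exists>d>0. \<forall>D. D tagged_division_of {0..t} \<and> (\<lambda>s. ball s d) fine D \<longrightarrow> Lpn M p (\<lambda>x. riemann_sum D x - g x) < e"
    proof (intro exI[of _ d] conjI d allI impI)
      fix D assume D: "D tagged_division_of {0..t} \<and> (\<lambda>s. ball s d) fine D"
      obtain N where N: "\<And>n. N \<le> n \<Longrightarrow> (\<lambda>s. ball s d) fine ?D n" using fine[OF d(1)] by blast
      have "\<forall>\<^sub>F n in sequentially. Lpn M p (\<lambda>x. riemann_sum (?D n) x - g x) < ennreal (e0 / 2)"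
        using e0 by (intro order_tendstoD(2)[OF lim]) simp
      then obtain N' where N': "\<And>n. N' \<le> n \<Longrightarrow> Lpn M p (\<lambda>x. riemann_sum (?D n) x - g x) < ennreal (e0 / 2)"
        unfolding eventually_sequentially by blast
      define n where "n = max N N'"
      have n: "N \<le> n" "Lpn M p (\<lambda>x. riemann_sum (?D n) x - g x) \<le> ennreal (e0 / 2)"
        using N'[of n] by (auto simp: n_def less_imp_le)
      have "Lpn M p (\<lambda>x. riemann_sum D x - g x) \<le> ennreal (e0 / 2 + e0 / 2)"
        by (rule Lpn_triangle_le[OF p, where G="riemann_sum (?D n)"])
          (use d(2)[OF _ tag _ N[OF n(1)]] D n e0 g tag in \<open>auto intro: LpsD riemann_sum_Lps\<close>)
      then show "Lpn M p (\<lambda>x. riemann_sum D x - g x) < e" using e0 by simp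
    qed
  qed
  then show ?thesis by blast
qed

end

section \<open>From averages of one operator to the ergodic maximal function\<close>

context contraction_semigroup
begin

definition avg :: "real \<Rightarrow> nat \<Rightarrow> ('a \<Rightarrow> complex) \<Rightarrow> 'a \<Rightarrow> complex"
  where "avg h n f x = complex_of_real (1 / real n) * (\<Sum>j<n. E (real j * h) f x)"

abbreviation A :: "real \<Rightarrow> ('a \<Rightarrow> complex) \<Rightarrow> 'a \<Rightarrow> complex"
  where "A t \<equiv> ergodic_mean M (ennreal p) T t"

text \<open>Uniform continuity of the orbit provides a witness for the choice in
  \<open>ergodic_mean\<close>. The averages then arise by evaluating the defining convergence of the
  chosen integral along uniform divisions.\<close>

lemma ergodic_mean_approx:
  assumes t: "0 < t" and f: "f \<in> Lps M p"
  shows ergodic_mean_Lps: "A t f \<in> Lps M p"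
    and ergodic_mean_avg: "0 < e \<Longrightarrow> \<forall>\<^sub>F n in sequentially. Lpn M p (\<lambda>x. A t f x - avg (t / real n) n f x) \<le> ennreal e"
proof -
  define g where "g = (SOME g. Lp_has_integral M (ennreal p) (\<lambda>s. E s f) g 0 t)"
  have "\<exists>g. Lp_has_integral M (ennreal p) (\<lambda>s. E s f) g 0 t"
  proof (rule Lp_has_integral_exists[OF p_ge_1 t])
    show "E s f \<in> Lps M p" if "0 \<le> s" for s using that f by (rule E_Lps)
    fix e :: real assume "0 < e"
    then obtain d where "0 < d" "\<And>s t. 0 \<le> s \<Longrightarrow> 0 \<le> t \<Longrightarrow> \<bar>s - t\<bar> < d \<Longrightarrow> Lpn M p (\<lambda>x. E s f x - E t f x) \<le> ennreal e"
      by (rule E_uniformly_continuous[OF f]) blast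
    then show "\<exists>d>0. \<forall>s r. 0 \<le> s \<longrightarrow> s \<le> t \<longrightarrow> 0 \<le> r \<longrightarrow> r \<le> t \<longrightarrow> \<bar>s - r\<bar> < d \<longrightarrow>
        Lpn M p (\<lambda>x. E s f x - E r f x) \<le> ennreal e" by blast
  qed
  then have int: "Lp_has_integral M (ennreal p) (\<lambda>s. E s f) g 0 t"
    unfolding g_def by (rule someI_ex)
  then have g: "g \<in> Lps M p" by (simp add: Lp_has_integral_def)
  have A_eq: "A t f = (\<lambda>x. of_real (1 / t) *\<^sub>C g x)"
    unfolding ergodic_mean_def g_def scaleC_of_real ..
  show "A t f \<in> Lps M p"
    unfolding A_eq using g by (rule Lps_scaleC[OF p_ge_1])
  show "\<forall>\<^sub>F n in sequentially. Lpn M p (\<lambda>x. A t f x - avg (t / real n) n f x) \<le> ennreal e" if e: "0 < e"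
  proof -
    \<comment> \<open>The tolerance is \<open>t * e\<close>, since the mean divides the integral by
      \<open>t\<close>.\<close>
    obtain d where d: "0 < d" "\<And>D. D tagged_division_of {0..t} \<Longrightarrow> (\<lambda>s. ball s d) fine D \<Longrightarrow>
        Lpn M p (\<lambda>x. (\<Sum>(s, K)\<in>D. measure lborel K *\<^sub>R E s f x) - g x) < ennreal (t * e)"
    proof -
      have "0 < ennreal (t * e)" using e t by simp
      with int show ?thesis using that unfolding Lp_has_integral_def by blast
    qed
    obtain N :: nat where N: "t / d < real N" using reals_Archimedean2 by blast
    show ?thesis
    proof (rule eventually_sequentiallyI)
      fix n assume n: "N \<le> n"
      have "0 < t / d" using t d by simp
      then have "0 < n" "t / d < real n" using N n by linarith+
      define rs where "rs x = (\<Sum>j<n. (t / real n) *\<^sub>R E (real j * (t / real n)) f x)" for x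
      have rs_le: "Lpn M p (\<lambda>x. rs x - g x) \<le> ennreal (t * e)"
        using d(2)[OF uniform_division_tagged uniform_division_fine] t \<open>0 < n\<close> \<open>t / d < real n\<close> d(1)
        by (simp add: uniform_division_sum rs_def less_imp_le)
      have rs_Lps: "rs \<in> Lps M p"
        unfolding rs_def[abs_def] scaleC_of_real[symmetric] using f t by (intro Lps_sum Lps_scaleC E_Lps p_ge_1) auto
      have "avg (t / real n) n f x = of_real (1 / t) *\<^sub>C rs x" for x
        using t \<open>0 < n\<close> by (simp add: avg_def rs_def scaleC_complex_eq scaleR_conv_of_real sum_distrib_left)
      then have "Lpn M p (\<lambda>x. A t f x - avg (t / real n) n f x) = Lpn M p (\<lambda>x. of_real (1 / t) *\<^sub>C (g x - rs x))"
        by (simp add: A_eq scaleC_diff_right)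
      also have "\<dots> = ennreal (1 / t) * Lpn M p (\<lambda>x. rs x - g x)"
        using g rs_Lps t by (subst Lpn_scaleC[OF p_ge_1])
          (auto simp: norm_divide Lpn_minus_commute[OF p_ge_1, of M g] intro!: strongly_measurable_diff intro: LpsD)
      also have "\<dots> \<le> ennreal (1 / t) * ennreal (t * e)"
        using rs_le by (rule mult_left_mono) simp
      also have "\<dots> = ennreal e" using t e by (simp flip: ennreal_mult)
      finally show "Lpn M p (\<lambda>x. A t f x - avg (t / real n) n f x) \<le> ennreal e" .
    qed
  qed
qed

lemma avg_Lps: "0 \<le> h \<Longrightarrow> f \<in> Lps M p \<Longrightarrow> avg h n f \<in> Lps M p"
  unfolding avg_def[abs_def] scaleC_complex_eq[symmetric]
  by (intro Lps_scaleC Lps_sum E_Lps p_ge_1) auto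

lemma E_measurable: "0 \<le> t \<Longrightarrow> f \<in> Lps M p \<Longrightarrow> strongly_measurable M (E t f)"
  using E_Lps LpsD(1) by blast

lemma avg_diff_le:
  assumes h: "0 \<le> h" and n: "0 < n" and fg: "f \<in> Lps M p" "g \<in> Lps M p"
  shows "Lpn M p (\<lambda>x. avg h n f x - avg h n g x) \<le> Lpn M p (\<lambda>x. f x - g x)"
proof -
  have m: "strongly_measurable M (\<lambda>x. E (real j * h) f x - E (real j * h) g x)" for j
    using h fg by (intro strongly_measurable_diff E_measurable) auto
  have "(\<lambda>x. avg h n f x - avg h n g x)
      = (\<lambda>x. complex_of_real (1 / real n) *\<^sub>C (\<Sum>j<n. E (real j * h) f x - E (real j * h) g x))"
    by (simp add: avg_def scaleC_complex_eq sum_subtractf diff_divide_distrib)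
  then have "Lpn M p (\<lambda>x. avg h n f x - avg h n g x)
      = ennreal (1 / real n) * Lpn M p (\<lambda>x. \<Sum>j<n. E (real j * h) f x - E (real j * h) g x)"
    using m by (simp add: Lpn_scaleC[OF p_ge_1] strongly_measurable_sum norm_divide)
  also have "\<dots> \<le> ennreal (1 / real n) * (\<Sum>j<n. Lpn M p (\<lambda>x. E (real j * h) f x - E (real j * h) g x))"
    using m by (intro mult_left_mono Lpn_sum_le p_ge_1) auto
  also have "\<dots> \<le> ennreal (1 / real n) * (\<Sum>j<n. Lpn M p (\<lambda>x. f x - g x))"
    using h fg by (intro mult_left_mono sum_mono E_diff_le) auto
  also have "\<dots> = Lpn M p (\<lambda>x. f x - g x)"
    using n by (simp add: mult.assoc[symmetric] ennreal_of_nat_eq_real_of_nat flip: ennreal_mult)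
  finally show ?thesis .
qed

definition C :: real
  where "C = 2 * (p / (p - 1)) powr (1 / p)"

lemma C_nonneg: "0 \<le> C"
  by (simp add: C_def)

text \<open>By the semigroup law the iterates of \<open>T h\<close> are the operators
  \<open>T (real j * h)\<close>, so \<open>avg h n\<close> is the \<open>n\<close>-th orbit sum of
  \<open>T h\<close> divided by \<open>n\<close>, and the maximal inequality for one operator
  applies.\<close>

lemma avg_maximal_bdd_integrable:
  assumes h: "0 \<le> h" and f: "\<And>k. f k \<in> bdd_integrable M"
  shows "Lp_norm M (ennreal p) (\<lambda>x. SUP n\<in>{1..N}. ennreal (norm (tensor m u (\<lambda>k. avg h n (f k)) x)))
    \<le> ennreal C * Lpn M p (tensor m u f)"
proof -
  interpret dunford_schwartz M "T h" using h by (rule ds)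
  have orbit: "AE x in M. orbit_sum g n x = (\<Sum>j<n. T (real j * h) g x)" if g: "g \<in> bdd_integrable M" for g n
  proof (induction n)
    case (Suc n)
    have T_in': "T (real j * h) g \<in> bdd_integrable M" for j using h g by (intro T_in) auto
    have "AE x in M. T h (orbit_sum g n) x = T h (\<lambda>x. \<Sum>j<n. T (real j * h) g x) x"
      using Suc g T_in' by (intro S_cong orbit_sum_in bdd_integrable_sum)
    moreover have "AE x in M. T h (\<lambda>x. \<Sum>j<n. T (real j * h) g x) x = (\<Sum>j<n. T h (T (real j * h) g) x)"
      using T_in' by (intro S_sum) auto
    moreover have "AE x in M. \<forall>j\<in>{..<n}. T (h + real j * h) g x = T h (T (real j * h) g) x"
      using h g by (subst AE_finite_all) (auto intro!: T_add)
    moreover note T_0[OF g]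
    ultimately show ?case
    proof eventually_elim
      case (elim x)
      then show ?case by (simp add: sum.lessThan_Suc_shift algebra_simps del: sum.lessThan_Suc)
    qed
  qed simp
  have eq: "AE x in M. avg h n (f k) x = of_real (1 / real n) * orbit_sum (f k) n x" for n k
  proof -
    have "AE x in M. \<forall>j\<in>{..<n}. E (real j * h) (f k) x = T (real j * h) (f k) x"
      using h f by (subst AE_finite_all) (auto intro!: E_eq)
    with orbit[OF f, of k n] show ?thesis by eventually_elim (simp add: avg_def)
  qed
  have "AE x in M. tensor m u (\<lambda>k. avg h n (f k)) x = of_real (1 / real n) *\<^sub>C tensor m u (\<lambda>k. orbit_sum (f k) n) x" for n
    using tensor_cong_AE[where f="\<lambda>k. avg h n (f k)" and g="\<lambda>k x. of_real (1 / real n) * orbit_sum (f k) n x", OF eq]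
    unfolding tensor_mult .
  then have "AE x in M. \<forall>n. tensor m u (\<lambda>k. avg h n (f k)) x = of_real (1 / real n) *\<^sub>C tensor m u (\<lambda>k. orbit_sum (f k) n) x"
    unfolding AE_all_countable by (rule allI)
  then have "AE x in M. (SUP n\<in>{1..N}. ennreal (norm (tensor m u (\<lambda>k. avg h n (f k)) x)))
      = (SUP n\<in>{1..N}. ennreal (norm (tensor m u (\<lambda>k. orbit_sum (f k) n) x) / real n))"
    by eventually_elim (simp add: norm_scaleC norm_divide)
  then have "Lp_norm M (ennreal p) (\<lambda>x. SUP n\<in>{1..N}. ennreal (norm (tensor m u (\<lambda>k. avg h n (f k)) x)))
      = Lp_norm M (ennreal p) (\<lambda>x. SUP n\<in>{1..N}. ennreal (norm (tensor m u (\<lambda>k. orbit_sum (f k) n) x) / real n))"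
    by (rule Lp_norm_cong_AE[OF p_gt_0])
  also have "\<dots> \<le> ennreal C * Lpn M p (tensor m u f)"
    unfolding C_def using sigma_finite_measure_axioms f p_gt_1 by (rule maximal_strong_type)
  finally show ?thesis .
qed

text \<open>The components are approximated by bounded integrable functions. For
  \<open>n > 0\<close> the map \<open>avg h n\<close> does not increase distances in L^p, and
  \<open>N\<close> is fixed, so the \<open>N\<close> errors are small together.\<close>

lemma avg_maximal:
  assumes h: "0 \<le> h" and f: "\<And>k. f k \<in> Lps M p"
  shows "Lp_norm M (ennreal p) (\<lambda>x. SUP n\<in>{1..N}. ennreal (norm (tensor m u (\<lambda>k. avg h n (f k)) x)))
    \<le> ennreal C * Lpn M p (tensor m u f)"
proof (rule ennreal_le_epsilon)
  fix e :: real assume e: "0 < e"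
  define U where "U = (\<Sum>k<m. norm (u k))"
  have U: "0 \<le> U" by (simp add: U_def sum_nonneg)
  \<comment> \<open>\<open>U * d\<close> bounds the error of one tensor; it enters with the factor
    \<open>C\<close> through the norm on the right and \<open>N\<close> times through the
    averages.\<close>
  define d where "d = e / ((C + real N) * U + 1)"
  have "0 < (C + real N) * U + 1" using U C_nonneg by (simp add: add_nonneg_pos)
  then have "0 < d" "d * ((C + real N) * U + 1) = e" using e by (simp_all add: d_def)
  then have d: "0 < d" "C * (U * d) + real N * (U * d) \<le> e" by (simp_all add: algebra_simps)
  have "\<exists>g. g \<in> bdd_integrable M \<and> Lpn M p (\<lambda>x. g x - f k x) \<le> ennreal d" for k
    using bdd_integrable_dense[OF f d(1) p_ge_1] by blast
  then obtain g where g: "\<And>k. g k \<in> bdd_integrable M" and gf: "\<And>k. Lpn M p (\<lambda>x. g k x - f k x) \<le> ennreal d"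
    by metis
  note gL = bdd_integrable_Lps[OF g p_ge_1]
  note fg = gf[unfolded Lpn_minus_commute[OF p_ge_1, of M "g _"]]
  have m: "strongly_measurable M (avg h n (f k))" "strongly_measurable M (avg h n (g k))" for n k
    using h f gL by (auto intro: LpsD avg_Lps)
  have tm: "strongly_measurable M (tensor m u (\<lambda>k. avg h n (f k)))" "strongly_measurable M (tensor m u (\<lambda>k. avg h n (g k)))" for n
    using m by (auto intro!: tensor_strongly_measurable simp flip: strongly_measurable_complex_iff)
  have "Lp_norm M (ennreal p) (\<lambda>x. SUP n\<in>{1..N}. ennreal (norm (tensor m u (\<lambda>k. avg h n (f k)) x)))
    \<le> Lp_norm M (ennreal p) (\<lambda>x. SUP n\<in>{1..N}. ennreal (norm (tensor m u (\<lambda>k. avg h n (g k)) x)))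
      + (\<Sum>n\<in>{1..N}. Lpn M p (\<lambda>x. tensor m u (\<lambda>k. avg h n (f k)) x - tensor m u (\<lambda>k. avg h n (g k)) x))"
    using tm by (intro Lp_norm_SUP_perturb p_ge_1) auto
  also have "\<dots> \<le> ennreal C * Lpn M p (tensor m u g) + (\<Sum>n\<in>{1..N}. ennreal (U * d))"
    unfolding U_def using h g m d f gL fg
    by (intro add_mono avg_maximal_bdd_integrable sum_mono Lpn_tensor_diff_le p_ge_1 order_trans[OF avg_diff_le]) auto
  also have "Lpn M p (tensor m u g) \<le> Lpn M p (tensor m u f) + ennreal (U * d)"
  proof -
    have "Lpn M p (tensor m u g) \<le> Lpn M p (tensor m u f) + Lpn M p (\<lambda>x. tensor m u g x - tensor m u f x)"
      using gL f by (intro Lpn_le_add_diff p_ge_1) (auto intro: LpsD tensor_Lps p_ge_1)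
    also have "\<dots> \<le> Lpn M p (tensor m u f) + ennreal (U * d)"
      unfolding U_def using gL f gf d by (intro add_left_mono Lpn_tensor_diff_le p_ge_1) (auto intro: LpsD)
    finally show ?thesis .
  qed
  finally have "Lp_norm M (ennreal p) (\<lambda>x. SUP n\<in>{1..N}. ennreal (norm (tensor m u (\<lambda>k. avg h n (f k)) x)))
    \<le> ennreal C * (Lpn M p (tensor m u f) + ennreal (U * d)) + (\<Sum>n\<in>{1..N}. ennreal (U * d))"
    by (simp add: mult_left_mono add_mono)
  also have "\<dots> = ennreal C * Lpn M p (tensor m u f) + ennreal (C * (U * d) + real N * (U * d))"
    using C_nonneg U d(1) by (simp add: distrib_left ennreal_mult add.assoc ennreal_of_nat_eq_real_of_nat)
  also have "\<dots> \<le> ennreal C * Lpn M p (tensor m u f) + ennreal e"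
    using d by (intro add_left_mono ennreal_leI)
  finally show "Lp_norm M (ennreal p) (\<lambda>x. SUP n\<in>{1..N}. ennreal (norm (tensor m u (\<lambda>k. avg h n (f k)) x)))
    \<le> ennreal C * Lpn M p (tensor m u f) + ennreal e" .
qed

text \<open>For positive \<open>L\<close>, steps of length \<open>1 / (real B * real L)\<close>
  reach each \<open>t\<close> in \<open>Q\<close> after exactly \<open>c t * L\<close> steps; this
  is what lets a single operator serve all times of a finite set.\<close>

lemma common_denominator:
  fixes Q :: "real set"
  assumes "finite Q" "Q \<subseteq> {t\<in>\<rat>. 0 < t}"
  shows "\<exists>B c. 0 < (B::nat) \<and> (\<forall>t\<in>Q. t * real B = real (c t))"
  using assms
proof (induction Q)
  case (insert t Q)
  then obtain B c where Bc: "0 < B" "\<And>s. s \<in> Q \<Longrightarrow> s * real B = real (c s)" by auto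
  obtain a b :: nat where ab: "b \<noteq> 0" "\<bar>t\<bar> = real a / real b"
    by (rule Rats_abs_nat_div_natE[of t]) (use insert.prems in auto)
  then have t: "t = real a / real b" using insert.prems by simp
  have "s * real (B * b) = real ((if s = t then a * B else c s * b))" if "s \<in> insert t Q" for s
    using that Bc(2)[of s] t ab by auto
  then show ?case using Bc ab by (intro exI[of _ "B * b"] exI[of _ "\<lambda>s. if s = t then a * B else c s * b"]) auto
qed auto

text \<open>The number of steps \<open>c t * L\<close> varies with \<open>t\<close>, but the step
  length \<open>h\<close> does not. A large \<open>L\<close> brings all these averages close to the
  ergodic means, while the maximal inequality for averages has the same constant for every
  \<open>h\<close> and \<open>N\<close>.\<close>

lemma ergodic_mean_maximal:
  assumes Q: "finite Q" "Q \<subseteq> {t\<in>\<rat>. 0 < t}" and f: "\<And>k. f k \<in> Lps M p"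
  shows "Lp_norm M (ennreal p) (\<lambda>x. SUP t\<in>Q. ennreal (norm (tensor m u (\<lambda>k. A t (f k)) x)))
    \<le> ennreal C * Lpn M p (tensor m u f)"
proof (rule ennreal_le_epsilon)
  fix e :: real assume e: "0 < e"
  define U where "U = (\<Sum>k<m. norm (u k))"
  have U: "0 \<le> U" by (simp add: U_def sum_nonneg)
  define d where "d = e / (real (card Q) * U + 1)"
  have "0 < real (card Q) * U + 1" using U by (simp add: add_nonneg_pos)
  then have "0 < d" "d * (real (card Q) * U + 1) = e" using e by (simp_all add: d_def)
  then have d: "0 < d" "real (card Q) * (U * d) \<le> e" by (simp_all add: algebra_simps)
  obtain B c where B: "0 < (B::nat)" and c: "\<And>t. t \<in> Q \<Longrightarrow> t * real B = real (c t)"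
    using common_denominator[OF Q] by blast
  have pos: "0 < t" if "t \<in> Q" for t using that Q by auto
  have c_pos: "0 < c t" if "t \<in> Q" for t
    using c[OF that] pos[OF that] B by (metis mult_pos_pos of_nat_0_less_iff)
  have "\<forall>\<^sub>F n in sequentially. \<forall>t\<in>Q. \<forall>k\<in>{..<m}. Lpn M p (\<lambda>x. A t (f k) x - avg (t / real n) n (f k) x) \<le> ennreal d"
    using Q pos f d by (intro eventually_ball_finite ballI ergodic_mean_avg) auto
  then obtain L0 where L0: "\<And>n t k. L0 \<le> n \<Longrightarrow> t \<in> Q \<Longrightarrow> k < m \<Longrightarrow>
      Lpn M p (\<lambda>x. A t (f k) x - avg (t / real n) n (f k) x) \<le> ennreal d"
    unfolding eventually_sequentially by auto
  \<comment> \<open>As \<open>c t\<close> is at least 1, \<open>L > L0\<close> pushes every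
    \<open>c t * L\<close> beyond \<open>L0\<close>.\<close>
  define L where "L = Suc L0"
  define h where "h = 1 / (real B * real L)"
  have h: "0 \<le> h" by (simp add: h_def)
  have approx: "Lpn M p (\<lambda>x. A t (f k) x - avg h (c t * L) (f k) x) \<le> ennreal d" if "t \<in> Q" "k < m" for t k
  proof -
    have "L \<le> c t * L" using c_pos[OF that(1)] by simp
    then have "L0 \<le> c t * L" by (simp add: L_def)
    moreover have "t / real (c t * L) = h"
      using c[OF that(1), symmetric] pos[OF that(1)] by (simp add: h_def)
    ultimately show ?thesis using L0[OF _ that, of "c t * L"] by simp
  qed
  \<comment> \<open>The inserted 0 covers an empty \<open>Q\<close>.\<close>
  define N where "N = Max (insert 0 ((\<lambda>t. c t * L) ` Q))"
  have N: "c t * L \<in> {1..N}" if "t \<in> Q" for t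
    using that Q c_pos[OF that] by (auto simp: N_def L_def intro!: Max_ge)
  have m: "strongly_measurable M (avg h n (f k))" "t \<in> Q \<Longrightarrow> strongly_measurable M (A t (f k))" for n k t
    using h f pos by (auto intro: LpsD avg_Lps ergodic_mean_Lps)
  have tm: "strongly_measurable M (tensor m u (\<lambda>k. avg h n (f k)))" "t \<in> Q \<Longrightarrow> strongly_measurable M (tensor m u (\<lambda>k. A t (f k)))" for n t
    using m by (auto intro!: tensor_strongly_measurable simp flip: strongly_measurable_complex_iff)
  have "Lp_norm M (ennreal p) (\<lambda>x. SUP t\<in>Q. ennreal (norm (tensor m u (\<lambda>k. A t (f k)) x)))
    \<le> Lp_norm M (ennreal p) (\<lambda>x. SUP t\<in>Q. ennreal (norm (tensor m u (\<lambda>k. avg h (c t * L) (f k)) x)))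
      + (\<Sum>t\<in>Q. Lpn M p (\<lambda>x. tensor m u (\<lambda>k. A t (f k)) x - tensor m u (\<lambda>k. avg h (c t * L) (f k)) x))"
    using tm Q by (intro Lp_norm_SUP_perturb p_ge_1) auto
  also have "\<dots> \<le> ennreal C * Lpn M p (tensor m u f) + (\<Sum>t\<in>Q. ennreal (U * d))"
  proof (rule add_mono)
    have "Lp_norm M (ennreal p) (\<lambda>x. SUP t\<in>Q. ennreal (norm (tensor m u (\<lambda>k. avg h (c t * L) (f k)) x)))
        \<le> Lp_norm M (ennreal p) (\<lambda>x. SUP n\<in>{1..N}. ennreal (norm (tensor m u (\<lambda>k. avg h n (f k)) x)))"
    proof (intro Lp_norm_mono_AE p_gt_0 AE_I2 SUP_least)
      fix x t assume "t \<in> Q"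
      from N[OF this] show "ennreal (norm (tensor m u (\<lambda>k. avg h (c t * L) (f k)) x))
          \<le> (SUP n\<in>{1..N}. ennreal (norm (tensor m u (\<lambda>k. avg h n (f k)) x)))"
        by (rule SUP_upper)
    qed
    also have "\<dots> \<le> ennreal C * Lpn M p (tensor m u f)"
      using h f by (rule avg_maximal)
    finally show "Lp_norm M (ennreal p) (\<lambda>x. SUP t\<in>Q. ennreal (norm (tensor m u (\<lambda>k. avg h (c t * L) (f k)) x)))
      \<le> ennreal C * Lpn M p (tensor m u f)" .
    show "(\<Sum>t\<in>Q. Lpn M p (\<lambda>x. tensor m u (\<lambda>k. A t (f k)) x - tensor m u (\<lambda>k. avg h (c t * L) (f k)) x)) \<le> (\<Sum>t\<in>Q. ennreal (U * d))"
      unfolding U_def using m approx d by (intro sum_mono Lpn_tensor_diff_le p_ge_1) auto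
  qed
  also have "\<dots> = ennreal C * Lpn M p (tensor m u f) + ennreal (real (card Q) * (U * d))"
    using U d by (simp add: ennreal_mult ennreal_of_nat_eq_real_of_nat)
  also have "\<dots> \<le> ennreal C * Lpn M p (tensor m u f) + ennreal e"
    using d by (intro add_left_mono ennreal_leI)
  finally show "Lp_norm M (ennreal p) (\<lambda>x. SUP t\<in>Q. ennreal (norm (tensor m u (\<lambda>k. A t (f k)) x)))
    \<le> ennreal C * Lpn M p (tensor m u f) + ennreal e" .
qed

abbreviation tensor_A :: "real \<Rightarrow> ('a \<Rightarrow> 'b::complex_banach) \<Rightarrow> 'a \<Rightarrow> 'b"
  where "tensor_A t \<equiv> tensor_extension M (ennreal p) (A t)"

text \<open>\<open>R\<close> admits every representation of a tensor. The maximal inequality for the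
  single time \<open>t\<close> bounds the image by the Bochner norm of the tensor, whatever the
  representation, which is exactly the hypothesis for extending \<open>R\<close> by
  continuity.\<close>

lemma tensor_extension_props:
  assumes t: "t \<in> \<rat>" "0 < t"
  shows "bounded_operator M (ennreal p) (tensor_A t :: ('a \<Rightarrow> 'b::complex_banach) \<Rightarrow> _) \<and>
    (\<forall>(n::nat) (u :: nat \<Rightarrow> 'b) f. (\<forall>k<n. f k \<in> Lps M p) \<longrightarrow>
      (AE x in M. tensor_A t (\<lambda>y. \<Sum>k<n. f k y *\<^sub>C u k) x = (\<Sum>k<n. A t (f k) x *\<^sub>C u k)))"
proof -
  define R where "R F G \<longleftrightarrow> (\<exists>m (u :: nat \<Rightarrow> 'b) f. (\<forall>k. f k \<in> Lps M p) \<and> F = tensor m u f \<and>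
    G = tensor m u (\<lambda>k. A t (f k)))" for F G
  have "\<exists>S. bounded_operator M (ennreal p) S \<and>
    (\<forall>F\<in>Lps M p. Lpn M p (S F) \<le> ennreal C * Lpn M p F) \<and> (\<forall>F G. R F G \<longrightarrow> (AE x in M. S F x = G x))"
  proof (rule bounded_operator_extension[OF p_ge_1 _ _ _ _ _ C_nonneg])
    fix F G :: "'a \<Rightarrow> 'b" assume R: "R F G"
    then obtain m u f where f: "\<And>k. f k \<in> Lps M p" and FG: "F = tensor m u f" "G = tensor m u (\<lambda>k. A t (f k))"
      by (auto simp: R_def)
    show "F \<in> Lps M p \<and> G \<in> Lps M p"
      unfolding FG using f t by (auto intro!: tensor_Lps p_ge_1 ergodic_mean_Lps)
    show "Lpn M p G \<le> ennreal C * Lpn M p F"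
      using ergodic_mean_maximal[of "{t}" f m u] f t by (simp add: FG Bochner_norm_def)
    show "R (\<lambda>x. c *\<^sub>C F x) (\<lambda>x. c *\<^sub>C G x)" for c
    proof -
      have "(\<lambda>x. c *\<^sub>C tensor m u g x) = tensor m (\<lambda>k. c *\<^sub>C u k) g" for g :: "nat \<Rightarrow> 'a \<Rightarrow> complex"
        by (simp add: fun_eq_iff tensor_def scaleC_sum_right scaleC_scaleC mult.commute)
      then show ?thesis unfolding R_def FG using f by blast
    qed
    fix F' G' :: "'a \<Rightarrow> 'b" assume R': "R F' G'"
    then obtain m' u' f' where f': "\<And>k. f' k \<in> Lps M p" and FG': "F' = tensor m' u' f'" "G' = tensor m' u' (\<lambda>k. A t (f' k))"
      by (auto simp: R_def)
    show "R (\<lambda>x. F x + F' x) (\<lambda>x. G x + G' x)"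
      unfolding R_def
    proof (intro exI conjI)
      show "\<forall>k. (\<lambda>k. if k < m then f k else f' (k - m)) k \<in> Lps M p" using f f' by auto
      show "(\<lambda>x. F x + F' x) = tensor (m + m') (\<lambda>k. if k < m then u k else u' (k - m)) (\<lambda>k. if k < m then f k else f' (k - m))"
        by (simp add: FG FG' tensor_append fun_eq_iff)
      have "(\<lambda>k. A t (if k < m then f k else f' (k - m))) = (\<lambda>k. if k < m then A t (f k) else A t (f' (k - m)))"
        by auto
      then have eq: "(\<lambda>k. A t ((\<lambda>k. if k < m then f k else f' (k - m)) k)) = (\<lambda>k. if k < m then A t (f k) else A t (f' (k - m)))"
        by simp
      show "(\<lambda>x. G x + G' x) = tensor (m + m') (\<lambda>k. if k < m then u k else u' (k - m))
          (\<lambda>k. A t ((\<lambda>k. if k < m then f k else f' (k - m)) k))"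
        unfolding eq FG FG' by (rule ext) (rule tensor_append[symmetric])
    qed
  next
    fix F :: "'a \<Rightarrow> 'b" and e :: real assume F: "F \<in> Lps M p" "0 < e"
    obtain m u f where f: "\<And>k :: nat. f k \<in> bdd_integrable M" and le: "Lpn M p (\<lambda>x. tensor m u f x - F x) \<le> ennreal e"
      by (rule tensor_dense[OF F p_ge_1]) blast
    have "R (tensor m u f) (tensor m u (\<lambda>k. A t (f k)))"
      unfolding R_def using bdd_integrable_Lps[OF f p_ge_1] by blast
    then show "\<exists>H K. R H K \<and> Lpn M p (\<lambda>x. H x - F x) \<le> ennreal e" using le by blast
  qed
  then obtain S where S: "bounded_operator M (ennreal p) S" and SR: "\<And>F G. R F G \<Longrightarrow> AE x in M. S F x = G x" by blast
  have "AE x in M. S (\<lambda>y. \<Sum>k<n. f k y *\<^sub>C u k) x = (\<Sum>k<n. A t (f k) x *\<^sub>C u k)"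
    if f: "\<forall>k<n. f k \<in> Lps M p" for n u and f :: "nat \<Rightarrow> 'a \<Rightarrow> complex"
  proof -
    \<comment> \<open>\<open>R\<close> requires every component to lie in L^p, while this is assumed
      below \<open>n\<close> only; the others are set to 0.\<close>
    define f' where "f' k = (if k < n then f k else (\<lambda>_. 0))" for k
    have "f' k \<in> Lps M p" for k using f Lps_zero[OF p_ge_1] by (auto simp: f'_def)
    then have "R (tensor n u f') (tensor n u (\<lambda>k. A t (f' k)))" unfolding R_def by blast
    then have "AE x in M. S (tensor n u f') x = tensor n u (\<lambda>k. A t (f' k)) x" by (rule SR)
    moreover have "tensor n u f' = (\<lambda>y. \<Sum>k<n. f k y *\<^sub>C u k)"
      by (auto simp: tensor_def f'_def intro!: sum.cong)
    moreover have "tensor n u (\<lambda>k. A t (f' k)) x = (\<Sum>k<n. A t (f k) x *\<^sub>C u k)" for x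
      by (auto simp: tensor_def f'_def intro!: sum.cong)
    ultimately show ?thesis by simp
  qed
  with S have "\<exists>S. bounded_operator M (ennreal p) S \<and>
    (\<forall>(n::nat) (u :: nat \<Rightarrow> 'b) f. (\<forall>k<n. f k \<in> Lps M p) \<longrightarrow>
      (AE x in M. S (\<lambda>y. \<Sum>k<n. f k y *\<^sub>C u k) x = (\<Sum>k<n. A t (f k) x *\<^sub>C u k)))" by blast
  then show ?thesis unfolding tensor_extension_def by (rule someI_ex)
qed

lemma tensor_A_Lps: "t \<in> \<rat> \<Longrightarrow> 0 < t \<Longrightarrow> F \<in> Lps M p \<Longrightarrow> tensor_A t F \<in> Lps M p"
  using tensor_extension_props[of t] by (auto simp: bounded_operator_def)

text \<open>The chosen extension comes with an unspecified constant, which is good enough for an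
  error term. The witness is \<open>max 0 K\<close>, as \<open>bounded_operator\<close> also admits
  negative reals as constants.\<close>

lemma tensor_A_diff_bound:
  assumes t: "t \<in> \<rat>" "0 < t"
  shows "\<exists>K\<ge>0. \<forall>F\<in>Lps M p. \<forall>G\<in>Lps M p.
    Lpn M p (\<lambda>x. tensor_A t F x - tensor_A t (G :: 'a \<Rightarrow> 'b::complex_banach) x) \<le> ennreal K * Lpn M p (\<lambda>x. F x - G x)"
proof -
  have bo: "bounded_operator M (ennreal p) (tensor_A t :: ('a \<Rightarrow> 'b) \<Rightarrow> _)"
    using tensor_extension_props[OF t] by blast
  then have "\<exists>K::real. \<forall>F\<in>Lps M p. Lpn M p (tensor_A t F :: 'a \<Rightarrow> 'b) \<le> ennreal K * Lpn M p F"
    unfolding bounded_operator_def by (elim conjE)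
  then obtain K where K: "\<And>F :: 'a \<Rightarrow> 'b. F \<in> Lps M p \<Longrightarrow> Lpn M p (tensor_A t F) \<le> ennreal K * Lpn M p F"
    by blast
  have "Lpn M p (\<lambda>x. tensor_A t F x - tensor_A t G x) \<le> ennreal (max 0 K) * Lpn M p (\<lambda>x. F x - G x)"
    if FG: "F \<in> Lps M p" "G \<in> Lps M p" for F G :: "'a \<Rightarrow> 'b"
  proof -
    have "(\<lambda>y. (- 1) *\<^sub>C G y) \<in> Lps M p" using FG(2) by (rule Lps_scaleC[OF p_ge_1])
    then have "AE x in M. tensor_A t (\<lambda>y. F y + (- 1) *\<^sub>C G y) x = tensor_A t F x + tensor_A t (\<lambda>y. (- 1) *\<^sub>C G y) x"
      using bo FG by (auto simp: bounded_operator_def)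
    moreover have "AE x in M. tensor_A t (\<lambda>y. (- 1) *\<^sub>C G y) x = (- 1) *\<^sub>C tensor_A t G x"
      using bo FG unfolding bounded_operator_def by blast
    ultimately have "AE x in M. tensor_A t F x - tensor_A t G x = tensor_A t (\<lambda>y. F y - G y) x"
      by eventually_elim (simp add: scaleC_minus1)
    then have "Lpn M p (\<lambda>x. tensor_A t F x - tensor_A t G x) = Lpn M p (tensor_A t (\<lambda>y. F y - G y))"
      by (rule Lpn_cong_AE[OF p_ge_1])
    also have "\<dots> \<le> ennreal K * Lpn M p (\<lambda>x. F x - G x)"
      using FG by (intro K Lps_diff p_ge_1)
    also have "\<dots> \<le> ennreal (max 0 K) * Lpn M p (\<lambda>x. F x - G x)"
      by (intro mult_right_mono ennreal_leI) auto
    finally show ?thesis .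
  qed
  then show ?thesis by (intro exI[of _ "max 0 K"]) simp
qed

text \<open>The constants \<open>K t\<close> may vary with \<open>t\<close>, but \<open>Q\<close> is
  finite and the approximating tensor is chosen after them, so their sum times \<open>d\<close> is
  small. The constant \<open>C\<close> comes from the inequality for tensors.\<close>

lemma tensor_A_maximal:
  fixes F :: "'a \<Rightarrow> 'b::complex_banach"
  assumes Q: "finite Q" "Q \<subseteq> {t\<in>\<rat>. 0 < t}" and F: "F \<in> Lps M p"
  shows "Lp_norm M (ennreal p) (\<lambda>x. SUP t\<in>Q. ennreal (norm (tensor_A t F x))) \<le> ennreal C * Lpn M p F"
proof (rule ennreal_le_epsilon)
  fix e :: real assume e: "0 < e"
  have "\<forall>t\<in>Q. \<exists>K\<ge>0. \<forall>F\<in>Lps M p. \<forall>G\<in>Lps M p.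
    Lpn M p (\<lambda>x. tensor_A t F x - tensor_A t (G :: 'a \<Rightarrow> 'b) x) \<le> ennreal K * Lpn M p (\<lambda>x. F x - G x)"
    using Q by (intro ballI tensor_A_diff_bound) auto
  from bchoice[OF this] obtain K where "\<forall>t\<in>Q. 0 \<le> K t \<and> (\<forall>F\<in>Lps M p. \<forall>G\<in>Lps M p.
    Lpn M p (\<lambda>x. tensor_A t F x - tensor_A t (G :: 'a \<Rightarrow> 'b) x) \<le> ennreal (K t) * Lpn M p (\<lambda>x. F x - G x))" ..
  then have K: "\<And>t. t \<in> Q \<Longrightarrow> 0 \<le> K t" "\<And>t F G. t \<in> Q \<Longrightarrow> F \<in> Lps M p \<Longrightarrow> G \<in> Lps M p \<Longrightarrow>
    Lpn M p (\<lambda>x. tensor_A t F x - tensor_A t (G :: 'a \<Rightarrow> 'b) x) \<le> ennreal (K t) * Lpn M p (\<lambda>x. F x - G x)"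
    by blast+
  define d where "d = e / (C + (\<Sum>t\<in>Q. K t) + 1)"
  have "0 < C + (\<Sum>t\<in>Q. K t) + 1" using C_nonneg K by (simp add: add_nonneg_pos sum_nonneg)
  then have "0 < d" "d * (C + (\<Sum>t\<in>Q. K t) + 1) = e" using e by (simp_all add: d_def)
  then have d: "0 < d" "C * d + (\<Sum>t\<in>Q. K t) * d \<le> e" by (simp_all add: algebra_simps)
  obtain m u f where f: "\<And>k :: nat. f k \<in> bdd_integrable M" and le: "Lpn M p (\<lambda>x. tensor m u f x - F x) \<le> ennreal d"
    by (rule tensor_dense[OF F d(1) p_ge_1]) blast
  note fL = bdd_integrable_Lps[OF f p_ge_1]
  have H: "tensor m u f \<in> Lps M p" using fL by (intro tensor_Lps p_ge_1)
  have Q': "t \<in> \<rat>" "0 < t" if "t \<in> Q" for t using that Q by auto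
  have "AE x in M. tensor_A t (tensor m u f) x = tensor m u (\<lambda>k. A t (f k)) x" if "t \<in> Q" for t
    unfolding tensor_def[abs_def] using tensor_extension_props[OF Q'[OF that], where 'b='b] fL by blast
  then have "AE x in M. \<forall>t\<in>Q. tensor_A t (tensor m u f) x = tensor m u (\<lambda>k. A t (f k)) x"
    using Q by (subst AE_finite_all) auto
  then have "AE x in M. (SUP t\<in>Q. ennreal (norm (tensor_A t (tensor m u f) x))) = (SUP t\<in>Q. ennreal (norm (tensor m u (\<lambda>k. A t (f k)) x)))"
    by eventually_elim simp
  then have H_le: "Lp_norm M (ennreal p) (\<lambda>x. SUP t\<in>Q. ennreal (norm (tensor_A t (tensor m u f) x))) \<le> ennreal C * Lpn M p (tensor m u f)"
    using ergodic_mean_maximal[OF Q fL, of m u] by (subst Lp_norm_cong_AE[OF p_gt_0]) auto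
  have "Lp_norm M (ennreal p) (\<lambda>x. SUP t\<in>Q. ennreal (norm (tensor_A t F x)))
    \<le> Lp_norm M (ennreal p) (\<lambda>x. SUP t\<in>Q. ennreal (norm (tensor_A t (tensor m u f) x)))
      + (\<Sum>t\<in>Q. Lpn M p (\<lambda>x. tensor_A t F x - tensor_A t (tensor m u f) x))"
    using Q Q' F H by (intro Lp_norm_SUP_perturb p_ge_1) (auto intro: LpsD tensor_A_Lps)
  also have "\<dots> \<le> ennreal C * (Lpn M p F + ennreal d) + (\<Sum>t\<in>Q. ennreal (K t) * ennreal d)"
  proof (intro add_mono sum_mono)
    have "Lpn M p (tensor m u f) \<le> Lpn M p F + Lpn M p (\<lambda>x. tensor m u f x - F x)"
      using H F by (intro Lpn_le_add_diff p_ge_1) (auto intro: LpsD)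
    also have "\<dots> \<le> Lpn M p F + ennreal d" using le by (rule add_left_mono)
    finally show "Lp_norm M (ennreal p) (\<lambda>x. SUP t\<in>Q. ennreal (norm (tensor_A t (tensor m u f) x))) \<le> ennreal C * (Lpn M p F + ennreal d)"
      by (intro order_trans[OF H_le] mult_left_mono) auto
    show "Lpn M p (\<lambda>x. tensor_A t F x - tensor_A t (tensor m u f) x) \<le> ennreal (K t) * ennreal d" if "t \<in> Q" for t
      using K(2)[OF that F H] le by (auto simp: Lpn_minus_commute[OF p_ge_1, of M F] elim!: order_trans intro!: mult_left_mono)
  qed
  also have "(\<Sum>t\<in>Q. ennreal (K t) * ennreal d) = ennreal ((\<Sum>t\<in>Q. K t) * d)"
    using K d(1) by (simp add: sum_distrib_right flip: ennreal_mult sum_ennreal)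
  also have "ennreal C * (Lpn M p F + ennreal d) + ennreal ((\<Sum>t\<in>Q. K t) * d) = ennreal C * Lpn M p F + ennreal (C * d + (\<Sum>t\<in>Q. K t) * d)"
    using C_nonneg d(1) K by (simp add: distrib_left ennreal_mult add.assoc sum_nonneg)
  also have "\<dots> \<le> ennreal C * Lpn M p F + ennreal e"
    using d by (intro add_left_mono ennreal_leI)
  finally show "Lp_norm M (ennreal p) (\<lambda>x. SUP t\<in>Q. ennreal (norm (tensor_A t F x))) \<le> ennreal C * Lpn M p F + ennreal e" .
qed

text \<open>Along an enumeration of the positive rationals the maximal function is an increasing
  limit of suprema over finite sets, and the bound for those is independent of the set.\<close>

theorem maximal_ergodic_bound:
  fixes F :: "'a \<Rightarrow> 'b::complex_banach"
  assumes F: "F \<in> Lps M p"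
  shows "Lp_norm M (ennreal p) (maximal_ergodic M (ennreal p) T F) \<le> ennreal C * Lpn M p F"
proof -
  let ?P = "{t\<in>\<rat>. 0 < t} :: real set"
  have "countable ?P" by (rule countable_subset[OF _ countable_rat]) auto
  moreover have "?P \<noteq> {}" by (auto intro!: exI[of _ 1])
  ultimately obtain r :: "nat \<Rightarrow> real" where r: "range r = ?P"
    by (metis range_from_nat_into)
  have rP: "r ` {..i} \<subseteq> ?P" for i using r by auto
  have "maximal_ergodic M (ennreal p) T F = (\<lambda>x. SUP i. SUP t\<in>r ` {..i}. ennreal (norm (tensor_A t F x)))"
  proof
    fix x
    have "(SUP t\<in>range r. ennreal (norm (tensor_A t F x))) = (SUP i. SUP t\<in>r ` {..i}. ennreal (norm (tensor_A t F x)))"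
    proof (rule antisym)
      show "(SUP t\<in>range r. ennreal (norm (tensor_A t F x))) \<le> (SUP i. SUP t\<in>r ` {..i}. ennreal (norm (tensor_A t F x)))"
      proof (rule SUP_least)
        fix t assume "t \<in> range r"
        then obtain i where "t = r i" by auto
        then show "ennreal (norm (tensor_A t F x)) \<le> (SUP i. SUP t\<in>r ` {..i}. ennreal (norm (tensor_A t F x)))"
          by (intro SUP_upper2[of i] SUP_upper) auto
      qed
      show "(SUP i. SUP t\<in>r ` {..i}. ennreal (norm (tensor_A t F x))) \<le> (SUP t\<in>range r. ennreal (norm (tensor_A t F x)))"
        by (intro SUP_least SUP_upper) auto
    qed
    then show "maximal_ergodic M (ennreal p) T F x = (SUP i. SUP t\<in>r ` {..i}. ennreal (norm (tensor_A t F x)))"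
      by (simp add: maximal_ergodic_def r)
  qed
  moreover have "Lp_norm M (ennreal p) (\<lambda>x. SUP i. SUP t\<in>r ` {..i}. ennreal (norm (tensor_A t F x))) \<le> ennreal C * Lpn M p F"
  proof (rule Lp_norm_SUP_le[OF p_gt_0])
    fix i
    show "Lp_norm M (ennreal p) (\<lambda>x. SUP t\<in>r ` {..i}. ennreal (norm (tensor_A t F x))) \<le> ennreal C * Lpn M p F"
      using rP F by (intro tensor_A_maximal) auto
    show "(\<lambda>x. SUP t\<in>r ` {..i}. ennreal (norm (tensor_A t F x))) \<in> borel_measurable M"
    proof (intro borel_measurable_SUP Lpn_measurable)
      fix t assume "t \<in> r ` {..i}"
      then have "t \<in> ?P" using rP by blast
      then show "strongly_measurable M (tensor_A t F)" using F by (auto intro: LpsD tensor_A_Lps)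
    qed simp
  next
    show "incseq (\<lambda>i. SUP t\<in>r ` {..i}. ennreal (norm (tensor_A t F x)))" for x
      by (intro monoI SUP_subset_mono) auto
  qed
  ultimately show ?thesis by simp
qed

end

theorem corollary4p2:
  fixes M :: "'a measure"
    and T :: "real \<Rightarrow> ('a \<Rightarrow> complex) \<Rightarrow> ('a \<Rightarrow> complex)"
    and p :: real
    and F :: "'a \<Rightarrow> 'b::complex_banach"
  assumes "sigma_finite_measure M"
    and "semigroup_L2 M T"
    and "strongly_continuous_L2 M T"
    and "contraction_property M T"
    and "1 < p"
    and "F \<in> Lspace M (ennreal p)"
  shows "Lp_norm M (ennreal p) (maximal_ergodic M (ennreal p) T F)
    \<le> ennreal (2 * (p / (p - 1)) powr (1 / p)) * Bochner_norm M (ennreal p) F"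
proof -
  interpret contraction_semigroup M T p
    using assms by (simp add: contraction_semigroup_def contraction_semigroup_axioms_def)
  show ?thesis
    using maximal_ergodic_bound[OF assms(6)] by (simp add: C_def)
qed

end
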